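(* Let $X$ be a closed subset of $\mathbb{R}^n$, let $p\in\mathbb{N}$, and suppose $X\subset M$, where $M$ is a $\mathcal{C}^p$ submanifold of $\mathbb{R}^n$ and $X$ is the closure of its interior in $M$ (interior and closure taken relative to $M$). Then a function $f:X\to\mathbb{R}$ is the restriction of a $\mathcal{C}^p$ function on $\mathbb{R}^n$ if and only if $\nabla^pf:\tau^p(X)\to\mathbb{R}$.
   Context: Notation. Multiindex notation $\alpha\in\mathbb{N}^n$, $|\alpha|$, $\alpha!$, $x^\alpha$. $\mathcal{P}_p$ is the space of real polynomials on $\mathbb{R}^n$ of degree $\le p$, $\mathcal{P}_p^*$ its dual, $r=\dim\mathcal{P}_p$. For $\xi\in\mathcal{P}_p^*$, $b\in\mathbb{R}^n$, $|\alpha|\le p$: $\xi_\alpha(b):=\xi(\tfrac1{\alpha!}(x-b)^\alpha)$; $\delta_a(P)=P(a)$. A bundle over $X$ with fibres in a vector space $W$ is a subset $E\subset X\times W$ whose fibres $E_a$ are linear subspaces. For a bundle $E\subset X\times\mathcal{P}_p^*$: $\Delta E=\{(a,b,\xi+\eta):a,b\in X,\xi\in E_a,\eta\in E_b,|a-b|^{p-|\alpha|}|\eta_\alpha(b)|\le1\ \forall|\alpha|\le p\}$, $E'=\{(a,\xi):(a,a,\xi)\in\overline{\Delta E}\}$ (closure in $X\times X\times\mathcal{P}_p^*$), $\rho(E)=\{(a,\xi):\xi\in\operatorname{Span}E'_a\}$. With $E_0=\{(a,\lambda\delta_a)\}$, $\rho^i(E_0)$ is constant for $i\ge2r$ and $\tau^p(X):=\rho^{2r}(E_0)$.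 For $f:X\to\mathbb{R}$ and bundles $\Phi\subset X\times(\mathcal{P}_p^*\times\mathbb{R})$: $\Delta\Phi=\{(a,b,\xi+\eta,\lambda+\mu):(\xi,\lambda)\in\Phi_a,(\eta,\mu)\in\Phi_b,|a-b|^{p-|\alpha|}|\eta_\alpha(b)|\le1\ \forall|\alpha|\le p\}$, $\Phi'=\{(a,\xi,\lambda):(a,a,\xi,\lambda)\in\overline{\Delta\Phi}\}$, $\rho(\Phi)$ the fibrewise linear span of $\Phi'$. With $\Phi_0=\{(a,\lambda\delta_a,\lambda f(a))\}$, $\nabla^pf:=\rho^{2(r+1)}(\Phi_0)$ (stable from then on); $\nabla^pf\subset\tau^p(X)\times\mathbb{R}$. "$\nabla^pf:\tau^p(X)\to\mathbb{R}$" means that for each $a\in X$, $\xi\in\tau^p_a(X)$ there is exactly one $\lambda$ with $(a,\xi,\lambda)\in\nabla^pf$. *)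

theory Defs
  imports "HOL-Analysis.Analysis"
begin

text \<open>Multi-indices on R^n are functions 'n => nat (the index type 'n is finite,
  CARD('n) = n). An element xi of the dual space of P_p is represented by its values
  on the monomial basis: xi beta = xi(x^beta), for mdeg beta <= p. A polynomial of
  degree <= p is represented by its coefficient function in the monomial basis.
  The topology on the dual space is the product topology on functions.\<close>

definition mdeg :: "('n::finite \<Rightarrow> nat) \<Rightarrow> nat" where
  "mdeg \<alpha> = (\<Sum>i\<in>UNIV. \<alpha> i)"

definition mindex :: "nat \<Rightarrow> ('n::finite \<Rightarrow> nat) set" where
  "mindex p = {\<alpha>. mdeg \<alpha> \<le> p}"

definition mfact :: "('n::finite \<Rightarrow> nat) \<Rightarrow> real" where
  "mfact \<alpha> = (\<Prod>i\<in>UNIV. fact (\<alpha> i))"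

text \<open>Coefficients (in the monomial basis) of the polynomial (x - b)^alpha / alpha!.\<close>
definition shifted_mono :: "real^'n::finite \<Rightarrow> ('n \<Rightarrow> nat) \<Rightarrow> ('n \<Rightarrow> nat) \<Rightarrow> real" where
  "shifted_mono b \<alpha> \<beta> =
     (if (\<forall>i. \<beta> i \<le> \<alpha> i)
      then (\<Prod>i\<in>UNIV. real (\<alpha> i choose \<beta> i) * (- (b$i)) ^ (\<alpha> i - \<beta> i)) / mfact \<alpha>
      else 0)"

definition dual_app :: "nat \<Rightarrow> (('n::finite \<Rightarrow> nat) \<Rightarrow> real) \<Rightarrow> (('n \<Rightarrow> nat) \<Rightarrow> real) \<Rightarrow> real" where
  "dual_app p \<xi> c = (\<Sum>\<beta>\<in>mindex p. c \<beta> * \<xi> \<beta>)"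

definition dual_comp :: "nat \<Rightarrow> (('n::finite \<Rightarrow> nat) \<Rightarrow> real) \<Rightarrow> ('n \<Rightarrow> nat) \<Rightarrow> real^'n \<Rightarrow> real" where
  "dual_comp p \<xi> \<alpha> b = dual_app p \<xi> (shifted_mono b \<alpha>)"

definition pdelta :: "nat \<Rightarrow> real^'n::finite \<Rightarrow> ('n \<Rightarrow> nat) \<Rightarrow> real" where
  "pdelta p a = (\<lambda>\<beta>. if mdeg \<beta> \<le> p then (\<Prod>i\<in>UNIV. (a$i) ^ (\<beta> i)) else 0)"

definition fibre :: "('a \<times> 'w) set \<Rightarrow> 'a \<Rightarrow> 'w set" where
  "fibre E a = {\<xi>. (a, \<xi>) \<in> E}"

definition lspan :: "(('n \<Rightarrow> nat) \<Rightarrow> real) set \<Rightarrow> (('n \<Rightarrow> nat) \<Rightarrow> real) set" where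
  "lspan S = {\<xi>. \<exists>T c. finite T \<and> T \<subseteq> S \<and> \<xi> = (\<lambda>\<beta>. \<Sum>v\<in>T. c v * v \<beta>)}"

definition lspan2 :: "((('n \<Rightarrow> nat) \<Rightarrow> real) \<times> real) set \<Rightarrow> ((('n \<Rightarrow> nat) \<Rightarrow> real) \<times> real) set" where
  "lspan2 S = {(\<xi>, l). \<exists>T c. finite T \<and> T \<subseteq> S \<and>
        \<xi> = (\<lambda>\<beta>. \<Sum>v\<in>T. c v * fst v \<beta>) \<and> l = (\<Sum>v\<in>T. c v * snd v)}"

definition DeltaE :: "nat \<Rightarrow> (real^'n::finite) set \<Rightarrow> ((real^'n) \<times> (('n \<Rightarrow> nat) \<Rightarrow> real)) set
    \<Rightarrow> ((real^'n) \<times> (real^'n) \<times> (('n \<Rightarrow> nat) \<Rightarrow> real)) set" where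
  "DeltaE p X E = {(a, b, \<lambda>\<beta>. \<xi> \<beta> + \<eta> \<beta>) | a b \<xi> \<eta>.
      a \<in> X \<and> b \<in> X \<and> \<xi> \<in> fibre E a \<and> \<eta> \<in> fibre E b \<and>
      (\<forall>\<alpha>. mdeg \<alpha> \<le> p \<longrightarrow> dist a b ^ (p - mdeg \<alpha>) * \<bar>dual_comp p \<eta> \<alpha> b\<bar> \<le> 1)}"

text \<open>Closure in X x X x P_p^*, i.e. the ambient closure intersected with X x X x P_p^*.\<close>
definition primeE :: "nat \<Rightarrow> (real^'n::finite) set \<Rightarrow> ((real^'n) \<times> (('n \<Rightarrow> nat) \<Rightarrow> real)) set
    \<Rightarrow> ((real^'n) \<times> (('n \<Rightarrow> nat) \<Rightarrow> real)) set" where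
  "primeE p X E = {(a, \<xi>). a \<in> X \<and> (a, a, \<xi>) \<in> closure (DeltaE p X E)}"

definition rhoE :: "nat \<Rightarrow> (real^'n::finite) set \<Rightarrow> ((real^'n) \<times> (('n \<Rightarrow> nat) \<Rightarrow> real)) set
    \<Rightarrow> ((real^'n) \<times> (('n \<Rightarrow> nat) \<Rightarrow> real)) set" where
  "rhoE p X E = {(a, \<xi>). a \<in> X \<and> \<xi> \<in> lspan (fibre (primeE p X E) a)}"

definition E0 :: "nat \<Rightarrow> (real^'n::finite) set \<Rightarrow> ((real^'n) \<times> (('n \<Rightarrow> nat) \<Rightarrow> real)) set" where
  "E0 p X = {(a, \<lambda>\<beta>. c * pdelta p a \<beta>) | a c. a \<in> X}"

text \<open>r = dim P_p = card (mindex p).\<close>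
definition tau :: "nat \<Rightarrow> (real^'n::finite) set \<Rightarrow> ((real^'n) \<times> (('n \<Rightarrow> nat) \<Rightarrow> real)) set" where
  "tau p X = (rhoE p X ^^ (2 * card (mindex p :: ('n \<Rightarrow> nat) set))) (E0 p X)"

definition DeltaF :: "nat \<Rightarrow> (real^'n::finite) set \<Rightarrow> ((real^'n) \<times> (('n \<Rightarrow> nat) \<Rightarrow> real) \<times> real) set
    \<Rightarrow> ((real^'n) \<times> (real^'n) \<times> (('n \<Rightarrow> nat) \<Rightarrow> real) \<times> real) set" where
  "DeltaF p X \<Phi> = {(a, b, \<lambda>\<beta>. \<xi> \<beta> + \<eta> \<beta>, l + m) | a b \<xi> \<eta> l m.
      a \<in> X \<and> b \<in> X \<and> (\<xi>, l) \<in> fibre \<Phi> a \<and> (\<eta>, m) \<in> fibre \<Phi> b \<and>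
      (\<forall>\<alpha>. mdeg \<alpha> \<le> p \<longrightarrow> dist a b ^ (p - mdeg \<alpha>) * \<bar>dual_comp p \<eta> \<alpha> b\<bar> \<le> 1)}"

definition primeF :: "nat \<Rightarrow> (real^'n::finite) set \<Rightarrow> ((real^'n) \<times> (('n \<Rightarrow> nat) \<Rightarrow> real) \<times> real) set
    \<Rightarrow> ((real^'n) \<times> (('n \<Rightarrow> nat) \<Rightarrow> real) \<times> real) set" where
  "primeF p X \<Phi> = {(a, \<xi>, l). a \<in> X \<and> (a, a, \<xi>, l) \<in> closure (DeltaF p X \<Phi>)}"

definition rhoF :: "nat \<Rightarrow> (real^'n::finite) set \<Rightarrow> ((real^'n) \<times> (('n \<Rightarrow> nat) \<Rightarrow> real) \<times> real) set
    \<Rightarrow> ((real^'n) \<times> (('n \<Rightarrow> nat) \<Rightarrow> real) \<times> real) set" where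
  "rhoF p X \<Phi> = {(a, v). a \<in> X \<and> v \<in> lspan2 (fibre (primeF p X \<Phi>) a)}"

definition Phi0 :: "nat \<Rightarrow> (real^'n::finite) set \<Rightarrow> (real^'n \<Rightarrow> real)
    \<Rightarrow> ((real^'n) \<times> (('n \<Rightarrow> nat) \<Rightarrow> real) \<times> real) set" where
  "Phi0 p X f = {(a, \<lambda>\<beta>. c * pdelta p a \<beta>, c * f a) | a c. a \<in> X}"

definition nabla :: "nat \<Rightarrow> (real^'n::finite) set \<Rightarrow> (real^'n \<Rightarrow> real)
    \<Rightarrow> ((real^'n) \<times> (('n \<Rightarrow> nat) \<Rightarrow> real) \<times> real) set" where
  "nabla p X f = (rhoF p X ^^ (2 * (card (mindex p :: ('n \<Rightarrow> nat) set) + 1))) (Phi0 p X f)"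

definition Cp_on :: "nat \<Rightarrow> (real^'n::finite) set \<Rightarrow> (real^'n \<Rightarrow> real) \<Rightarrow> bool" where
  "Cp_on p U F \<longleftrightarrow> (\<exists>D :: ('n \<Rightarrow> nat) \<Rightarrow> real^'n \<Rightarrow> real.
      (\<forall>x\<in>U. D (\<lambda>_. 0) x = F x) \<and>
      (\<forall>\<alpha>. mdeg \<alpha> \<le> p \<longrightarrow> continuous_on U (D \<alpha>)) \<and>
      (\<forall>\<alpha> i. mdeg \<alpha> < p \<longrightarrow> (\<forall>x\<in>U.
          ((\<lambda>t. D \<alpha> (x + t *\<^sub>R axis i 1)) has_real_derivative D (\<alpha>(i := Suc (\<alpha> i))) x) (at 0))))"

definition Cp_map_on :: "nat \<Rightarrow> (real^'n::finite) set \<Rightarrow> (real^'n \<Rightarrow> real^'n) \<Rightarrow> bool" where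
  "Cp_map_on p U \<phi> \<longleftrightarrow> (\<forall>j. Cp_on p U (\<lambda>x. \<phi> x $ j))"

definition Cp_diffeo :: "nat \<Rightarrow> (real^'n::finite) set \<Rightarrow> (real^'n) set \<Rightarrow> (real^'n \<Rightarrow> real^'n) \<Rightarrow> bool" where
  "Cp_diffeo p U V \<phi> \<longleftrightarrow> open U \<and> open V \<and> \<phi> ` U = V \<and> Cp_map_on p U \<phi> \<and>
      (\<exists>\<psi>. Cp_map_on p V \<psi> \<and> (\<forall>x\<in>U. \<psi> (\<phi> x) = x))"

definition Cp_submanifold :: "nat \<Rightarrow> (real^'n::finite) set \<Rightarrow> bool" where
  "Cp_submanifold p M \<longleftrightarrow> (\<exists>d. \<forall>m\<in>M. \<exists>U V \<phi> L.
      m \<in> U \<and> Cp_diffeo p U V \<phi> \<and> subspace L \<and> dim L = d \<and> \<phi> ` (M \<inter> U) = V \<inter> L)"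

end

theory Submission
  imports Defs
begin

text \<open>
  If \<open>f\<close> is the restriction of a \<open>C\<^sup>p\<close> function \<open>F\<close>, Taylor's theorem shows by induction that
  \<open>\<rho>\<^sup>i(\<Phi>\<^sub>0)\<close> is the graph over \<open>\<rho>\<^sup>i(E\<^sub>0)\<close> of the map sending a functional \<open>\<xi>\<close> over \<open>a\<close> to its value on
  the Taylor polynomial of \<open>F\<close> at \<open>a\<close>; the iterates increase, so no stabilisation is needed.

  Conversely only uniqueness of the value over the zero functional in \<open>\<rho>\<^bsup>p+2\<^esup>(\<Phi>\<^sub>0)\<close> is needed.
  Compose a chart inverse with a linear projection onto the model subspace: this gives a \<open>C\<^sup>p\<close> map
  \<open>h\<close> from an open subset of \<open>\<real>\<^sup>n\<close> into \<open>M\<close> such that \<open>h\<^sup>-\<^sup>1(X)\<close> is the closure of its interior. The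
  functionals \<open>P \<mapsto> \<partial>\<^sup>\<beta>(P \<circ> h)(y)\<close> are limits of difference quotients at interior points and limits of
  these elsewhere, so they acquire values after \<open>p + 1\<close> steps. One more step shows that these values
  satisfy Whitney's conditions, and Whitney's extension theorem (by a dyadic grid
  partition of unity) extends \<open>f \<circ> h\<close>. Local extensions are then patched together.
\<close>

subsection \<open>Partial derivatives and functions of class \<open>C\<^sup>k\<close>\<close>

text \<open>The obstacle in the converse is to know which functionals carry a value at all.
  Uniqueness over zero settles this: if functionals converge while their values blow up or
  oscillate, rescaling or subtracting produces a nonzero value over the zero functional. So every
  limit that the smallness condition admits has a value, and the values converge to it. The
  condition |a - b|^(p - |\<alpha>|) |\<eta>_\<alpha>(b)| \<le> 1 is met by pulled-back difference
  quotients because the \<alpha>-component at h(y) of the functional P \<mapsto>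
  \<partial>^\<beta>(P o h)(y) is the \<beta>-th derivative at y of (h - h(y))^\<alpha> / \<alpha>!,
  which is zero for |\<beta>| < |\<alpha>|. Parametrizing by an open subset of R^n, rather than by
  the model subspace, keeps all derivatives indexed by the same multi-indices whatever the dimension
  of M. The iteration count suffices because r \<ge> p + 1, by the powers of a single coordinate, so
  that p + 2 \<le> 2(r + 1).\<close>

definition has_partial :: "'n \<Rightarrow> (real^'n::finite \<Rightarrow> real) \<Rightarrow> real \<Rightarrow> real^'n \<Rightarrow> bool" where
  "has_partial i F d x \<longleftrightarrow> ((\<lambda>t. F (x + t *\<^sub>R axis i 1)) has_real_derivative d) (at 0)"

text \<open>\<open>deriv\<close> makes this a total operator that can be iterated freely; existence
  of the derivative is asserted separately through \<open>has_partial\<close>.\<close>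

definition pd :: "'n \<Rightarrow> (real^'n::finite \<Rightarrow> real) \<Rightarrow> real^'n \<Rightarrow> real" where
  "pd i F x = deriv (\<lambda>t. F (x + t *\<^sub>R axis i 1)) 0"

lemma has_partial_imp_pd: "has_partial i F d x \<Longrightarrow> pd i F x = d"
  unfolding has_partial_def pd_def by (rule DERIV_imp_deriv)

lemma has_partial_unique: "has_partial i F d x \<Longrightarrow> has_partial i F e x \<Longrightarrow> d = e"
  using has_partial_imp_pd by metis

lemma has_partial_along:
  assumes "has_partial i F d (x + s *\<^sub>R axis i 1)"
  shows "((\<lambda>t. F (x + t *\<^sub>R axis i 1)) has_real_derivative d) (at s)"
proof -
  have "((\<lambda>t. F ((x + s *\<^sub>R axis i 1) + t *\<^sub>R axis i 1)) has_real_derivative d) (at 0)"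
    using assms unfolding has_partial_def .
  then have "((\<lambda>t. (\<lambda>u. F (x + u *\<^sub>R axis i 1)) (t + s)) has_real_derivative d) (at 0)"
    by (simp add: algebra_simps scaleR_add_left)
  then have "((\<lambda>u. F (x + u *\<^sub>R axis i 1)) has_real_derivative d) (at (0 + s))"
    by (subst DERIV_shift) simp
  then show ?thesis by simp
qed

lemma line_in_open:
  fixes x :: "real^'n::finite"
  assumes "open U" "x \<in> U"
  shows "eventually (\<lambda>t. x + t *\<^sub>R axis i 1 \<in> U) (nhds (0::real))"
proof -
  have "((\<lambda>t. x + t *\<^sub>R axis i 1) \<longlongrightarrow> x + 0 *\<^sub>R axis i (1::real)) (nhds (0::real))"
    by (intro tendsto_intros filterlim_ident)
  then have "((\<lambda>t. x + t *\<^sub>R axis i 1) \<longlongrightarrow> x) (nhds (0::real))" by simp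
  then show ?thesis using assms by (rule topological_tendstoD)
qed

lemma has_partial_cong:
  assumes "open U" "x \<in> U" "\<And>y. y \<in> U \<Longrightarrow> F y = G y" "has_partial i F d x"
  shows "has_partial i G d x"
proof -
  have "eventually (\<lambda>t. F (x + t *\<^sub>R axis i 1) = G (x + t *\<^sub>R axis i 1)) (nhds 0)"
    using line_in_open[OF assms(1,2)] by eventually_elim (use assms(3) in auto)
  then show ?thesis
    using assms(4) unfolding has_partial_def by (subst (asm) DERIV_cong_ev[OF refl _ refl]) auto
qed

lemma pd_cong:
  assumes "open U" "x \<in> U" "\<And>y. y \<in> U \<Longrightarrow> F y = G y"
  shows "pd i F x = pd i G x"
proof -
  have "eventually (\<lambda>t. F (x + t *\<^sub>R axis i 1) = G (x + t *\<^sub>R axis i 1)) (nhds 0)"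
    using line_in_open[OF assms(1,2)] by eventually_elim (use assms(3) in auto)
  then show ?thesis unfolding pd_def by (rule deriv_cong_ev) simp
qed

lemma has_partial_const: "has_partial i (\<lambda>x. c) 0 x"
  unfolding has_partial_def by simp

lemma has_partial_add:
  "has_partial i F d x \<Longrightarrow> has_partial i G e x \<Longrightarrow> has_partial i (\<lambda>x. F x + G x) (d + e) x"
  unfolding has_partial_def by (rule DERIV_add)

lemma has_partial_diff:
  "has_partial i F d x \<Longrightarrow> has_partial i G e x \<Longrightarrow> has_partial i (\<lambda>x. F x - G x) (d - e) x"
  unfolding has_partial_def by (rule DERIV_diff)

lemma has_partial_mult:
  assumes "has_partial i F d x" "has_partial i G e x"
  shows "has_partial i (\<lambda>x. F x * G x) (d * G x + F x * e) x"
  using DERIV_mult[OF assms[unfolded has_partial_def]] unfolding has_partial_def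
  by (simp add: algebra_simps)

lemma has_partial_cmult: "has_partial i F d x \<Longrightarrow> has_partial i (\<lambda>x. c * F x) (c * d) x"
  unfolding has_partial_def by (rule DERIV_cmult)

lemma has_partial_sum:
  "(\<And>q. q \<in> Q \<Longrightarrow> has_partial i (F q) (d q) x) \<Longrightarrow>
    has_partial i (\<lambda>x. \<Sum>q\<in>Q. F q x) (\<Sum>q\<in>Q. d q) x"
  unfolding has_partial_def by (rule DERIV_sum)

lemma has_derivative_imp_has_partial:
  assumes "(F has_derivative F') (at x)"
  shows "has_partial i F (F' (axis i 1)) x"
proof -
  interpret bounded_linear F' using assms by (rule has_derivative_bounded_linear)
  have "((\<lambda>t. x + t *\<^sub>R axis i 1) has_derivative (\<lambda>t. t *\<^sub>R axis i (1::real))) (at (0::real))"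
    by (auto intro!: derivative_eq_intros)
  moreover have "(F has_derivative F') (at (x + 0 *\<^sub>R axis i 1))" using assms by simp
  ultimately have "((\<lambda>t. F (x + t *\<^sub>R axis i 1)) has_derivative (\<lambda>t. F' (t *\<^sub>R axis i 1))) (at 0)"
    using has_derivative_compose by blast
  then show ?thesis
    unfolding has_partial_def has_field_derivative_def by (simp add: scaleR mult_commute_abs)
qed

text \<open>Recursion through \<open>pd\<close> lets products and compositions be handled by
  induction on \<open>k\<close>. The multi-index families that \<open>Cp_on\<close> asks for
  presuppose symmetric mixed derivatives and are recovered in \<open>Ck_imp_Cp_on\<close>.\<close>

fun Ck :: "nat \<Rightarrow> (real^'n::finite) set \<Rightarrow> (real^'n \<Rightarrow> real) \<Rightarrow> bool" where
  "Ck 0 U F \<longleftrightarrow> continuous_on U F"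
| "Ck (Suc k) U F \<longleftrightarrow> continuous_on U F \<and>
     (\<forall>i. (\<forall>x\<in>U. has_partial i F (pd i F x) x) \<and> Ck k U (pd i F))"

lemma Ck_imp_continuous_on: "Ck k U F \<Longrightarrow> continuous_on U F"
  by (cases k) auto

lemma Ck_cong:
  assumes "open U" "\<And>y. y \<in> U \<Longrightarrow> F y = G y" "Ck k U F"
  shows "Ck k U G"
  using assms(2,3)
proof (induction k arbitrary: F G)
  case 0
  then show ?case using continuous_on_cong[of U U F G] by auto
next
  case (Suc k)
  have pd: "pd i F x = pd i G x" if "x \<in> U" for i x
    using pd_cong[OF assms(1) that Suc.prems(1)] by simp
  have "Ck k U (pd i G)" for i using Suc.IH[OF pd] Suc.prems(2) by auto
  moreover have "has_partial i G (pd i G x) x" if "x \<in> U" for i x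
    using has_partial_cong[OF assms(1) that Suc.prems(1)] Suc.prems(2) that pd by auto
  moreover have "continuous_on U G"
    using Suc.prems continuous_on_cong[of U U F G] by auto
  ultimately show ?case by simp
qed

lemma Ck_SucI:
  assumes "open U" "continuous_on U F" "\<And>i x. x \<in> U \<Longrightarrow> has_partial i F (D i x) x"
    "\<And>i. Ck k U (D i)"
  shows "Ck (Suc k) U F"
proof -
  have pd: "D i x = pd i F x" if "x \<in> U" for i x
    using assms(3)[OF that] has_partial_imp_pd by metis
  have "Ck k U (pd i F)" for i using Ck_cong[OF assms(1) pd assms(4)] .
  then show ?thesis using assms(2,3) pd by auto
qed

lemma Ck_SucD: "Ck (Suc k) U F \<Longrightarrow> Ck k U F"
  by (induction k arbitrary: F) auto

lemma Ck_subset: "Ck k U F \<Longrightarrow> V \<subseteq> U \<Longrightarrow> Ck k V F"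
  by (induction k arbitrary: F) (auto intro: continuous_on_subset)

lemma Ck_local:
  assumes "\<And>x. x \<in> U \<Longrightarrow> \<exists>V. open V \<and> x \<in> V \<and> Ck k V F"
  shows "Ck k U F"
  using assms
proof (induction k arbitrary: F)
  case 0
  have "continuous (at x within U) F" if "x \<in> U" for x
  proof -
    obtain V where "open V" "x \<in> V" "Ck 0 V F" using 0 \<open>x \<in> U\<close> by blast
    then show ?thesis by (simp add: continuous_on_eq_continuous_at continuous_at_imp_continuous_at_within)
  qed
  then show ?case by (simp add: continuous_on_eq_continuous_within)
next
  case (Suc k)
  have "continuous (at x within U) F" if "x \<in> U" for x
  proof -
    obtain V where "open V" "x \<in> V" "Ck (Suc k) V F" using Suc.prems \<open>x \<in> U\<close> by blast
    then show ?thesis by (simp add: continuous_on_eq_continuous_at continuous_at_imp_continuous_at_within)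
  qed
  then have "continuous_on U F" by (simp add: continuous_on_eq_continuous_within)
  moreover have "Ck k U (pd i F)" for i
    by (rule Suc.IH) (use Suc.prems in fastforce)
  moreover have "has_partial i F (pd i F x) x" if "x \<in> U" for i x
    using Suc.prems[OF that] by auto
  ultimately show ?case by simp
qed

lemma Ck_const: "Ck k U (\<lambda>x. c)"
proof (induction k arbitrary: c)
  case (Suc k)
  have "pd i (\<lambda>x. c) = (\<lambda>x. 0)" for i :: 'a
    by (auto intro!: ext has_partial_imp_pd has_partial_const)
  then show ?case using Suc by (auto intro: has_partial_const)
qed auto

lemma pd_add:
  "has_partial i F (pd i F x) x \<Longrightarrow> has_partial i G (pd i G x) x \<Longrightarrow>
    pd i (\<lambda>x. F x + G x) x = pd i F x + pd i G x"
  by (intro has_partial_imp_pd has_partial_add)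

lemma Ck_add:
  assumes "open U" "Ck k U F" "Ck k U G"
  shows "Ck k U (\<lambda>x. F x + G x)"
  using assms(2,3)
proof (induction k arbitrary: F G)
  case 0
  then show ?case by (auto intro: continuous_intros)
next
  case (Suc k)
  show ?case
    by (rule Ck_SucI[OF assms(1), where D = "\<lambda>i x. pd i F x + pd i G x"])
      (use Suc in \<open>auto intro: continuous_intros has_partial_add\<close>)
qed

lemma Ck_mult:
  assumes "open U" "Ck k U F" "Ck k U G"
  shows "Ck k U (\<lambda>x. F x * G x)"
  using assms(2,3)
proof (induction k arbitrary: F G)
  case 0
  then show ?case by (auto intro: continuous_intros)
next
  case (Suc k)
  have F: "Ck k U F" and G: "Ck k U G" using Suc.prems Ck_SucD by blast+
  show ?case
    by (rule Ck_SucI[OF assms(1), where D = "\<lambda>i x. pd i F x * G x + F x * pd i G x"])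
      (use Suc F G in \<open>auto intro: continuous_intros has_partial_mult Ck_add[OF assms(1)]\<close>)
qed

lemma Ck_cmult: "open U \<Longrightarrow> Ck k U F \<Longrightarrow> Ck k U (\<lambda>x. c * F x)"
  using Ck_mult[OF _ Ck_const] .

lemma Ck_diff: "open U \<Longrightarrow> Ck k U F \<Longrightarrow> Ck k U G \<Longrightarrow> Ck k U (\<lambda>x. F x - G x)"
  using Ck_add[of U k F "\<lambda>x. (-1) * G x"] Ck_cmult[of U k G "-1"] by simp

lemma Ck_sum:
  assumes "open U" "\<And>q. q \<in> Q \<Longrightarrow> Ck k U (F q)"
  shows "Ck k U (\<lambda>x. \<Sum>q\<in>Q. F q x)"
  using assms(2)
  by (induction Q rule: infinite_finite_induct) (auto intro: Ck_add[OF assms(1)] Ck_const)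

lemma Ck_prod:
  assumes "open U" "\<And>q. q \<in> Q \<Longrightarrow> Ck k U (F q)"
  shows "Ck k U (\<lambda>x. \<Prod>q\<in>Q. F q x)"
  using assms(2)
  by (induction Q rule: infinite_finite_induct) (auto intro: Ck_mult[OF assms(1)] Ck_const)

lemma Ck_power: "open U \<Longrightarrow> Ck k U F \<Longrightarrow> Ck k U (\<lambda>x. F x ^ m)"
  by (induction m) (auto intro: Ck_const Ck_mult)

lemma Ck_bounded_linear:
  assumes "bounded_linear h"
  shows "Ck k UNIV h"
proof (cases k)
  case 0
  then show ?thesis using assms by (simp add: linear_continuous_on)
next
  case (Suc l)
  have "Ck (Suc l) UNIV h"
    by (rule Ck_SucI[where D = "\<lambda>i x. h (axis i 1)"])
      (use assms in \<open>auto simp: linear_continuous_on bounded_linear_imp_has_derivative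
        intro: Ck_const has_derivative_imp_has_partial\<close>)
  then show ?thesis using Suc by simp
qed

text \<open>Move along the coordinates one at a time.\<close>

lemma partial_increment_bound:
  fixes F :: "real^'n::finite \<Rightarrow> real"
  assumes "\<And>i y. y \<in> ball x r \<Longrightarrow> has_partial i F (D i y) y"
    and "\<And>i y. y \<in> ball x r \<Longrightarrow> \<bar>D i y - D i x\<bar> \<le> e"
    and "norm h < r" "finite I"
  shows "\<bar>F (x + (\<Sum>i\<in>I. h$i *\<^sub>R axis i 1)) - F x - (\<Sum>i\<in>I. h$i * D i x)\<bar> \<le> e * (\<Sum>i\<in>I. \<bar>h$i\<bar>)"
  using \<open>finite I\<close>
proof (induction I rule: finite_induct)
  case (insert j I)
  define z where "z = x + (\<Sum>i\<in>I. h$i *\<^sub>R axis i (1::real))"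
  define s where "s = h$j"
  have comp: "(\<Sum>i\<in>I. h$i *\<^sub>R axis i (1::real)) $ k = (if k \<in> I then h$k else 0)" for k
    using \<open>finite I\<close> by (simp add: axis_def if_distrib cong: if_cong)
  \<comment> \<open>Componentwise the displacement from \<open>x\<close> is dominated by
    \<open>h\<close>: coordinates in \<open>I\<close> carry \<open>h$k\<close>, the
    \<open>j\<close>-th carries \<open>t\<close>, all others 0. So every point visited stays in the
    ball.\<close>
  have zin: "z + t *\<^sub>R axis j 1 \<in> ball x r" if "\<bar>t\<bar> \<le> \<bar>s\<bar>" for t
  proof -
    have "norm ((\<Sum>i\<in>I. h$i *\<^sub>R axis i (1::real)) + t *\<^sub>R axis j 1) \<le> norm h"
    proof (rule norm_le_componentwise_cart)
      fix k
      show "norm (((\<Sum>i\<in>I. h$i *\<^sub>R axis i (1::real)) + t *\<^sub>R axis j 1) $ k) \<le> norm (h $ k)"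
        using that insert.hyps(2) unfolding vector_add_component comp s_def by (auto simp: axis_def)
    qed
    then show ?thesis using assms(3) unfolding z_def by (simp add: dist_norm norm_minus_commute add.assoc add.commute[of "t *\<^sub>R _"])
  qed
  have der: "((\<lambda>t. F (z + t *\<^sub>R axis j 1)) has_real_derivative D j (z + t *\<^sub>R axis j 1)) (at t)"
    if "\<bar>t\<bar> \<le> \<bar>s\<bar>" for t
    by (intro has_partial_along assms(1) zin that)
  have "\<exists>u. \<bar>u\<bar> \<le> \<bar>s\<bar> \<and> F (z + s *\<^sub>R axis j 1) - F z = s * D j (z + u *\<^sub>R axis j 1)"
  proof -
    consider "s = 0" | "s > 0" | "s < 0" by linarith
    then show ?thesis
    proof cases
      case 1 then show ?thesis by auto
    next
      case 2
      then obtain u where "0 < u" "u < s"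
        "F (z + s *\<^sub>R axis j 1) - F (z + 0 *\<^sub>R axis j 1) = (s - 0) * D j (z + u *\<^sub>R axis j 1)"
        using MVT2[of 0 s "\<lambda>t. F (z + t *\<^sub>R axis j 1)" "\<lambda>t. D j (z + t *\<^sub>R axis j 1)"] der by auto
      then show ?thesis by (auto intro!: exI[of _ u])
    next
      case 3
      then obtain u where "s < u" "u < 0"
        "F (z + 0 *\<^sub>R axis j 1) - F (z + s *\<^sub>R axis j 1) = (0 - s) * D j (z + u *\<^sub>R axis j 1)"
        using MVT2[of s 0 "\<lambda>t. F (z + t *\<^sub>R axis j 1)" "\<lambda>t. D j (z + t *\<^sub>R axis j 1)"] der by auto
      then show ?thesis by (auto intro!: exI[of _ u] simp: algebra_simps)
    qed
  qed
  then obtain u where u: "\<bar>u\<bar> \<le> \<bar>s\<bar>" "F (z + s *\<^sub>R axis j 1) - F z = s * D j (z + u *\<^sub>R axis j 1)"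
    by blast
  have "\<bar>F (z + s *\<^sub>R axis j 1) - F z - s * D j x\<bar> = \<bar>s\<bar> * \<bar>D j (z + u *\<^sub>R axis j 1) - D j x\<bar>"
    using u(2) by (simp add: abs_mult[symmetric] algebra_simps)
  also have "\<dots> \<le> \<bar>s\<bar> * e" by (intro mult_left_mono assms(2) zin u) auto
  finally have 1: "\<bar>F (z + s *\<^sub>R axis j 1) - F z - s * D j x\<bar> \<le> \<bar>s\<bar> * e" .
  have 2: "\<bar>F z - F x - (\<Sum>i\<in>I. h$i * D i x)\<bar> \<le> e * (\<Sum>i\<in>I. \<bar>h$i\<bar>)"
    using insert.IH unfolding z_def .
  have 3: "x + (\<Sum>i\<in>insert j I. h$i *\<^sub>R axis i (1::real)) = z + s *\<^sub>R axis j 1"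
    unfolding z_def s_def using insert.hyps by (simp add: algebra_simps)
  have 4: "(\<Sum>i\<in>insert j I. h$i * D i x) = s * D j x + (\<Sum>i\<in>I. h$i * D i x)"
    "e * (\<Sum>i\<in>insert j I. \<bar>h$i\<bar>) = \<bar>s\<bar> * e + e * (\<Sum>i\<in>I. \<bar>h$i\<bar>)"
    unfolding s_def using insert.hyps by (auto simp: algebra_simps)
  show ?case unfolding 3 4 using 1 2 by linarith
qed auto

text \<open>Near \<open>x\<close> all partial derivatives are within \<open>e'\<close> of their
  values at \<open>x\<close>, so moving along the coordinates makes an error of at most
  \<open>e'\<close> times the l1 norm of the increment.\<close>

lemma has_derivative_of_partials:
  fixes F :: "real^'n::finite \<Rightarrow> real"
  assumes "open U" "x \<in> U" "\<And>i y. y \<in> U \<Longrightarrow> has_partial i F (D i y) y"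
    "\<And>i. continuous_on U (D i)"
  shows "(F has_derivative (\<lambda>h. \<Sum>i\<in>UNIV. h$i * D i x)) (at x)"
proof (rule has_derivativeI)
  show "bounded_linear (\<lambda>h::real^'n. \<Sum>i\<in>UNIV. h$i * D i x)"
    by (intro bounded_linear_sum bounded_linear_mult_const bounded_linear_vec_nth)
  show "((\<lambda>y. ((F y - F x) - (\<Sum>i\<in>UNIV. (y - x)$i * D i x)) /\<^sub>R norm (y - x)) \<longlongrightarrow> 0) (at x)"
  proof (rule tendstoI)
    fix e :: real assume "e > 0"
    \<comment> \<open>There are \<open>CARD('n)\<close> coordinates, each bounded by
      \<open>norm h\<close>; the factor 2 makes the final estimate strict.\<close>
    define e' where "e' = e / (2 * CARD('n))"
    have "e' > 0" using \<open>e > 0\<close> by (simp add: e'_def)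
    have "\<forall>\<^sub>F y in nhds x. \<forall>i\<in>UNIV. \<bar>D i y - D i x\<bar> \<le> e'"
    proof (intro eventually_ball_finite finite ballI)
      fix i
      have "(D i \<longlongrightarrow> D i x) (nhds x)"
        using assms continuous_on_eq_continuous_at[of U "D i"] continuous_at tendsto_at_iff_tendsto_nhds isCont_def
        by blast
      then show "\<forall>\<^sub>F y in nhds x. \<bar>D i y - D i x\<bar> \<le> e'"
        using \<open>e' > 0\<close> by (auto dest!: tendstoD[of _ _ _ e'] simp: dist_real_def elim: eventually_mono)
    qed
    moreover have "\<forall>\<^sub>F y in nhds x. y \<in> U" using assms eventually_nhds by blast
    ultimately have "\<forall>\<^sub>F y in nhds x. (\<forall>i. \<bar>D i y - D i x\<bar> \<le> e') \<and> y \<in> U"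
      by eventually_elim auto
    then obtain r where r: "r > 0" "\<And>y. y \<in> ball x r \<Longrightarrow> (\<forall>i. \<bar>D i y - D i x\<bar> \<le> e') \<and> y \<in> U"
      unfolding eventually_nhds_metric by (auto simp: dist_commute)
    have "dist (((F y - F x) - (\<Sum>i\<in>UNIV. (y - x)$i * D i x)) /\<^sub>R norm (y - x)) 0 < e"
      if y: "y \<noteq> x" "dist y x < r" for y
    proof -
      define h where "h = y - x"
      have nh: "norm h < r" "norm h > 0" using y by (auto simp: h_def dist_norm)
      have eq: "x + (\<Sum>i\<in>UNIV. h$i *\<^sub>R axis i 1) = y"
        using basis_expansion[of h] unfolding h_def by (simp add: scalar_mult_eq_scaleR)
      have "\<bar>F (x + (\<Sum>i\<in>UNIV. h$i *\<^sub>R axis i 1)) - F x - (\<Sum>i\<in>UNIV. h$i * D i x)\<bar>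
          \<le> e' * (\<Sum>i\<in>UNIV. \<bar>h$i\<bar>)"
        by (rule partial_increment_bound[of x r F D]) (use r nh assms(3) in auto)
      also have "\<dots> \<le> e' * (\<Sum>i\<in>(UNIV::'n set). norm h)"
        using \<open>e' > 0\<close> by (intro mult_left_mono sum_mono) (auto simp: component_le_norm_cart)
      also have "\<dots> = e / 2 * norm h" by (simp add: e'_def)
      finally have "\<bar>F y - F x - (\<Sum>i\<in>UNIV. h$i * D i x)\<bar> \<le> e / 2 * norm h" unfolding eq .
      also have "\<dots> < e * norm h" using nh \<open>e > 0\<close> by simp
      finally have "\<bar>F y - F x - (\<Sum>i\<in>UNIV. h$i * D i x)\<bar> / norm h < e"
        using nh by (simp add: divide_simps)
      then show ?thesis by (simp add: h_def dist_norm abs_mult divide_inverse mult.commute)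
    qed
    then show "\<forall>\<^sub>F y in at x. dist (((F y - F x) - (\<Sum>i\<in>UNIV. (y - x)$i * D i x)) /\<^sub>R norm (y - x)) 0 < e"
      unfolding eventually_at using r(1) by blast
  qed
qed

section \<open>The chain rule for functions of class C^k\<close>

lemma Ck_has_derivative:
  assumes "open U" "x \<in> U" "Ck (Suc k) U F"
  shows "(F has_derivative (\<lambda>h. \<Sum>i\<in>UNIV. h$i * pd i F x)) (at x)"
  by (rule has_derivative_of_partials[OF assms(1,2)]) (use assms(3) Ck_imp_continuous_on in auto)

lemma continuous_on_vec_components:
  assumes "\<And>j. continuous_on U (\<lambda>x. \<phi> x $ j)"
  shows "continuous_on U \<phi>"
proof -
  have "continuous_on U (\<lambda>x. \<chi> j. \<phi> x $ j)" by (intro continuous_on_vec_lambda assms)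
  then show ?thesis by simp
qed

text \<open>By the chain rule a first derivative of the composite is a sum of products of a
  derivative of \<open>\<phi>\<close> with a derivative of \<open>F\<close> composed with
  \<open>\<phi>\<close>; the induction hypothesis covers the latter with the order lowered by
  one.\<close>

lemma Ck_compose:
  fixes \<phi> :: "real^'m::finite \<Rightarrow> real^'n::finite"
  assumes "open U" "open V" "\<phi> ` U \<subseteq> V" "Ck k V F" "\<And>j. Ck k U (\<lambda>x. \<phi> x $ j)"
  shows "Ck k U (\<lambda>x. F (\<phi> x))"
  using assms(4,5)
proof (induction k arbitrary: F)
  case 0
  have "continuous_on U \<phi>"
    by (rule continuous_on_vec_components) (use 0 in auto)
  then show ?case using 0 assms(3) continuous_on_compose2[of V F U \<phi>] by simp
next
  case (Suc k)
  have cF: "continuous_on V F" using Suc.prems(1) Ck_imp_continuous_on by blast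
  have c: "continuous_on U \<phi>"
    by (rule continuous_on_vec_components) (use Suc.prems(2) Ck_imp_continuous_on in blast)
  show ?case
  proof (rule Ck_SucI[OF assms(1), where D = "\<lambda>i x. \<Sum>j\<in>UNIV. pd i (\<lambda>x. \<phi> x $ j) x * pd j F (\<phi> x)"])
    show "continuous_on U (\<lambda>x. F (\<phi> x))"
      using continuous_on_compose2[OF cF c] assms(3) by blast
    show "Ck k U (\<lambda>x. \<Sum>j\<in>UNIV. pd i (\<lambda>x. \<phi> x $ j) x * pd j F (\<phi> x))" for i
      proof (rule Ck_sum[OF assms(1)])
      fix j
      have "Ck k U (\<lambda>x. pd j F (\<phi> x))"
        by (rule Suc.IH) (use Suc.prems(1) Ck_SucD[OF Suc.prems(2)] in auto)
      then show "Ck k U (\<lambda>x. pd i (\<lambda>x. \<phi> x $ j) x * pd j F (\<phi> x))"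
        using Suc.prems(2)[of j] by (intro Ck_mult[OF assms(1)]) auto
    qed
    fix i x assume x: "x \<in> U"
    have "((\<lambda>t. \<phi> (x + t *\<^sub>R axis i 1)) has_vector_derivative (\<chi> j. pd i (\<lambda>x. \<phi> x $ j) x)) (at 0)"
    proof -
      have "((\<lambda>t. \<phi> (x + t *\<^sub>R axis i 1)) has_derivative (\<lambda>t. t *\<^sub>R (\<chi> j. pd i (\<lambda>x. \<phi> x $ j) x))) (at 0)"
      proof (subst has_derivative_componentwise_within, rule ballI)
        fix b :: "real^'n" assume "b \<in> Basis"
        then obtain j where b: "b = axis j 1" by (auto simp: Basis_vec_def)
        have "has_partial i (\<lambda>x. \<phi> x $ j) (pd i (\<lambda>x. \<phi> x $ j) x) x" using Suc.prems(2) x by auto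
        then show "((\<lambda>t. \<phi> (x + t *\<^sub>R axis i 1) \<bullet> b) has_derivative (\<lambda>t. (t *\<^sub>R (\<chi> j. pd i (\<lambda>x. \<phi> x $ j) x)) \<bullet> b)) (at 0)"
          unfolding b has_partial_def has_field_derivative_def
          by (simp add: inner_axis mult.commute[of _ "pd _ _ _"] fun_eq_iff)
      qed
      then show ?thesis unfolding has_vector_derivative_def .
    qed
    moreover have "(F has_derivative (\<lambda>h. \<Sum>j\<in>UNIV. h$j * pd j F (\<phi> x))) (at (\<phi> (x + 0 *\<^sub>R axis i 1)))"
      using Ck_has_derivative[OF assms(2) _ Suc.prems(1)] x assms(3) by auto
    ultimately have "((\<lambda>t. F (\<phi> (x + t *\<^sub>R axis i 1))) has_derivative
       (\<lambda>t. \<Sum>j\<in>UNIV. (t *\<^sub>R (\<chi> j. pd i (\<lambda>x. \<phi> x $ j) x))$j * pd j F (\<phi> x))) (at 0)"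
      unfolding has_vector_derivative_def using has_derivative_compose by blast
    moreover have "(\<lambda>t. \<Sum>j\<in>UNIV. (t *\<^sub>R (\<chi> j. pd i (\<lambda>x. \<phi> x $ j) x))$j * pd j F (\<phi> x)) =
        (*) (\<Sum>j\<in>UNIV. pd i (\<lambda>x. \<phi> x $ j) x * pd j F (\<phi> x))"
      by (auto simp: fun_eq_iff sum_distrib_left mult_ac)
    ultimately show "has_partial i (\<lambda>x. F (\<phi> x)) (\<Sum>j\<in>UNIV. pd i (\<lambda>x. \<phi> x $ j) x * pd j F (\<phi> x)) x"
      unfolding has_partial_def has_field_derivative_def by simp
  qed
qed

text \<open>Both mixed partial derivatives occur as intermediate values of the same second difference.\<close>

lemma second_difference:
  fixes F :: "real^'n::finite \<Rightarrow> real"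
  assumes "\<And>y. y \<in> ball x r \<Longrightarrow> has_partial i F (pd i F y) y"
    "\<And>y. y \<in> ball x r \<Longrightarrow> has_partial j (pd i F) (pd j (pd i F) y) y" "0 < s" "2 * s < r"
  shows "\<exists>z. dist x z < r \<and> F (x + s *\<^sub>R axis i 1 + s *\<^sub>R axis j 1) - F (x + s *\<^sub>R axis i 1)
      - F (x + s *\<^sub>R axis j 1) + F x = s * s * pd j (pd i F) z"
proof -
  have inb: "x + u *\<^sub>R axis i 1 + v *\<^sub>R axis j 1 \<in> ball x r" if "0 \<le> u" "u \<le> s" "0 \<le> v" "v \<le> s" for u v
  proof -
    have "norm (u *\<^sub>R axis i (1::real) + v *\<^sub>R axis j 1) \<le> u + v"
      by (rule order_trans[OF norm_triangle_ineq]) (use that in simp)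
    then have "norm (- (u *\<^sub>R axis i (1::real) + v *\<^sub>R axis j 1)) < r"
      unfolding norm_minus_cancel using that assms by linarith
    then show ?thesis by (simp add: dist_norm algebra_simps)
  qed
  define g where "g u = F (x + s *\<^sub>R axis j 1 + u *\<^sub>R axis i 1) - F (x + u *\<^sub>R axis i 1)" for u
  have dg: "(g has_real_derivative pd i F (x + s *\<^sub>R axis j 1 + u *\<^sub>R axis i 1) - pd i F (x + u *\<^sub>R axis i 1)) (at u)"
    if "0 \<le> u" "u \<le> s" for u
    unfolding g_def using inb[of u s] inb[of u 0] that assms(3)
    by (intro DERIV_diff has_partial_along assms(1)) (auto simp: algebra_simps)
  obtain u where u: "0 < u" "u < s" "g s - g 0 = (s - 0) * (pd i F (x + s *\<^sub>R axis j 1 + u *\<^sub>R axis i 1) - pd i F (x + u *\<^sub>R axis i 1))"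
    using MVT2[OF assms(3) dg] by blast
  have dh: "((\<lambda>v. pd i F (x + u *\<^sub>R axis i 1 + v *\<^sub>R axis j 1)) has_real_derivative
      pd j (pd i F) (x + u *\<^sub>R axis i 1 + v *\<^sub>R axis j 1)) (at v)" if "0 \<le> v" "v \<le> s" for v
    using inb[of u v] that u by (intro has_partial_along assms(2)) auto
  obtain v where v: "0 < v" "v < s" "pd i F (x + u *\<^sub>R axis i 1 + s *\<^sub>R axis j 1) - pd i F (x + u *\<^sub>R axis i 1 + 0 *\<^sub>R axis j 1) =
     (s - 0) * pd j (pd i F) (x + u *\<^sub>R axis i 1 + v *\<^sub>R axis j 1)"
    using MVT2[OF assms(3) dh] by blast
  have "g s - g 0 = s * (s * pd j (pd i F) (x + u *\<^sub>R axis i 1 + v *\<^sub>R axis j 1))"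
    using u(3) v(3) by (simp add: algebra_simps)
  then show ?thesis using inb[of u v] u v unfolding g_def
    by (intro exI[of _ "x + u *\<^sub>R axis i 1 + v *\<^sub>R axis j 1"]) (auto simp: algebra_simps)
qed

text \<open>The second difference is symmetric in \<open>i\<close> and \<open>j\<close>, so the two
  mixed derivatives share a value, attained at two possibly different points near \<open>x\<close>.
  Continuity puts these values within \<open>e\<close>, half the supposed gap, of those at
  \<open>x\<close>: a contradiction.\<close>

lemma pd_commute:
  fixes F :: "real^'n::finite \<Rightarrow> real"
  assumes "open U" "x \<in> U" "Ck (Suc (Suc k)) U F"
  shows "pd i (pd j F) x = pd j (pd i F) x"
proof (rule ccontr)
  define e where "e = \<bar>pd i (pd j F) x - pd j (pd i F) x\<bar> / 2"
  assume "pd i (pd j F) x \<noteq> pd j (pd i F) x"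
  then have e: "e > 0" by (simp add: e_def)
  have cont: "isCont (pd a (pd b F)) x" for a b
    using assms Ck_imp_continuous_on[of k U "pd a (pd b F)"] by (auto simp: continuous_on_eq_continuous_at)
  have near: "\<forall>\<^sub>F y in nhds x. dist (pd a (pd b F) y) (pd a (pd b F) x) < e" for a b
    using cont[of a b] e unfolding isCont_def tendsto_at_iff_tendsto_nhds by (rule tendstoD)
  have "\<forall>\<^sub>F y in nhds x. y \<in> U" using assms eventually_nhds by blast
  then have "\<forall>\<^sub>F y in nhds x. y \<in> U \<and> dist (pd i (pd j F) y) (pd i (pd j F) x) < e \<and>
      dist (pd j (pd i F) y) (pd j (pd i F) x) < e"
    using near[of i j] near[of j i] by eventually_elim auto
  then obtain r where r: "r > 0" "\<And>y. dist x y < r \<Longrightarrow> y \<in> U \<and> dist (pd i (pd j F) y) (pd i (pd j F) x) < e \<and>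
      dist (pd j (pd i F) y) (pd j (pd i F) x) < e"
    unfolding eventually_nhds_metric by (auto simp: dist_commute)
  define s where "s = r / 3"
  have s: "0 < s" "2 * s < r" using r by (auto simp: s_def)
  obtain z where z: "dist x z < r" "F (x + s *\<^sub>R axis i 1 + s *\<^sub>R axis j 1) - F (x + s *\<^sub>R axis i 1)
      - F (x + s *\<^sub>R axis j 1) + F x = s * s * pd j (pd i F) z"
    using second_difference[of x r i F j s] r assms(3) s by auto
  obtain w where w: "dist x w < r" "F (x + s *\<^sub>R axis j 1 + s *\<^sub>R axis i 1) - F (x + s *\<^sub>R axis j 1)
      - F (x + s *\<^sub>R axis i 1) + F x = s * s * pd i (pd j F) w"
    using second_difference[of x r j F i s] r assms(3) s by auto
  have "s * s * pd j (pd i F) z = s * s * pd i (pd j F) w"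
    using z(2) w(2) by (simp add: algebra_simps)
  then have "pd j (pd i F) z = pd i (pd j F) w" using s by simp
  then show False using r(2)[OF z(1)] r(2)[OF w(1)] e unfolding e_def dist_real_def by (smt (verit) field_sum_of_halves)
qed

subsection \<open>Families of derivatives\<close>

definition inc :: "'n \<Rightarrow> ('n \<Rightarrow> nat) \<Rightarrow> 'n \<Rightarrow> nat" where
  "inc i \<alpha> = \<alpha>(i := Suc (\<alpha> i))"

lemma inc_commute: "inc i (inc j \<alpha>) = inc j (inc i \<alpha>)"
  by (auto simp: inc_def fun_eq_iff)

text \<open>The witness demanded by \<open>Cp_on\<close>, isolated so that it can be restricted,
  shifted and compared with a Taylor family. Members of degree above \<open>p\<close> are
  unconstrained.\<close>

definition jetfam :: "nat \<Rightarrow> (real^'n::finite) set \<Rightarrow> (('n \<Rightarrow> nat) \<Rightarrow> real^'n \<Rightarrow> real) \<Rightarrow> bool" where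
  "jetfam p U D \<longleftrightarrow> (\<forall>\<alpha>. mdeg \<alpha> \<le> p \<longrightarrow> continuous_on U (D \<alpha>)) \<and>
     (\<forall>\<alpha> i. mdeg \<alpha> < p \<longrightarrow> (\<forall>x\<in>U. has_partial i (D \<alpha>) (D (inc i \<alpha>) x) x))"

lemma Cp_on_iff_jetfam: "Cp_on p U F \<longleftrightarrow> (\<exists>D. (\<forall>x\<in>U. D (\<lambda>_. 0) x = F x) \<and> jetfam p U D)"
  unfolding Cp_on_def jetfam_def has_partial_def inc_def ..

lemma jetfam_continuous_on: "jetfam p U D \<Longrightarrow> mdeg \<alpha> \<le> p \<Longrightarrow> continuous_on U (D \<alpha>)"
  unfolding jetfam_def by blast

lemma jetfam_has_partial:
  "jetfam p U D \<Longrightarrow> mdeg \<alpha> < p \<Longrightarrow> x \<in> U \<Longrightarrow> has_partial i (D \<alpha>) (D (inc i \<alpha>) x) x"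
  unfolding jetfam_def by blast

lemma jetfam_subset: "jetfam p U D \<Longrightarrow> V \<subseteq> U \<Longrightarrow> jetfam p V D"
  unfolding jetfam_def by (meson continuous_on_subset subsetD)

lemma mdeg_zero [simp]: "mdeg (\<lambda>_. 0) = 0"
  by (simp add: mdeg_def)

lemma mdeg_eq_0_iff [simp]: "mdeg \<alpha> = 0 \<longleftrightarrow> \<alpha> = (\<lambda>_. 0)"
  by (auto simp: mdeg_def)

lemma mdeg_inc [simp]: "mdeg (inc i \<alpha>) = Suc (mdeg \<alpha>)"
proof -
  have "mdeg (inc i \<alpha>) = (\<Sum>k\<in>UNIV. \<alpha> k + (if k = i then 1 else 0))"
    unfolding mdeg_def by (rule sum.cong) (auto simp: inc_def)
  then show ?thesis by (simp add: sum.distrib mdeg_def)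
qed

lemma mdeg_add: "mdeg (\<lambda>i. \<alpha> i + \<beta> i) = mdeg \<alpha> + mdeg \<beta>"
  by (simp add: mdeg_def sum.distrib)

lemma mdeg_pos_decomp:
  assumes "mdeg \<alpha> = Suc k"
  obtains \<beta> i where "\<alpha> = inc i \<beta>" "mdeg \<beta> = k"
proof -
  have "\<alpha> \<noteq> (\<lambda>_. 0)" using assms by auto
  then obtain i where i: "\<alpha> i \<noteq> 0" by auto
  define \<beta> where "\<beta> = \<alpha>(i := \<alpha> i - 1)"
  have eq: "\<alpha> = inc i \<beta>" using i by (auto simp: \<beta>_def inc_def)
  then have "mdeg \<alpha> = Suc (mdeg \<beta>)" by (metis mdeg_inc)
  then show thesis using that eq assms by simp
qed

lemma jetfam_imp_Ck:
  assumes "open U" "jetfam p U D"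
  shows "mdeg \<alpha> + k \<le> p \<Longrightarrow> Ck k U (D \<alpha>)"
proof (induction k arbitrary: \<alpha>)
  case 0
  then show ?case using jetfam_continuous_on[OF assms(2)] by simp
next
  case (Suc k)
  show ?case
    by (rule Ck_SucI[OF assms(1), where D = "\<lambda>i. D (inc i \<alpha>)"])
      (use Suc jetfam_continuous_on[OF assms(2)] jetfam_has_partial[OF assms(2)] in auto)
qed

text \<open>A member of positive degree is a partial derivative of one of lower degree, so agreement
  propagates upwards from index 0. Applied to shifted families, this turns one identity between
  second derivatives into symmetry at all orders.\<close>

lemma jetfam_unique:
  assumes "open U" "jetfam p U D" "jetfam p U E" "\<And>x. x \<in> U \<Longrightarrow> D (\<lambda>_. 0) x = E (\<lambda>_. 0) x"
  shows "mdeg \<alpha> \<le> p \<Longrightarrow> x \<in> U \<Longrightarrow> D \<alpha> x = E \<alpha> x"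
proof (induction "mdeg \<alpha>" arbitrary: \<alpha> x)
  case 0
  then show ?case using assms(4) by simp
next
  case (Suc k)
  obtain \<beta> i where \<beta>: "\<alpha> = inc i \<beta>" "mdeg \<beta> = k"
    using mdeg_pos_decomp Suc.hyps(2) by metis
  have "D \<beta> y = E \<beta> y" if "y \<in> U" for y using Suc \<beta> that by auto
  then have "has_partial i (E \<beta>) (D \<alpha> x) x"
    using has_partial_cong[OF assms(1) \<open>x \<in> U\<close>] jetfam_has_partial[OF assms(2)] Suc \<beta> by (metis Suc_le_lessD)
  moreover have "has_partial i (E \<beta>) (E \<alpha> x) x"
    using jetfam_has_partial[OF assms(3)] Suc \<beta> by (metis Suc_le_lessD)
  ultimately show ?case by (rule has_partial_unique)
qed

text \<open>The derivatives \<open>pd i F\<close> have families \<open>D i\<close> by induction. At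
  each nonzero multi-index a family for \<open>F\<close> must use one of them, and the point is that
  the choice of \<open>i\<close> is immaterial.\<close>

lemma Ck_imp_Cp_on:
  assumes "open U"
  shows "Ck p U F \<Longrightarrow> Cp_on p U F"
proof (induction p arbitrary: F)
  case 0
  then show ?case unfolding Cp_on_iff_jetfam
    by (intro exI[of _ "\<lambda>_. F"]) (auto simp: jetfam_def)
next
  case (Suc p)
  have "\<exists>D. (\<forall>x\<in>U. D (\<lambda>_. 0) x = pd i F x) \<and> jetfam p U D" for i
    using Suc by (auto simp: Cp_on_iff_jetfam)
  then obtain D where D0: "\<And>i x. x \<in> U \<Longrightarrow> D i (\<lambda>_. 0) x = pd i F x" and D: "\<And>i. jetfam p U (D i)"
    by metis
  \<comment> \<open>Both sides belong to families, indexed by \<open>\<gamma>\<close>, that start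
    from the two mixed second derivatives of \<open>F\<close>, equal by
    \<open>pd_commute\<close>.\<close>
  have sym: "D i (inc j \<gamma>) x = D j (inc i \<gamma>) x" if "x \<in> U" "mdeg \<gamma> < p" for i j \<gamma> x
  proof -
    obtain q where q: "p = Suc q" using \<open>mdeg \<gamma> < p\<close> by (cases p) auto
    have jf: "jetfam q U (\<lambda>\<gamma>. D i (inc j \<gamma>))" for i j
      unfolding jetfam_def
    proof (intro conjI allI impI ballI)
      fix \<alpha> :: "'a \<Rightarrow> nat" assume "mdeg \<alpha> \<le> q"
      then show "continuous_on U (D i (inc j \<alpha>))"
        using D[of i] q by (intro jetfam_continuous_on) auto
    next
      fix \<alpha> :: "'a \<Rightarrow> nat" and k x assume "mdeg \<alpha> < q" "x \<in> U"
      moreover have "inc j (inc k \<alpha>) = inc k (inc j \<alpha>)" by (rule inc_commute)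
      ultimately show "has_partial k (D i (inc j \<alpha>))
           (D i (inc j (inc k \<alpha>)) x) x"
        using jetfam_has_partial[OF D[of i], of "inc j \<alpha>" x k] q by auto
    qed
    have base: "D i (inc j (\<lambda>_. 0)) x = pd j (pd i F) x" if "x \<in> U" for i j x
    proof -
      have "has_partial j (D i (\<lambda>_. 0)) (D i (inc j (\<lambda>_. 0)) x) x"
        using jetfam_has_partial[OF D[of i], of "\<lambda>_. 0" x j] q that by simp
      then have "has_partial j (pd i F) (D i (inc j (\<lambda>_. 0)) x) x"
        by (rule has_partial_cong[OF assms that, rotated]) (use D0 in auto)
      then show ?thesis using has_partial_imp_pd by metis
    qed
    have "Ck (Suc (Suc q)) U F" using Suc.prems q by simp
    then have "D i (inc j (\<lambda>_. 0)) x = D j (inc i (\<lambda>_. 0)) x" if "x \<in> U" for x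
      using base[OF that] pd_commute[OF assms that] by metis
    then show ?thesis
      using jetfam_unique[OF assms jf[of i j] jf[of j i], of \<gamma> x] that q by auto
  qed
  \<comment> \<open>One index occurring in \<open>\<alpha>\<close> is split off; by
    \<open>sym\<close> any other choice gives the same values on \<open>U\<close>.\<close>
  define E where "E \<alpha> = (if \<alpha> = (\<lambda>_. 0) then F else
     (let i = (SOME i. \<alpha> i \<noteq> 0) in D i (\<alpha>(i := \<alpha> i - 1))))" for \<alpha> :: "'a \<Rightarrow> nat"
  have E: "E (inc j \<gamma>) x = D j \<gamma> x" if "x \<in> U" "mdeg \<gamma> \<le> p" for \<gamma> j x
  proof -
    define \<alpha> where "\<alpha> = inc j \<gamma>"
    define i where "i = (SOME i. \<alpha> i \<noteq> 0)"
    have "\<alpha> j \<noteq> 0" by (simp add: \<alpha>_def inc_def)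
    then have i: "\<alpha> i \<noteq> 0" unfolding i_def by (rule someI)
    have ne: "\<alpha> \<noteq> (\<lambda>_. 0)" using i by auto
    have Ea: "E \<alpha> = D i (\<alpha>(i := \<alpha> i - 1))" using ne by (simp add: E_def i_def Let_def)
    show ?thesis
    proof (cases "i = j")
      case True
      then have "\<alpha>(i := \<alpha> i - 1) = \<gamma>" by (auto simp: \<alpha>_def inc_def)
      then show ?thesis using Ea True unfolding \<alpha>_def by simp
    next
      case False
      define \<delta> where "\<delta> = \<gamma>(i := \<gamma> i - 1)"
      have "\<gamma> i \<noteq> 0" using i False by (simp add: \<alpha>_def inc_def)
      then have g: "\<gamma> = inc i \<delta>" and a: "\<alpha>(i := \<alpha> i - 1) = inc j \<delta>"
        using False by (auto simp: \<delta>_def \<alpha>_def inc_def fun_eq_iff)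
      then have "mdeg \<gamma> = Suc (mdeg \<delta>)" by (metis mdeg_inc)
      then have "mdeg \<delta> < p" using that by simp
      then show ?thesis using sym[OF \<open>x \<in> U\<close>, of \<delta> i j] Ea a g unfolding \<alpha>_def by simp
    qed
  qed
  have "jetfam (Suc p) U E"
    unfolding jetfam_def
  proof (intro conjI allI impI ballI)
    fix \<alpha> :: "'a \<Rightarrow> nat" assume "mdeg \<alpha> \<le> Suc p"
    show "continuous_on U (E \<alpha>)"
    proof (cases "mdeg \<alpha>")
      case 0
      then show ?thesis using Suc.prems by (simp add: E_def)
    next
      case (Suc k)
      then obtain \<beta> i where \<beta>: "\<alpha> = inc i \<beta>" "mdeg \<beta> = k"
        using mdeg_pos_decomp by metis
      have "mdeg \<beta> \<le> p" using \<beta> Suc \<open>mdeg \<alpha> \<le> Suc p\<close> by simp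
      then have "continuous_on U (D i \<beta>)" by (rule jetfam_continuous_on[OF D])
      then show ?thesis
        using continuous_on_cong[of U U "E \<alpha>" "D i \<beta>"] E \<beta> \<open>mdeg \<beta> \<le> p\<close> by simp
    qed
  next
    fix \<alpha> :: "'a \<Rightarrow> nat" and j x assume "mdeg \<alpha> < Suc p" and x: "x \<in> U"
    then have ax: "E (inc j \<alpha>) x = D j \<alpha> x" using E by auto
    show "has_partial j (E \<alpha>) (E (inc j \<alpha>) x) x"
    proof (cases "mdeg \<alpha>")
      case 0
      then have "E \<alpha> = F" "\<alpha> = (\<lambda>_. 0)" by (auto simp: E_def)
      then show ?thesis using Suc.prems x D0[OF x] ax by auto
    next
      case (Suc k)
      then obtain \<beta> i where \<beta>: "\<alpha> = inc i \<beta>" "mdeg \<beta> = k"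
        using mdeg_pos_decomp by metis
      have d: "mdeg \<beta> < p" using \<beta> Suc \<open>mdeg \<alpha> < Suc p\<close> by simp
      have "has_partial j (D i \<beta>) (D i (inc j \<beta>) x) x"
        by (rule jetfam_has_partial[OF D d x])
      then have "has_partial j (E \<alpha>) (D i (inc j \<beta>) x) x"
        by (rule has_partial_cong[OF assms x, rotated]) (use E \<beta> d in auto)
      then show ?thesis using sym[OF x d, of i j] ax \<beta> by simp
    qed
  qed
  moreover have "E (\<lambda>_. 0) = F" by (simp add: E_def)
  ultimately show ?case unfolding Cp_on_iff_jetfam by metis
qed

lemma Cp_on_iff_Ck: "open U \<Longrightarrow> Cp_on p U F \<longleftrightarrow> Ck p U F"
proof
  assume "open U" "Cp_on p U F"
  then obtain D where D: "\<forall>x\<in>U. D (\<lambda>_. 0) x = F x" "jetfam p U D" unfolding Cp_on_iff_jetfam by blast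
  then have "Ck p U (D (\<lambda>_. 0))" using jetfam_imp_Ck[OF \<open>open U\<close>] by simp
  then show "Ck p U F" by (rule Ck_cong[OF \<open>open U\<close>, rotated]) (use D in auto)
qed (rule Ck_imp_Cp_on)

subsection \<open>Taylor polynomials\<close>

text \<open>\<open>dpm \<gamma> x\<close> is \<open>x\<^sup>\<gamma> / \<gamma>!\<close>; \<open>tay p c a \<beta>\<close> is the \<open>\<beta>\<close>-th derivative of the polynomial of
  degree at most \<open>p\<close> whose derivatives at \<open>a\<close> are the numbers \<open>c\<close>.\<close>

definition dpm :: "('n::finite \<Rightarrow> nat) \<Rightarrow> real^'n \<Rightarrow> real" where
  "dpm \<gamma> x = (\<Prod>k\<in>UNIV. (x$k) ^ \<gamma> k / fact (\<gamma> k))"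

definition tay :: "nat \<Rightarrow> (('n::finite \<Rightarrow> nat) \<Rightarrow> real) \<Rightarrow> real^'n \<Rightarrow> ('n \<Rightarrow> nat) \<Rightarrow> real^'n \<Rightarrow> real" where
  "tay p c a \<beta> x = (\<Sum>\<gamma>\<in>mindex (p - mdeg \<beta>). c (\<lambda>i. \<beta> i + \<gamma> i) * dpm \<gamma> (x - a))"

lemma le_mdeg: "\<alpha> i \<le> mdeg \<alpha>"
  unfolding mdeg_def by (rule member_le_sum) auto

lemma finite_mindex [simp]: "finite (mindex p :: ('n::finite \<Rightarrow> nat) set)"
proof (rule finite_subset)
  show "mindex p \<subseteq> (PiE UNIV (\<lambda>_::'n. {..p}))"
    using le_mdeg order_trans by (fastforce simp: mindex_def)
  show "finite (PiE UNIV (\<lambda>_::'n. {..p}))" by (rule finite_PiE) auto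
qed

lemma mem_mindex: "\<alpha> \<in> mindex p \<longleftrightarrow> mdeg \<alpha> \<le> p"
  by (simp add: mindex_def)

lemma mindex_0 [simp]: "mindex 0 = {\<lambda>_. 0}"
  by (auto simp: mindex_def)

lemma dpm_zero_index [simp]: "dpm (\<lambda>_. 0) x = 1"
  by (simp add: dpm_def)

lemma dpm_zero: "dpm \<gamma> 0 = (if \<gamma> = (\<lambda>_. 0) then 1 else 0)"
proof (cases "\<gamma> = (\<lambda>_. 0)")
  case False
  then obtain k where "\<gamma> k \<noteq> 0" by auto
  then have "dpm \<gamma> 0 = 0" unfolding dpm_def by (intro prod_zero) auto
  then show ?thesis using False by simp
qed simp

lemma has_partial_dpm:
  "has_partial i (\<lambda>x. dpm \<gamma> (x - a)) (if \<gamma> i = 0 then 0 else dpm (\<gamma>(i := \<gamma> i - 1)) (x - a)) x"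
proof -
  define c where "c = (\<Prod>k\<in>UNIV - {i}. (x$k - a$k) ^ \<gamma> k / fact (\<gamma> k))"
  define u where "u = x$i - a$i"
  have 1: "dpm \<gamma> (x + t *\<^sub>R axis i 1 - a) = (u + t) ^ \<gamma> i / fact (\<gamma> i) * c" for t
  proof -
    have "(\<Prod>k\<in>UNIV - {i}. ((x + t *\<^sub>R axis i 1 - a)$k) ^ \<gamma> k / fact (\<gamma> k)) = c"
      unfolding c_def by (rule prod.cong) (auto simp: axis_def)
    then show ?thesis
      unfolding dpm_def by (subst prod.remove[of _ i]) (auto simp: u_def algebra_simps)
  qed
  have 2: "dpm (\<gamma>(i := m)) (x - a) = u ^ m / fact m * c" for m
  proof -
    have "(\<Prod>k\<in>UNIV - {i}. ((x - a)$k) ^ (\<gamma>(i := m)) k / fact ((\<gamma>(i := m)) k)) = c"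
      unfolding c_def by (rule prod.cong) auto
    then show ?thesis
      unfolding dpm_def by (subst prod.remove[of _ i]) (auto simp: u_def)
  qed
  show ?thesis
  proof (cases "\<gamma> i")
    case 0
    then show ?thesis unfolding has_partial_def 1 by simp
  next
    case (Suc m)
    have "((\<lambda>t. (u + t) ^ Suc m / fact (Suc m) * c) has_real_derivative
        (real (Suc m) * u ^ m / fact (Suc m) * c)) (at 0)"
      by (auto intro!: derivative_eq_intros simp del: power_Suc fact_Suc)
    moreover have "real (Suc m) * u ^ m / fact (Suc m) * c = u ^ m / fact m * c"
      by (simp add: fact_Suc del: of_nat_Suc)
    ultimately show ?thesis using Suc 2[of m] unfolding has_partial_def 1 by simp
  qed
qed

text \<open>Termwise differentiation: summands with \<open>\<gamma> i = 0\<close> drop out, the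
  others are renamed by lowering \<open>\<gamma> i\<close>, which lowers the degree bound by one and
  turns \<open>\<beta>\<close> into \<open>inc i \<beta>\<close>.\<close>

lemma has_partial_tay:
  assumes "mdeg \<beta> < p"
  shows "has_partial i (tay p c a \<beta>) (tay p c a (inc i \<beta>) x) x"
proof -
  define m where "m = p - Suc (mdeg \<beta>)"
  have m: "p - mdeg \<beta> = Suc m" "p - mdeg (inc i \<beta>) = m" using assms by (auto simp: m_def)
  let ?d = "\<lambda>\<gamma>. if \<gamma> i = 0 then 0 else dpm (\<gamma>(i := \<gamma> i - 1)) (x - a)"
  have 1: "has_partial i (tay p c a \<beta>) (\<Sum>\<gamma>\<in>mindex (p - mdeg \<beta>). c (\<lambda>k. \<beta> k + \<gamma> k) * ?d \<gamma>) x"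
    unfolding tay_def by (intro has_partial_sum has_partial_cmult has_partial_dpm)
  have 2: "(\<Sum>\<gamma>\<in>mindex (p - mdeg \<beta>). c (\<lambda>k. \<beta> k + \<gamma> k) * ?d \<gamma>) =
     (\<Sum>\<gamma>\<in>{\<gamma>\<in>mindex (Suc m). \<gamma> i \<noteq> 0}. c (\<lambda>k. \<beta> k + \<gamma> k) * ?d \<gamma>)"
    unfolding m by (rule sum.mono_neutral_right) auto
  also have "(\<Sum>\<gamma>\<in>{\<gamma>\<in>mindex (Suc m). \<gamma> i \<noteq> 0}. c (\<lambda>k. \<beta> k + \<gamma> k) * ?d \<gamma>) =
      (\<Sum>\<gamma>\<in>mindex m. c (\<lambda>k. inc i \<beta> k + \<gamma> k) * dpm \<gamma> (x - a))"
  proof (rule sum.reindex_bij_witness[where i = "inc i" and j = "\<lambda>\<gamma>. \<gamma>(i := \<gamma> i - 1)"])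
    fix \<gamma> :: "'a \<Rightarrow> nat" assume "\<gamma> \<in> {\<gamma>\<in>mindex (Suc m). \<gamma> i \<noteq> 0}"
    then show eq: "inc i (\<gamma>(i := \<gamma> i - 1)) = \<gamma>" and "\<gamma>(i := \<gamma> i - 1) \<in> mindex m"
      using mdeg_inc[of i "\<gamma>(i := \<gamma> i - 1)"] by (auto simp: inc_def mindex_def)
    show "c (\<lambda>k. inc i \<beta> k + (\<gamma>(i := \<gamma> i - 1)) k) * dpm (\<gamma>(i := \<gamma> i - 1)) (x - a) =
         c (\<lambda>k. \<beta> k + \<gamma> k) * (if \<gamma> i = 0 then 0 else dpm (\<gamma>(i := \<gamma> i - 1)) (x - a))"
    proof -
      have "(\<lambda>k. inc i \<beta> k + (\<gamma>(i := \<gamma> i - 1)) k) = (\<lambda>k. \<beta> k + \<gamma> k)"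
        using \<open>\<gamma> \<in> _\<close> by (auto simp: inc_def fun_eq_iff)
      then show ?thesis using \<open>\<gamma> \<in> _\<close> by simp
    qed
  next
    fix \<gamma> :: "'a \<Rightarrow> nat" assume "\<gamma> \<in> mindex m"
    moreover have "mdeg (inc i \<gamma>) = Suc (mdeg \<gamma>)" by (rule mdeg_inc)
    ultimately show "inc i \<gamma> \<in> {\<gamma>\<in>mindex (Suc m). \<gamma> i \<noteq> 0}"
      unfolding mindex_def by (simp add: inc_def)
    show "(inc i \<gamma>)(i := inc i \<gamma> i - 1) = \<gamma>" by (simp add: inc_def)
  qed
  also have "\<dots> = tay p c a (inc i \<beta>) x" unfolding tay_def m ..
  finally show ?thesis using 1 by simp
qed

lemma tay_base [simp]: "tay p c a \<beta> a = c \<beta>"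
proof -
  have "tay p c a \<beta> a = (\<Sum>\<gamma>\<in>{\<lambda>_. 0}. c (\<lambda>i. \<beta> i + \<gamma> i) * dpm \<gamma> 0)"
    unfolding tay_def by (subst sum.mono_neutral_right[of _ "{\<lambda>_. 0}"]) (auto simp: dpm_zero mem_mindex)
  then show ?thesis by simp
qed

lemma tay_top: "mdeg \<beta> = p \<Longrightarrow> tay p c a \<beta> x = c \<beta>"
  by (simp add: tay_def)

lemma continuous_on_dpm [continuous_intros]:
  "continuous_on S g \<Longrightarrow> continuous_on S (\<lambda>x. dpm \<gamma> (g x))"
  unfolding dpm_def by (intro continuous_intros) auto

lemma jetfam_tay: "jetfam p U (tay p c a)"
  unfolding jetfam_def
proof (intro conjI allI impI ballI has_partial_tay)
  show "continuous_on U (tay p c a \<alpha>)" for \<alpha> :: "'a \<Rightarrow> nat"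
    unfolding tay_def by (intro continuous_intros)
qed

lemma jetfam_diff: "jetfam p U D \<Longrightarrow> jetfam p U E \<Longrightarrow> jetfam p U (\<lambda>\<alpha> x. D \<alpha> x - E \<alpha> x)"
  unfolding jetfam_def by (auto intro: continuous_intros has_partial_diff)

text \<open>The derivative of \<open>D \<beta>\<close> has operator norm at most
  \<open>CARD('n) * B\<close>, one \<open>B\<close> for each coordinate; the mean value inequality
  on a convex set does the rest.\<close>

lemma jetfam_increment_bound:
  fixes D :: "('n::finite \<Rightarrow> nat) \<Rightarrow> real^'n \<Rightarrow> real" and B :: real
  assumes "open U" "jetfam p U D" "mdeg \<beta> < p" "convex S" "S \<subseteq> U" "x \<in> S" "y \<in> S"
    and B: "\<And>i z. z \<in> S \<Longrightarrow> \<bar>D (inc i \<beta>) z\<bar> \<le> B"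
  shows "\<bar>D \<beta> y - D \<beta> x\<bar> \<le> CARD('n) * B * norm (y - x)"
proof -
  have der: "(D \<beta> has_derivative (\<lambda>h. \<Sum>i\<in>UNIV. h$i * D (inc i \<beta>) z)) (at z within S)" if "z \<in> S" for z
  proof (rule has_derivative_at_withinI, rule has_derivative_of_partials[OF assms(1)])
    show "z \<in> U" using that assms(5) by blast
    show "has_partial i (D \<beta>) (D (inc i \<beta>) y) y" if "y \<in> U" for i y
      by (rule jetfam_has_partial[OF assms(2,3) that])
    show "continuous_on U (D (inc i \<beta>))" for i
      by (rule jetfam_continuous_on[OF assms(2)]) (use assms(3) in simp)
  qed
  have on: "onorm (\<lambda>h::real^'n. \<Sum>i\<in>UNIV. h$i * D (inc i \<beta>) z) \<le> CARD('n) * B" if "z \<in> S" for z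
  proof (rule onorm_le)
    fix h :: "real^'n"
    have "norm (\<Sum>i\<in>UNIV. h$i * D (inc i \<beta>) z) \<le> (\<Sum>i\<in>(UNIV::'n set). norm h * B)"
    proof (intro order_trans[OF norm_sum] sum_mono)
      fix i
      show "norm (h$i * D (inc i \<beta>) z) \<le> norm h * B"
        unfolding real_norm_def abs_mult
        using B[OF that, of i] component_le_norm_cart[of h i] by (intro mult_mono) auto
    qed
    then show "norm (\<Sum>i\<in>UNIV. h$i * D (inc i \<beta>) z) \<le> CARD('n) * B * norm h" by (simp add: mult_ac)
  qed
  show "\<bar>D \<beta> y - D \<beta> x\<bar> \<le> CARD('n) * B * norm (y - x)"
    using differentiable_bound[OF assms(4) der on assms(7,6)] by simp
qed

text \<open>Descending induction on \<open>mdeg \<beta>\<close>, integrating the bound on the next order from \<open>a\<close>.\<close>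

lemma jetfam_bound:
  fixes D :: "('n::finite \<Rightarrow> nat) \<Rightarrow> real^'n \<Rightarrow> real" and e h :: real
  assumes "open U" "jetfam p U D" "convex S" "S \<subseteq> U" "a \<in> S" "\<And>x. x \<in> S \<Longrightarrow> norm (x - a) \<le> h"
    and base: "\<And>\<beta>. mdeg \<beta> \<le> p \<Longrightarrow> \<bar>D \<beta> a\<bar> \<le> e * h ^ (p - mdeg \<beta>)"
    and top: "\<And>\<beta> x. mdeg \<beta> = p \<Longrightarrow> x \<in> S \<Longrightarrow> \<bar>D \<beta> x\<bar> \<le> e"
  shows "mdeg \<beta> \<le> p \<Longrightarrow> x \<in> S \<Longrightarrow> \<bar>D \<beta> x\<bar> \<le> (1 + CARD('n)) ^ (p - mdeg \<beta>) * e * h ^ (p - mdeg \<beta>)"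
proof (induction "p - mdeg \<beta>" arbitrary: \<beta> x)
  case 0
  then show ?case using top[of \<beta> x] by simp
next
  case (Suc k)
  define N where "N = real CARD('n)"
  have "h \<ge> 0" using assms(5) assms(6)[of a] by simp
  \<comment> \<open>Read off the top-order bound, for which a multi-index of degree exactly
    \<open>p\<close> has to be exhibited.\<close>
  have "e \<ge> 0"
  proof -
    obtain i :: 'n where True by simp
    have "mdeg ((\<lambda>_. 0)(i := p)) = p" by (simp add: mdeg_def)
    then show ?thesis using top[of "(\<lambda>_. 0)(i := p)" a] assms(5) by linarith
  qed
  have lt: "mdeg \<beta> < p" and k: "p - mdeg \<beta> = Suc k" using Suc.hyps(2) by auto
  have "\<bar>D \<beta> x - D \<beta> a\<bar> \<le> CARD('n) * ((1 + CARD('n)) ^ k * e * h ^ k) * norm (x - a)"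
  proof (rule jetfam_increment_bound[OF assms(1,2) lt assms(3,4,5) Suc.prems(2)])
    fix i z assume "z \<in> S"
    have "p - mdeg (inc i \<beta>) = k" "mdeg (inc i \<beta>) \<le> p" using k lt by auto
    then show "\<bar>D (inc i \<beta>) z\<bar> \<le> (1 + CARD('n)) ^ k * e * h ^ k"
      using Suc.hyps(1)[of "inc i \<beta>" z] \<open>z \<in> S\<close> by metis
  qed
  also have "\<dots> \<le> CARD('n) * ((1 + CARD('n)) ^ k * e * h ^ k) * h"
    using assms(6)[OF Suc.prems(2)] \<open>h \<ge> 0\<close> \<open>e \<ge> 0\<close> by (intro mult_left_mono) auto
  finally have 1: "\<bar>D \<beta> x - D \<beta> a\<bar> \<le> N * (1 + N) ^ k * (e * h ^ Suc k)" by (simp add: N_def mult_ac)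
  have 2: "\<bar>D \<beta> a\<bar> \<le> e * h ^ Suc k" using base[of \<beta>] Suc.prems k by simp
  \<comment> \<open>Origin of the base \<open>1 + CARD('n)\<close>: the increment contributes
    \<open>N * (1 + N) ^ k\<close>, the value at \<open>a\<close> contributes 1.\<close>
  have "N * (1 + N) ^ k * (e * h ^ Suc k) + e * h ^ Suc k \<le> (1 + N) ^ Suc k * (e * h ^ Suc k)"
  proof -
    have "(1 + N) ^ k \<ge> 1" by (rule one_le_power) (simp add: N_def)
    then have "N * (1 + N) ^ k + 1 \<le> (1 + N) ^ Suc k" by (simp add: algebra_simps)
    then have "(N * (1 + N) ^ k + 1) * (e * h ^ Suc k) \<le> (1 + N) ^ Suc k * (e * h ^ Suc k)"
      by (rule mult_right_mono) (use \<open>h \<ge> 0\<close> \<open>e \<ge> 0\<close> in auto)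
    then show ?thesis by (simp only: distrib_right mult_1)
  qed
  then have "\<bar>D \<beta> x\<bar> \<le> (1 + N) ^ Suc k * (e * h ^ Suc k)" using 1 2 by linarith
  then show ?case unfolding k N_def by (simp only: mult.assoc of_nat_1 of_nat_add of_nat_power)
qed

text \<open>Subtracting the Taylor polynomial at \<open>x\<close> leaves a family that vanishes at
  \<open>x\<close> in all orders and whose top-order members are increments
  \<open>D \<alpha> z - D \<alpha> x\<close>, small by uniform continuity on \<open>B\<close>.
  \<open>jetfam_bound\<close> integrates this along the segment, which convexity keeps inside
  \<open>B\<close>.\<close>

lemma jetfam_taylor:
  fixes D :: "('n::finite \<Rightarrow> nat) \<Rightarrow> real^'n \<Rightarrow> real"
  assumes "open U" "jetfam p U D" "compact B" "convex B" "B \<subseteq> U" "e > 0"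
  shows "\<exists>d>0. \<forall>x\<in>B. \<forall>y\<in>B. dist x y < d \<longrightarrow> (\<forall>\<beta>. mdeg \<beta> \<le> p \<longrightarrow>
     \<bar>D \<beta> y - tay p (\<lambda>\<gamma>. D \<gamma> x) x \<beta> y\<bar> \<le> e * dist x y ^ (p - mdeg \<beta>))"
proof -
  define N where "N = (1 + real CARD('n)) ^ p"
  have N: "N \<ge> 1" unfolding N_def by (rule one_le_power) simp
  define e' where "e' = e / N"
  have e': "e' > 0" using assms N by (simp add: e'_def)
  have "\<exists>d>0. \<forall>x\<in>B. \<forall>y\<in>B. dist y x < d \<longrightarrow> dist (D \<beta> y) (D \<beta> x) < e'" if "mdeg \<beta> \<le> p" for \<beta>
  proof -
    have "continuous_on B (D \<beta>)"
      using jetfam_continuous_on[OF assms(2) that] assms(5) continuous_on_subset by blast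
    then have "uniformly_continuous_on B (D \<beta>)" using compact_uniformly_continuous assms(3) by blast
    then show ?thesis unfolding uniformly_continuous_on_def using e' by blast
  qed
  then obtain d where d: "\<And>\<beta>. mdeg \<beta> \<le> p \<Longrightarrow> d \<beta> > 0"
    "\<And>\<beta> x y. mdeg \<beta> \<le> p \<Longrightarrow> x \<in> B \<Longrightarrow> y \<in> B \<Longrightarrow> dist y x < d \<beta> \<Longrightarrow> dist (D \<beta> y) (D \<beta> x) < e'"
    by metis
  define d0 where "d0 = Min (d ` mindex p)"
  have ne: "mindex p \<noteq> ({} :: ('n \<Rightarrow> nat) set)" by (auto simp: mindex_def intro: exI[of _ "\<lambda>_. 0"])
  have d0: "d0 > 0" unfolding d0_def using ne d(1) by (subst Min_gr_iff) (auto simp: mem_mindex)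
  have d0le: "d0 \<le> d \<beta>" if "mdeg \<beta> \<le> p" for \<beta>
    unfolding d0_def using that by (intro Min_le) (auto simp: mem_mindex)
  show ?thesis
  proof (intro exI[of _ d0] conjI ballI impI allI)
    fix x y :: "real^'n" and \<beta> :: "'n \<Rightarrow> nat" assume x: "x \<in> B" and y: "y \<in> B" and xy: "dist x y < d0" and \<beta>: "mdeg \<beta> \<le> p"
    define Q where "Q \<alpha> z = D \<alpha> z - tay p (\<lambda>\<gamma>. D \<gamma> x) x \<alpha> z" for \<alpha> z
    define h where "h = dist x y"
    have "\<bar>Q \<beta> y\<bar> \<le> (1 + CARD('n)) ^ (p - mdeg \<beta>) * e' * h ^ (p - mdeg \<beta>)"
    proof (rule jetfam_bound[OF assms(1), where S = "closed_segment x y" and a = x])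
      show "jetfam p U Q" unfolding Q_def by (intro jetfam_diff assms(2) jetfam_tay)
      show seg: "closed_segment x y \<subseteq> U"
        using closed_segment_subset[OF x y assms(4)] assms(5) by blast
      show "norm (z - x) \<le> h" if "z \<in> closed_segment x y" for z
        using segment_bound(1)[OF that] by (simp add: h_def dist_norm norm_minus_commute)
      show "\<bar>Q \<alpha> x\<bar> \<le> e' * h ^ (p - mdeg \<alpha>)" for \<alpha>
        using e' by (simp add: Q_def h_def)
      show "\<bar>Q \<alpha> z\<bar> \<le> e'" if a: "mdeg \<alpha> = p" and z: "z \<in> closed_segment x y" for \<alpha> z
      proof -
        have "z \<in> B" using closed_segment_subset[OF x y assms(4)] z by blast
        moreover have "dist z x < d \<alpha>"
          using segment_bound(1)[OF z] xy d0le[of \<alpha>] a by (simp add: dist_norm norm_minus_commute)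
        ultimately have "dist (D \<alpha> z) (D \<alpha> x) < e'" using d(2)[of \<alpha> x z] a x by auto
        then show ?thesis using tay_top[OF a] by (simp add: Q_def dist_real_def)
      qed
    qed (use \<beta> in auto)
    also have "\<dots> \<le> N * e' * h ^ (p - mdeg \<beta>)"
    proof (intro mult_right_mono)
      show "real ((1 + CARD('n)) ^ (p - mdeg \<beta>)) \<le> N"
        unfolding N_def of_nat_power of_nat_add of_nat_1 by (rule power_increasing) auto
    qed (use e' in \<open>auto simp: h_def\<close>)
    also have "N * e' = e" using N by (simp add: e'_def)
    finally show "\<bar>D \<beta> y - tay p (\<lambda>\<gamma>. D \<gamma> x) x \<beta> y\<bar> \<le> e * dist x y ^ (p - mdeg \<beta>)"
      unfolding Q_def h_def .
  qed (rule d0)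
qed

subsection \<open>Derivative bounds at a scale\<close>

text \<open>\<open>bd k S h A F\<close> bounds every partial derivative of order \<open>j \<le> k\<close> of \<open>F\<close> on \<open>S\<close> by \<open>A / h\<^sup>j\<close>.
  With this recursive form products need no Leibniz formula.\<close>

fun bd :: "nat \<Rightarrow> (real^'n::finite) set \<Rightarrow> real \<Rightarrow> real \<Rightarrow> (real^'n \<Rightarrow> real) \<Rightarrow> bool" where
  "bd 0 S h A F \<longleftrightarrow> (\<forall>x\<in>S. \<bar>F x\<bar> \<le> A)"
| "bd (Suc k) S h A F \<longleftrightarrow> (\<forall>x\<in>S. \<bar>F x\<bar> \<le> A) \<and> (\<forall>i. bd k S h (A / h) (pd i F))"

lemma bd_cong:
  assumes "open S" "\<And>x. x \<in> S \<Longrightarrow> F x = G x" "bd k S h A F"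
  shows "bd k S h A G"
  using assms(2,3)
proof (induction k arbitrary: F G A)
  case (Suc k)
  have "pd i F x = pd i G x" if "x \<in> S" for i x
    using pd_cong[OF assms(1) that Suc.prems(1)] by simp
  then have "bd k S h (A / h) (pd i G)" for i
    using Suc.IH[of "pd i F" "pd i G" "A / h"] Suc.prems(2) by auto
  then show ?case using Suc.prems by auto
qed auto

lemma bd_imp_abs_le: "bd k S h A F \<Longrightarrow> x \<in> S \<Longrightarrow> \<bar>F x\<bar> \<le> A"
  by (cases k) auto

lemma bd_mono: "bd k S h A F \<Longrightarrow> A \<le> B \<Longrightarrow> h > 0 \<Longrightarrow> bd k S h B F"
proof (induction k arbitrary: F A B)
  case (Suc k)
  have "A / h \<le> B / h" using Suc.prems by (simp add: divide_right_mono)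
  then show ?case using Suc by fastforce
qed fastforce

lemma bd_subset: "bd k S h A F \<Longrightarrow> T \<subseteq> S \<Longrightarrow> bd k T h A F"
  by (induction k arbitrary: F A) auto

lemma bd_SucD: "bd (Suc k) S h A F \<Longrightarrow> bd k S h A F"
  by (induction k arbitrary: F A) auto

lemma bd_const: "\<bar>c\<bar> \<le> A \<Longrightarrow> h > 0 \<Longrightarrow> bd k S h A (\<lambda>x. c)"
proof (induction k arbitrary: c A)
  case (Suc k)
  have "pd i (\<lambda>x. c) = (\<lambda>x. 0)" for i :: 'a
    by (auto intro!: ext has_partial_imp_pd has_partial_const)
  then show ?case using Suc by auto
qed auto

lemma bd_add:
  assumes "open S" "Ck k S F" "Ck k S G" "bd k S h A F" "bd k S h B G"
  shows "bd k S h (A + B) (\<lambda>x. F x + G x)"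
  using assms(2-)
proof (induction k arbitrary: F G A B)
  case 0
  then show ?case by (auto intro: order_trans[OF abs_triangle_ineq] add_mono)
next
  case (Suc k)
  have "bd k S h (A / h + B / h) (\<lambda>x. pd i F x + pd i G x)" for i
    by (rule Suc.IH) (use Suc.prems in auto)
  then have "bd k S h (A / h + B / h) (pd i (\<lambda>x. F x + G x))" for i
    by (rule bd_cong[OF assms(1), rotated]) (use Suc.prems in \<open>auto simp: pd_add\<close>)
  moreover have "\<bar>F x + G x\<bar> \<le> A + B" if "x \<in> S" for x
    using bd_imp_abs_le[OF Suc.prems(3) that] bd_imp_abs_le[OF Suc.prems(4) that] by linarith
  ultimately show ?case by (simp add: add_divide_distrib)
qed

text \<open>The product rule replaces one product by two, each with bound \<open>A * B / h\<close>;
  hence a factor 2 per order. Nonemptiness of \<open>S\<close> makes \<open>A\<close> and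
  \<open>B\<close> nonnegative.\<close>

lemma bd_mult:
  assumes "open S" "Ck k S F" "Ck k S G" "bd k S h A F" "bd k S h B G" "S \<noteq> {}"
  shows "bd k S h (2 ^ k * A * B) (\<lambda>x. F x * G x)"
  using assms(2-5)
proof (induction k arbitrary: F G A B)
  case 0
  then show ?case by (auto simp: abs_mult intro!: mult_mono order_trans[OF abs_ge_zero])
next
  case (Suc k)
  have A: "A \<ge> 0" and B: "B \<ge> 0"
    using bd_imp_abs_le[OF Suc.prems(3)] bd_imp_abs_le[OF Suc.prems(4)] assms(6) abs_ge_zero order_trans by blast+
  have C: "Ck k S F" "Ck k S G" "Ck k S (pd i F)" "Ck k S (pd i G)" for i
    using Suc.prems Ck_SucD by auto
  have D: "bd k S h A F" "bd k S h B G" using Suc.prems bd_SucD by blast+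
  have 1: "bd k S h (2 ^ k * (A / h) * B) (\<lambda>x. pd i F x * G x)" for i
    by (rule Suc.IH) (use Suc.prems C D in auto)
  have 2: "bd k S h (2 ^ k * A * (B / h)) (\<lambda>x. F x * pd i G x)" for i
    by (rule Suc.IH) (use Suc.prems C D in auto)
  have "bd k S h (2 ^ k * (A / h) * B + 2 ^ k * A * (B / h)) (\<lambda>x. pd i F x * G x + F x * pd i G x)" for i
    by (intro bd_add Ck_mult assms(1) C 1 2)
  then have "bd k S h (2 ^ k * (A / h) * B + 2 ^ k * A * (B / h)) (pd i (\<lambda>x. F x * G x))" for i
  proof (rule bd_cong[OF assms(1), rotated])
    fix x assume "x \<in> S"
    then show "pd i F x * G x + F x * pd i G x = pd i (\<lambda>x. F x * G x) x"
      by (intro has_partial_imp_pd[symmetric] has_partial_mult) (use Suc.prems in auto)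
  qed
  then have "bd k S h (2 ^ Suc k * A * B / h) (pd i (\<lambda>x. F x * G x))" for i
    by (rule back_subst[of "\<lambda>c. bd k S h c (pd i (\<lambda>x. F x * G x))"]) (simp add: field_simps)
  moreover have "\<bar>F x * G x\<bar> \<le> 2 ^ Suc k * A * B" if "x \<in> S" for x
  proof -
    have "\<bar>F x * G x\<bar> \<le> A * B"
      unfolding abs_mult using bd_imp_abs_le[OF Suc.prems(3) that] bd_imp_abs_le[OF Suc.prems(4) that]
      by (intro mult_mono A) auto
    also have "\<dots> \<le> 2 ^ Suc k * (A * B)"
      using A B mult_right_mono[of 1 "2 ^ Suc k" "A * B"] one_le_power[of "2::real" "Suc k"] by auto
    finally show ?thesis by (simp add: mult.assoc)
  qed
  ultimately show ?case unfolding bd.simps by blast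
qed

lemma bd_cmult:
  assumes "open S" "Ck k S F" "bd k S h A F"
  shows "bd k S h (\<bar>c\<bar> * A) (\<lambda>x. c * F x)"
  using assms(2,3)
proof (induction k arbitrary: F A)
  case 0
  then show ?case by (auto simp: abs_mult intro: mult_left_mono)
next
  case (Suc k)
  have "bd k S h (\<bar>c\<bar> * (A / h)) (\<lambda>x. c * pd i F x)" for i
    by (rule Suc.IH) (use Suc.prems in auto)
  then have "bd k S h (\<bar>c\<bar> * (A / h)) (pd i (\<lambda>x. c * F x))" for i
  proof (rule bd_cong[OF assms(1), rotated])
    fix x assume "x \<in> S"
    then show "c * pd i F x = pd i (\<lambda>x. c * F x) x"
      by (intro has_partial_imp_pd[symmetric] has_partial_cmult) (use Suc.prems in auto)
  qed
  moreover have "\<bar>c * F x\<bar> \<le> \<bar>c\<bar> * A" if "x \<in> S" for x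
    using Suc.prems(2) that by (auto simp: abs_mult intro: mult_left_mono)
  ultimately show ?case by simp
qed

lemma bd_diff:
  assumes "open S" "Ck k S F" "Ck k S G" "bd k S h A F" "bd k S h B G"
  shows "bd k S h (A + B) (\<lambda>x. F x - G x)"
  using bd_add[OF assms(1,2) _ assms(4), of "\<lambda>x. (-1) * G x" B] Ck_cmult[OF assms(1,3), of "-1"]
    bd_cmult[OF assms(1,3,5), of "-1"] by simp

lemma bd_sum:
  fixes A :: real
  assumes "open S" "h > 0" "finite Q" "\<And>q. q \<in> Q \<Longrightarrow> Ck k S (F q)" "\<And>q. q \<in> Q \<Longrightarrow> bd k S h A (F q)"
  shows "bd k S h (card Q * A) (\<lambda>x. \<Sum>q\<in>Q. F q x)"
  using assms(3-)
proof (induction Q rule: finite_induct)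
  case empty
  then show ?case using bd_const[of 0 0 h] assms(2) by simp
next
  case (insert q Q)
  have "bd k S h (A + card Q * A) (\<lambda>x. F q x + (\<Sum>q\<in>Q. F q x))"
    by (intro bd_add assms(1) Ck_sum insert) (use insert in auto)
  then show ?case using insert by (simp add: algebra_simps)
qed

text \<open>Only the terms in \<open>R\<close> are active on \<open>S\<close>. Counting these
  instead of all of \<open>Q\<close> keeps the constants independent of the grid spacing.\<close>

lemma bd_sum_sparse:
  fixes A :: real
  assumes "open S" "h > 0" "finite Q" "A \<ge> 0"
    and "\<And>q. q \<in> Q \<Longrightarrow> q \<in> R \<Longrightarrow> Ck k S (F q) \<and> bd k S h A (F q)"
    and "\<And>q x. q \<in> Q \<Longrightarrow> q \<notin> R \<Longrightarrow> x \<in> S \<Longrightarrow> F q x = 0"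
    and "finite R" "card R \<le> m"
  shows "bd k S h (m * A) (\<lambda>x. \<Sum>q\<in>Q. F q x)"
proof -
  have "bd k S h (card (Q \<inter> R) * A) (\<lambda>x. \<Sum>q\<in>Q \<inter> R. F q x)"
    by (rule bd_sum) (use assms in auto)
  moreover have "card (Q \<inter> R) \<le> m" using card_mono[of R "Q \<inter> R"] assms by auto
  ultimately have "bd k S h (m * A) (\<lambda>x. \<Sum>q\<in>Q \<inter> R. F q x)"
    using assms(2,4) by (elim bd_mono) (auto intro: mult_right_mono)
  then show ?thesis
    by (rule bd_cong[OF assms(1), rotated]) (use assms(3,6) in \<open>auto intro!: sum.mono_neutral_left\<close>)
qed

lemma bd_prod:
  assumes "open S" "S \<noteq> {}" "h > 0" "finite Q" "\<And>q. q \<in> Q \<Longrightarrow> Ck k S (F q)" "\<And>q. q \<in> Q \<Longrightarrow> bd k S h A (F q)"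
  shows "bd k S h ((2 ^ k * A) ^ card Q) (\<lambda>x. \<Prod>q\<in>Q. F q x)"
  using assms(4-)
proof (induction Q rule: finite_induct)
  case empty
  then show ?case using bd_const[of 1 1 h] assms(3) by simp
next
  case (insert q Q)
  have "bd k S h (2 ^ k * A * (2 ^ k * A) ^ card Q) (\<lambda>x. F q x * (\<Prod>q\<in>Q. F q x))"
    by (intro bd_mult assms(1,2) Ck_prod insert) (use insert in auto)
  then show ?case using insert by (simp add: algebra_simps)
qed

text \<open>In order \<open>j\<close> the bound \<open>A / h^j\<close> is at most
  \<open>c^j * A / h'^j\<close>, and \<open>c^k\<close> serves all orders \<open>j \<le> k\<close>
  at once. This passes from the grid spacing to the distance from the compact set.\<close>

lemma bd_rescale:
  assumes "h > 0" "h' > 0" "c \<ge> 1" "h' \<le> c * h" "S \<noteq> {}"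
  shows "bd k S h A F \<Longrightarrow> bd k S h' (c ^ k * A) F"
proof (induction k arbitrary: F A)
  case (Suc k)
  have A: "A \<ge> 0" using bd_imp_abs_le[OF Suc.prems] assms(5) abs_ge_zero order_trans by blast
  have "bd k S h' (c ^ k * (A / h)) (pd i F)" for i
    by (rule Suc.IH) (use Suc.prems in auto)
  moreover have "c ^ k * (A / h) \<le> c ^ Suc k * A / h'"
  proof -
    have "1 / h \<le> c / h'" using assms by (simp add: field_simps)
    then have "c ^ k * A * (1 / h) \<le> c ^ k * A * (c / h')"
      using assms A by (intro mult_left_mono) auto
    then show ?thesis by (simp add: mult_ac)
  qed
  ultimately have "bd k S h' (c ^ Suc k * A / h') (pd i F)" for i
    using bd_mono assms(2) by blast
  moreover have "\<bar>F x\<bar> \<le> c ^ Suc k * A" if "x \<in> S" for x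
    using bd_imp_abs_le[OF Suc.prems that] mult_right_mono[OF one_le_power[OF assms(3), of "Suc k"] A] by simp
  ultimately show ?case by simp
qed auto

lemma jetfam_pd:
  "jetfam p S D \<Longrightarrow> mdeg \<beta> < p \<Longrightarrow> x \<in> S \<Longrightarrow> pd i (D \<beta>) x = D (inc i \<beta>) x"
  by (rule has_partial_imp_pd, rule jetfam_has_partial)

text \<open>Turns pointwise bounds on all members of a family, the form in which Taylor estimates
  arrive, into \<open>bd\<close>, which is stable under products; \<open>jetfam_of_bd\<close> leads
  back.\<close>

lemma bd_of_jetfam:
  assumes "open S" "jetfam p S D" "h > 0"
    "\<And>\<beta> x. mdeg \<beta> \<le> p \<Longrightarrow> x \<in> S \<Longrightarrow> \<bar>D \<beta> x\<bar> \<le> A / h ^ mdeg \<beta>"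
  shows "mdeg \<beta> + k \<le> p \<Longrightarrow> bd k S h (A / h ^ mdeg \<beta>) (D \<beta>)"
proof (induction k arbitrary: \<beta>)
  case 0
  then show ?case using assms(4) by auto
next
  case (Suc k)
  have "bd k S h (A / h ^ mdeg \<beta> / h) (pd i (D \<beta>))" for i
  proof (rule bd_cong[OF assms(1)])
    show "bd k S h (A / h ^ mdeg \<beta> / h) (D (inc i \<beta>))"
      using Suc.IH[of "inc i \<beta>"] Suc.prems by (simp add: mult.commute)
    show "D (inc i \<beta>) x = pd i (D \<beta>) x" if "x \<in> S" for x
      using jetfam_pd[OF assms(2) _ that] Suc.prems by simp
  qed
  moreover have "\<forall>x\<in>S. \<bar>D \<beta> x\<bar> \<le> A / h ^ mdeg \<beta>" using assms(4) Suc.prems by auto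
  ultimately show ?case by simp
qed

lemma jetfam_of_bd:
  assumes "open S" "jetfam p S D" "bd p S h A (D (\<lambda>_. 0))"
  shows "mdeg \<beta> \<le> p \<Longrightarrow> bd (p - mdeg \<beta>) S h (A / h ^ mdeg \<beta>) (D \<beta>)"
proof (induction "mdeg \<beta>" arbitrary: \<beta>)
  case 0
  then have "\<beta> = (\<lambda>_. 0)" by simp
  then show ?case using assms(3) by simp
next
  case (Suc k)
  obtain \<gamma> i where \<gamma>: "\<beta> = inc i \<gamma>" "mdeg \<gamma> = k" using mdeg_pos_decomp Suc.hyps(2) by metis
  have "bd (p - mdeg \<gamma>) S h (A / h ^ mdeg \<gamma>) (D \<gamma>)"
    using Suc.hyps(1)[of \<gamma>] Suc.prems \<gamma> by simp
  moreover have "p - mdeg \<gamma> = Suc (p - mdeg \<beta>)" using Suc.prems \<gamma> by simp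
  ultimately have "bd (p - mdeg \<beta>) S h (A / h ^ mdeg \<gamma> / h) (pd i (D \<gamma>))" by auto
  then have "bd (p - mdeg \<beta>) S h (A / h ^ mdeg \<gamma> / h) (D \<beta>)"
  proof (rule bd_cong[OF assms(1), rotated])
    show "pd i (D \<gamma>) x = D \<beta> x" if "x \<in> S" for x
      using jetfam_pd[OF assms(2) _ that] Suc.prems \<gamma> by simp
  qed
  then show ?case using \<gamma> by (simp add: mult.commute)
qed

subsection \<open>A partition of unity on a grid\<close>

text \<open>Averaging a step over unit intervals gains one derivative.\<close>

lemma smooth_step_exists:
  "\<exists>A :: nat \<Rightarrow> real \<Rightarrow> real. (\<forall>k\<le>m. continuous_on UNIV (A k)) \<and>
     (\<forall>k<m. \<forall>t. (A k has_real_derivative A (Suc k) t) (at t)) \<and>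
     (\<forall>k\<le>m. \<forall>t. \<bar>A k t\<bar> \<le> 2 ^ k) \<and> (\<forall>t\<le>0. A 0 t = 0) \<and> (\<forall>t\<ge>1 + real m. A 0 t = 1)"
proof (induction m)
  case 0
  show ?case
    by (rule exI[of _ "\<lambda>_ t. max 0 (min 1 t)"]) (auto intro!: continuous_intros)
next
  case (Suc m)
  then obtain A :: "nat \<Rightarrow> real \<Rightarrow> real" where IH: "\<forall>k\<le>m. continuous_on UNIV (A k)"
    "\<forall>k<m. \<forall>t. (A k has_real_derivative A (Suc k) t) (at t)" "\<forall>k\<le>m. \<forall>t. \<bar>A k t\<bar> \<le> 2 ^ k"
    "\<forall>t\<le>0. A 0 t = 0" "\<forall>t\<ge>1 + real m. A 0 t = 1"
    by (elim exE conjE)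
  note A = IH[rule_format]
  have A0: "continuous_on T (A 0)" for T using continuous_on_subset[OF A(1)[of 0] subset_UNIV] by simp
  have int: "A 0 integrable_on {a..b}" for a b
    by (intro integrable_continuous_real A0)
  define S where "S t = integral {t - 1..t} (A 0)" for t
  \<comment> \<open>Near \<open>t\<close> the average is \<open>J u - J (u - 1)\<close> for one
    antiderivative \<open>J\<close>; its base point \<open>t - 2\<close> lies to the left of both
    arguments.\<close>
  have S': "(S has_real_derivative A 0 t - A 0 (t - 1)) (at t)" for t
  proof -
    define c where "c = t - 2"
    define J where "J u = integral {c..u} (A 0)" for u
    have J: "(J has_real_derivative A 0 u) (at u)" if "c < u" "u < t + 1" for u
    proof -
      have "(J has_real_derivative A 0 u) (at u within {c..t + 1})"
        unfolding J_def by (intro integral_has_real_derivative A0) (use that in auto)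
      moreover have "at u within {c..t + 1} = at u" using that by (intro at_within_interior) auto
      ultimately show ?thesis by simp
    qed
    have "((\<lambda>u. J (u - 1)) has_real_derivative A 0 (t - 1)) (at t)"
      using DERIV_shift[of J "A 0 (t - 1)" t "-1"] J[of "t - 1"] by (simp add: c_def)
    then have "((\<lambda>u. J u - J (u - 1)) has_real_derivative A 0 t - A 0 (t - 1)) (at t)"
      by (intro DERIV_diff J) (auto simp: c_def)
    moreover have "eventually (\<lambda>u. J u - J (u - 1) = S u) (nhds t)"
    proof -
      have "J u - J (u - 1) = S u" if "u > c + 1" for u
        using Henstock_Kurzweil_Integration.integral_combine[of c "u - 1" u "A 0"] int that
        unfolding J_def S_def by simp
      then show ?thesis
        using eventually_nhds_in_open[of "{c + 1<..}" t] by (auto simp: c_def elim: eventually_mono)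
    qed
    ultimately show ?thesis by (subst DERIV_cong_ev[OF refl _ refl]) (auto simp: eq_commute)
  qed
  \<comment> \<open>The average comes in front and the derivatives become differences over unit
    steps. So bounds at most double with each order and the transition interval grows by 1.\<close>
  define B where "B k t = (case k of 0 \<Rightarrow> S t | Suc l \<Rightarrow> A l t - A l (t - 1))" for k t
  have B0: "B 0 = S" and BS: "B (Suc l) = (\<lambda>t. A l t - A l (t - 1))" for l
    by (simp_all add: B_def fun_eq_iff)
  show ?case
  proof (intro exI[of _ B] conjI allI impI)
    fix k assume k: "k \<le> Suc m"
    show "continuous_on UNIV (B k)"
    proof (cases k)
      case 0
      have "isCont S t" for t using S' DERIV_isCont by blast
      then show ?thesis using 0 by (simp add: B_def continuous_at_imp_continuous_on)
    next
      case (Suc l)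
      then have "continuous_on UNIV (A l)" using A(1) k by simp
      then show ?thesis unfolding B_def Suc
        by (auto intro!: continuous_intros continuous_on_compose2[of UNIV "A l" UNIV "\<lambda>t. t - 1"])
    qed
    show "\<bar>B k t\<bar> \<le> 2 ^ k" for t
    proof (cases k)
      case 0
      have "norm (integral {t - 1..t} (A 0)) \<le> 1 * (t - (t - 1))"
        using A(3)[of 0] by (intro integral_bound A0) auto
      then show ?thesis using 0 by (simp add: B_def S_def)
    next
      case (Suc l)
      then show ?thesis using A(3)[of l t] A(3)[of l "t - 1"] k by (simp add: B_def)
    qed
  next
    fix k t assume "k < Suc m"
    show "(B k has_real_derivative B (Suc k) t) (at t)"
    proof (cases k)
      case 0
      then show ?thesis using S' by (simp add: B0 BS)
    next
      case (Suc l)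
      then have "l < m" using \<open>k < Suc m\<close> by simp
      have "((\<lambda>u. A l (u - 1)) has_real_derivative A (Suc l) (t - 1)) (at t)"
        using DERIV_shift[of "A l" "A (Suc l) (t - 1)" t "-1"] A(2)[OF \<open>l < m\<close>, of "t - 1"] by simp
      then show ?thesis unfolding BS Suc using A(2)[OF \<open>l < m\<close>] A(2)[OF \<open>l < m\<close>] by (auto intro!: DERIV_diff)
    qed
  next
    fix t :: real assume "t \<le> 0"
    then have "S t = integral {t - 1..t} (\<lambda>_. 0)"
      unfolding S_def by (intro integral_cong) (use A(4) in auto)
    then show "B 0 t = 0" by (simp add: B_def)
  next
    fix t :: real assume "t \<ge> 1 + real (Suc m)"
    then have "S t = integral {t - 1..t} (\<lambda>_. 1)"
      unfolding S_def by (intro integral_cong) (use A(5) in auto)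
    then show "B 0 t = 1" by (simp add: B_def)
  qed
qed


text \<open>\<open>step m k\<close> is the \<open>k\<close>-th derivative of a function of class C^m
  that is 0 up to 0 and 1 from \<open>1 + m\<close> onwards.\<close>

definition step :: "nat \<Rightarrow> nat \<Rightarrow> real \<Rightarrow> real" where
  "step m = (SOME A. (\<forall>k\<le>m. continuous_on UNIV (A k)) \<and>
     (\<forall>k<m. \<forall>t. (A k has_real_derivative A (Suc k) t) (at t)) \<and>
     (\<forall>k\<le>m. \<forall>t. \<bar>A k t\<bar> \<le> 2 ^ k) \<and> (\<forall>t\<le>0. A 0 t = 0) \<and> (\<forall>t\<ge>1 + real m. A 0 t = 1))"

lemma step_properties:
  shows continuous_on_step: "k \<le> m \<Longrightarrow> continuous_on UNIV (step m k)"
    and DERIV_step: "k < m \<Longrightarrow> (step m k has_real_derivative step m (Suc k) t) (at t)"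
    and abs_step_le: "k \<le> m \<Longrightarrow> \<bar>step m k t\<bar> \<le> 2 ^ k"
    and step_eq_0: "t \<le> 0 \<Longrightarrow> step m 0 t = 0"
    and step_eq_1: "t \<ge> 1 + real m \<Longrightarrow> step m 0 t = 1"
  using someI_ex[OF smooth_step_exists[of m], folded step_def] by blast+

text \<open>As a difference of two unit translates, this makes the sum over integer translates
  telescope; for \<open>k = 0\<close> it vanishes outside \<open>[-1, 1 + m]\<close>.\<close>

definition bump :: "nat \<Rightarrow> nat \<Rightarrow> real \<Rightarrow> real" where
  "bump m k t = step m k (t + 1) - step m k t"

lemma continuous_on_bump: "k \<le> m \<Longrightarrow> continuous_on UNIV (bump m k)"
  unfolding bump_def using continuous_on_step
  by (intro continuous_intros continuous_on_compose2[of UNIV "step m k" UNIV "\<lambda>t. t + 1"]) auto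

lemma DERIV_bump:
  assumes "k < m"
  shows "(bump m k has_real_derivative bump m (Suc k) t) (at t)"
proof -
  have "((\<lambda>u. step m k (u + 1)) has_real_derivative step m (Suc k) (t + 1)) (at t)"
    using DERIV_shift[of "step m k" "step m (Suc k) (t + 1)" t 1] DERIV_step[OF assms] by simp
  then show ?thesis unfolding bump_def using DERIV_step[OF assms] by (intro DERIV_diff)
qed

lemma abs_bump_le: "k \<le> m \<Longrightarrow> \<bar>bump m k t\<bar> \<le> 2 ^ Suc m"
proof -
  assume "k \<le> m"
  have "\<bar>bump m k t\<bar> \<le> 2 ^ k + 2 ^ k"
    unfolding bump_def using abs_step_le[OF \<open>k \<le> m\<close>, of t] abs_step_le[OF \<open>k \<le> m\<close>, of "t + 1"] by linarith
  also have "\<dots> = 2 ^ Suc k" by simp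
  also have "\<dots> \<le> 2 ^ Suc m" using \<open>k \<le> m\<close> by (intro power_increasing) auto
  finally show ?thesis .
qed

lemma bump_nonzero: "bump m 0 t \<noteq> 0 \<Longrightarrow> \<bar>t\<bar> \<le> 1 + real m"
  unfolding bump_def using step_eq_0[of t] step_eq_0[of "t + 1"] step_eq_1[of m t] step_eq_1[of m "t + 1"]
  by (smt (verit) of_nat_0_le_iff)

text \<open>Telescoping leaves \<open>step m 0 (t - a + 1) - step m 0 (t - b)\<close>, and the
  hypotheses place the two arguments where the step is 1 and 0.\<close>

lemma bump_sum:
  fixes t :: real and a b :: int
  assumes "t - a + 1 \<ge> 1 + real m" "t - b \<le> 0" "a \<le> b + 1"
  shows "(\<Sum>k\<in>{a..b}. bump m 0 (t - k)) = 1"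
proof -
  have "(\<Sum>k\<in>{a..a + int n - 1}. bump m 0 (t - k)) = step m 0 (t - a + 1) - step m 0 (t - (a + int n) + 1)" for n
  proof (induction n)
    case (Suc n)
    have "{a..a + int (Suc n) - 1} = insert (a + int n) {a..a + int n - 1}" by auto
    then show ?case using Suc by (simp add: bump_def algebra_simps)
  qed simp
  from this[of "nat (b + 1 - a)"] show ?thesis
    using assms step_eq_1[of m "t - a + 1"] step_eq_0[of "t - b" m] by simp
qed

text \<open>Stated for all \<open>k\<close> because differentiating raises \<open>k\<close> and
  contributes \<open>1 / e\<close>, exactly the loss that \<open>bd\<close> allows per order at
  scale \<open>e\<close>. The constant depends on \<open>m\<close> alone, so it survives the
  induction.\<close>

lemma coordinate_bump:
  assumes "e > 0"
  shows "k + l \<le> m \<Longrightarrow> Ck l UNIV (\<lambda>x::real^'n::finite. bump m k (x$i / e - c)) \<and>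
    bd l UNIV e (2 ^ Suc m) (\<lambda>x::real^'n. bump m k (x$i / e - c))"
proof (induction l arbitrary: k)
  case 0
  have "continuous_on UNIV (\<lambda>x::real^'n. bump m k (x$i / e - c))"
    using continuous_on_bump[of k m] 0 assms
    by (intro continuous_on_compose2[of UNIV "bump m k" UNIV "\<lambda>x::real^'n. x$i / e - c"] continuous_intros) auto
  then show ?case using 0 abs_bump_le by auto
next
  case (Suc l)
  let ?F = "\<lambda>k x::real^'n. bump m k (x$i / e - c)"
  have hp: "has_partial j (?F k) ((if j = i then 1 / e else 0) * ?F (Suc k) x) x" for j x
  proof (cases "j = i")
    case True
    have "((\<lambda>t. (x + t *\<^sub>R axis j 1)$i / e - c) has_real_derivative 1 / e) (at 0)"
      using True assms by (auto intro!: derivative_eq_intros)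
    moreover have "(bump m k has_real_derivative ?F (Suc k) x) (at ((x + 0 *\<^sub>R axis j 1)$i / e - c))"
      using DERIV_bump[of k m] Suc.prems by simp
    ultimately have "((\<lambda>t. bump m k ((x + t *\<^sub>R axis j 1)$i / e - c)) has_real_derivative ?F (Suc k) x * (1 / e)) (at 0)"
      by (rule DERIV_chain2[rotated])
    then show ?thesis using True unfolding has_partial_def by (simp add: mult.commute)
  next
    case False
    then have "(axis j 1 :: real^'n)$i = 0" by (simp add: axis_def)
    then show ?thesis using False unfolding has_partial_def by simp
  qed
  have IH: "Ck l UNIV (?F (Suc k))" "bd l UNIV e (2 ^ Suc m) (?F (Suc k))"
    using Suc.IH[of "Suc k"] Suc.prems by auto
  have "Ck (Suc l) UNIV (?F k)"
  proof (rule Ck_SucI[OF open_UNIV _ hp])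
    show "continuous_on UNIV (?F k)"
      using continuous_on_bump[of k m] Suc.prems assms
      by (intro continuous_on_compose2[of UNIV "bump m k" UNIV "\<lambda>x::real^'n. x$i / e - c"] continuous_intros) auto
  qed (intro Ck_cmult open_UNIV IH)
  moreover have "bd l UNIV e (2 ^ Suc m / e) (pd j (?F k))" for j
  proof -
    have "bd l UNIV e (\<bar>if j = i then 1 / e else 0\<bar> * 2 ^ Suc m) (\<lambda>x. (if j = i then 1 / e else 0) * ?F (Suc k) x)"
      by (rule bd_cmult[OF open_UNIV IH])
    then have "bd l UNIV e (2 ^ Suc m / e) (\<lambda>x. (if j = i then 1 / e else 0) * ?F (Suc k) x)"
      by (rule bd_mono) (use assms in auto)
    then show ?thesis
      by (rule bd_cong[OF open_UNIV, rotated]) (rule has_partial_imp_pd[OF hp, symmetric])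
  qed
  moreover have "\<bar>?F k x\<bar> \<le> 2 ^ Suc m" for x using abs_bump_le Suc.prems by simp
  ultimately show ?case by (simp only: bd.simps) blast
qed

section \<open>Tensor-product bumps on the grid of spacing \<open>e\<close>\<close>

definition gp :: "real \<Rightarrow> ('n \<Rightarrow> int) \<Rightarrow> real^'n::finite" where
  "gp e q = (\<chi> i. e * q i)"

definition theta :: "nat \<Rightarrow> real \<Rightarrow> ('n::finite \<Rightarrow> int) \<Rightarrow> real^'n \<Rightarrow> real" where
  "theta p e q x = (\<Prod>i\<in>UNIV. bump p 0 (x$i / e - q i))"

lemma Ck_theta: "e > 0 \<Longrightarrow> Ck p UNIV (theta p e q)"
  unfolding theta_def using coordinate_bump[of e 0 p p] by (intro Ck_prod) auto

lemma bd_theta: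
  assumes "e > 0"
  shows "bd p UNIV e ((2 ^ p * 2 ^ Suc p) ^ CARD('n)) (theta p e (q :: 'n::finite \<Rightarrow> int))"
proof -
  have "bd p UNIV e ((2 ^ p * 2 ^ Suc p) ^ CARD('n)) (\<lambda>x. \<Prod>i\<in>UNIV. bump p 0 (x$i / e - q i))"
    by (rule bd_prod) (use coordinate_bump[OF assms, of 0 p p] assms in \<open>auto simp del: power_Suc\<close>)
  then show ?thesis by (simp add: theta_def[abs_def])
qed

lemma theta_nonzero_component:
  "theta p e q x \<noteq> 0 \<Longrightarrow> \<bar>x$i / e - q i\<bar> \<le> 1 + real p"
  unfolding theta_def using bump_nonzero by (metis UNIV_I finite prod_zero)

text \<open>Each coordinate is off by at most \<open>(1 + p) * e\<close>, and the l1 norm, which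
  dominates the Euclidean one, collects \<open>CARD('n)\<close> of these.\<close>

lemma theta_nonzero:
  fixes q :: "'n::finite \<Rightarrow> int"
  assumes "e > 0" "theta p e q x \<noteq> 0"
  shows "dist x (gp e q) \<le> real (CARD('n) * (1 + p)) * e"
proof -
  have "norm (x - gp e q) \<le> (\<Sum>i\<in>UNIV. \<bar>(x - gp e q)$i\<bar>)" by (rule norm_le_l1_cart)
  also have "\<dots> \<le> (\<Sum>i\<in>(UNIV::'n set). (1 + real p) * e)"
  proof (rule sum_mono)
    fix i
    have "\<bar>(x - gp e q)$i\<bar> = \<bar>x$i / e - q i\<bar> * e"
    proof -
      have "(x - gp e q)$i = (x$i / e - q i) * e" using assms(1) by (simp add: gp_def field_simps)
      then show ?thesis using assms(1) by (simp add: abs_mult)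
    qed
    also have "\<dots> \<le> (1 + real p) * e"
      using theta_nonzero_component[OF assms(2)] assms(1) by (intro mult_right_mono) auto
    finally show "\<bar>(x - gp e q)$i\<bar> \<le> (1 + real p) * e" .
  qed
  finally show ?thesis by (simp add: dist_norm algebra_simps)
qed

text \<open>Any finite \<open>Q\<close> containing the active indices gives the same sum as a box of
  indices, and over a box the sum of products factors into one-dimensional telescoping sums.\<close>

lemma theta_sum:
  fixes x :: "real^'n::finite"
  assumes "e > 0" "finite Q" "\<And>q. theta p e q x \<noteq> 0 \<Longrightarrow> q \<in> Q"
  shows "(\<Sum>q\<in>Q. theta p e q x) = 1"
proof -
  define a where "a i = \<lfloor>x$i / e - (1 + real p)\<rfloor>" for i
  define b where "b i = \<lceil>x$i / e + (1 + real p)\<rceil>" for i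
  let ?B = "PiE UNIV (\<lambda>i. {a i..b i})"
  have inB: "q \<in> ?B" if "theta p e q x \<noteq> 0" for q
  proof -
    have "a i \<le> q i \<and> q i \<le> b i" for i
    proof -
      have "\<bar>x$i / e - q i\<bar> \<le> 1 + real p" using theta_nonzero_component[OF that] .
      then have "x$i / e - (1 + real p) \<le> q i" "q i \<le> x$i / e + (1 + real p)" by linarith+
      then show ?thesis unfolding a_def b_def by linarith
    qed
    then show ?thesis by auto
  qed
  have fin: "finite ?B" by (rule finite_PiE) auto
  have "(\<Sum>q\<in>Q. theta p e q x) = (\<Sum>q\<in>Q \<inter> ?B. theta p e q x)"
    by (rule sum.mono_neutral_right) (use assms inB in auto)
  also have "\<dots> = (\<Sum>q\<in>?B. theta p e q x)"
    by (rule sum.mono_neutral_left) (use assms fin in auto)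
  also have "\<dots> = (\<Prod>i\<in>UNIV. \<Sum>k\<in>{a i..b i}. bump p 0 (x$i / e - k))"
    unfolding theta_def by (rule prod_sum_PiE[symmetric]) auto
  also have "\<dots> = 1"
  proof (rule prod.neutral, rule ballI)
    fix i
    show "(\<Sum>k\<in>{a i..b i}. bump p 0 (x$i / e - k)) = 1"
    proof (rule bump_sum)
      show "x$i / e - a i + 1 \<ge> 1 + real p" unfolding a_def by linarith
      show "x$i / e - b i \<le> 0" unfolding b_def by linarith
      show "a i \<le> b i + 1" unfolding a_def b_def by linarith
    qed
  qed
  finally show ?thesis .
qed

text \<open>Each coordinate of \<open>q\<close> ranges over at most \<open>2 * C + 1\<close>
  integers. What matters is that the bound is free of \<open>e\<close> and \<open>x\<close>.\<close>

lemma grid_count: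
  fixes x :: "real^'n::finite"
  assumes "e > 0"
  shows "finite {q. dist x (gp e q) \<le> real C * e}" (is "finite ?S")
    and "card {q. dist x (gp e q) \<le> real C * e} \<le> (2 * C + 1) ^ CARD('n)"
proof -
  let ?I = "\<lambda>i. {\<lceil>x$i / e - real C\<rceil>..\<lfloor>x$i / e + real C\<rfloor>}"
  have sub: "?S \<subseteq> PiE UNIV ?I"
  proof
    fix q assume "q \<in> ?S"
    then have q: "norm (x - gp e q) \<le> real C * e" by (simp add: dist_norm)
    have "q i \<in> ?I i" for i
    proof -
      have "\<bar>(x - gp e q)$i\<bar> \<le> real C * e" using component_le_norm_cart[of "x - gp e q" i] q by linarith
      then have "\<bar>x$i - e * q i\<bar> \<le> real C * e" by (simp add: gp_def)
      then have "\<bar>x$i / e - q i\<bar> \<le> real C"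
        using assms by (simp add: field_simps abs_le_iff)
      then have "x$i / e - real C \<le> q i" "q i \<le> x$i / e + real C" by linarith+
      then show ?thesis unfolding atLeastAtMost_iff by (intro conjI) linarith+
    qed
    then show "q \<in> PiE UNIV ?I" by auto
  qed
  have fin: "finite (PiE UNIV ?I)" by (rule finite_PiE) auto
  show "finite ?S" using sub fin finite_subset by blast
  have "card ?S \<le> card (PiE UNIV ?I)" using sub fin card_mono by blast
  also have "\<dots> = (\<Prod>i\<in>UNIV. card (?I i))" by (rule card_PiE) simp
  also have "\<dots> \<le> (\<Prod>i\<in>(UNIV::'n set). 2 * C + 1)"
  proof (rule prod_mono, rule conjI)
    fix i
    have "\<lfloor>x$i / e + real C\<rfloor> + 1 - \<lceil>x$i / e - real C\<rceil> \<le> int (2 * C + 1)" by linarith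
    then show "card (?I i) \<le> 2 * C + 1" by (simp only: card_atLeastAtMost_int nat_le_iff)
  qed simp
  finally show "card ?S \<le> (2 * C + 1) ^ CARD('n)" by simp
qed

subsection \<open>Whitney's extension theorem for compact sets\<close>

locale whitney_field =
  fixes K :: "(real^'n::finite) set" and g :: "('n \<Rightarrow> nat) \<Rightarrow> real^'n \<Rightarrow> real" and p :: nat
  assumes compact_K: "compact K" and K_ne: "K \<noteq> {}"
    and whitney: "\<And>e. e > 0 \<Longrightarrow> \<exists>d>0. \<forall>x\<in>K. \<forall>y\<in>K. dist x y < d \<longrightarrow> (\<forall>\<beta>. mdeg \<beta> \<le> p \<longrightarrow>
      \<bar>g \<beta> y - tay p (\<lambda>\<gamma>. g \<gamma> x) x \<beta> y\<bar> \<le> e * dist x y ^ (p - mdeg \<beta>))"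
begin

abbreviation T :: "real^'n \<Rightarrow> ('n \<Rightarrow> nat) \<Rightarrow> real^'n \<Rightarrow> real" where
  "T a \<equiv> tay p (\<lambda>\<gamma>. g \<gamma> a) a"

definition close :: "real \<Rightarrow> real \<Rightarrow> bool" where
  "close e d \<longleftrightarrow> (\<forall>x\<in>K. \<forall>y\<in>K. dist x y < d \<longrightarrow> (\<forall>\<beta>. mdeg \<beta> \<le> p \<longrightarrow>
      \<bar>g \<beta> y - T x \<beta> y\<bar> \<le> e * dist x y ^ (p - mdeg \<beta>)))"

text \<open>The difference of two Taylor polynomials is itself a family with constant top-order
  members, and its values at \<open>a'\<close> are Whitney remainders. \<open>jetfam_bound\<close>
  carries the bound from \<open>a'\<close> to \<open>z\<close>.\<close>

lemma tay_compare:
  fixes e h \<delta> :: real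
  assumes "close e \<delta>" "e > 0" "a \<in> K" "a' \<in> K" "dist a a' < \<delta>" "dist a a' \<le> h" "dist z a' \<le> h" "mdeg \<beta> \<le> p"
  shows "\<bar>T a' \<beta> z - T a \<beta> z\<bar> \<le> (1 + CARD('n)) ^ p * e * h ^ (p - mdeg \<beta>)"
proof -
  define Q where "Q \<alpha> x = T a' \<alpha> x - T a \<alpha> x" for \<alpha> x
  have h: "h \<ge> 0" using assms(6) zero_le_dist order_trans by blast
  have base: "\<bar>Q \<alpha> a'\<bar> \<le> e * h ^ (p - mdeg \<alpha>)" if "mdeg \<alpha> \<le> p" for \<alpha>
  proof -
    have "\<bar>Q \<alpha> a'\<bar> \<le> e * dist a a' ^ (p - mdeg \<alpha>)"
      using assms that unfolding close_def Q_def by simp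
    also have "\<dots> \<le> e * h ^ (p - mdeg \<alpha>)"
      using assms by (intro mult_left_mono power_mono) auto
    finally show ?thesis .
  qed
  have "\<bar>Q \<beta> z\<bar> \<le> (1 + CARD('n)) ^ (p - mdeg \<beta>) * e * h ^ (p - mdeg \<beta>)"
  proof (rule jetfam_bound[OF open_UNIV, where S = "closed_segment a' z" and a = a'])
    show "jetfam p UNIV Q" unfolding Q_def by (intro jetfam_diff jetfam_tay)
    show "norm (x - a') \<le> h" if "x \<in> closed_segment a' z" for x
      using segment_bound(1)[OF that] assms(7) by (simp add: dist_norm)
    show "\<bar>Q \<alpha> x\<bar> \<le> e" if "mdeg \<alpha> = p" for \<alpha> x
      using base[of \<alpha>] that by (simp add: Q_def tay_top)
  qed (use base assms in auto)
  also have "\<dots> \<le> (1 + CARD('n)) ^ p * e * h ^ (p - mdeg \<beta>)"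
  proof (intro mult_right_mono)
    show "real ((1 + CARD('n)) ^ (p - mdeg \<beta>)) \<le> real ((1 + CARD('n)) ^ p)"
      unfolding of_nat_le_iff by (rule power_increasing) auto
  qed (use assms h in auto)
  finally show ?thesis unfolding Q_def .
qed

section \<open>Dyadic construction of the extension off \<open>K\<close>\<close>

definition rho :: nat where "rho = CARD('n) * (1 + p)"

definition near :: "real^'n \<Rightarrow> real^'n" where
  "near x = (SOME a. a \<in> K \<and> infdist x K = dist x a)"

lemma near: "near x \<in> K" "infdist x K = dist x (near x)"
proof -
  have "\<exists>a. a \<in> K \<and> infdist x K = dist x a"
    using infdist_attains_inf[of K x] compact_K K_ne compact_imp_closed by blast
  from someI_ex[OF this] show "near x \<in> K" "infdist x K = dist x (near x)" unfolding near_def by auto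
qed

definition grid :: "nat \<Rightarrow> real \<Rightarrow> ('n \<Rightarrow> int) set" where
  "grid c e = {q. infdist (gp e q) K \<le> real c * e}"

text \<open>\<open>rho\<close> is the support radius of \<open>theta\<close> in units of the
  spacing. Within \<open>e\<close> of \<open>K\<close> all active grid points are therefore at most
  \<open>rho + 1\<close> spacings from \<open>K\<close>, so the value is 1; beyond
  \<open>2 * rho + 1\<close> spacings it is 0.\<close>

definition cutoff :: "real \<Rightarrow> real^'n \<Rightarrow> real" where
  "cutoff e x = (\<Sum>q\<in>grid (rho + 1) e. theta p e q x)"

text \<open>The range \<open>7 * rho + 3\<close> is \<open>6 * rho + 3\<close>, the largest distance
  from \<open>K\<close>, in spacings, at which this scale is used, plus \<open>rho\<close> for the
  support of \<open>theta\<close>.\<close>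

definition patch :: "real \<Rightarrow> real^'n \<Rightarrow> real" where
  "patch e x = (\<Sum>q\<in>grid (7 * rho + 3) e. theta p e q x * T (near (gp e q)) (\<lambda>_. 0) x)"

definition eps :: "nat \<Rightarrow> real" where "eps j = (1/2) ^ j"

definition w :: "nat \<Rightarrow> real^'n \<Rightarrow> real" where
  "w j x = cutoff (eps j) x - cutoff (eps (Suc j)) x"

text \<open>Whitney's extension: Taylor polynomials averaged on each dyadic shell, with shell
  weights \<open>w j\<close>. On a ball off \<open>K\<close> the active scales lie in one fixed
  finite set (\<open>G_local\<close>), which gives smoothness and estimates.\<close>

definition G :: "real^'n \<Rightarrow> real" where
  "G x = (\<Sum>j\<in>{j. w j x \<noteq> 0}. w j x * patch (eps j) x)"

lemma eps_pos [simp]: "eps j > 0" by (simp add: eps_def)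

lemma theta_dist:
  fixes e :: real and x :: "real^'n"
  shows "e > 0 \<Longrightarrow> theta p e q x \<noteq> 0 \<Longrightarrow> dist x (gp e q) \<le> real rho * e"
  using theta_nonzero[of e p q x] by (simp add: rho_def)

lemma finite_grid:
  fixes e :: real
  assumes "e > 0"
  shows "finite (grid c e)"
proof -
  obtain R where R: "\<And>x. x \<in> K \<Longrightarrow> norm x \<le> R"
    using compact_K compact_imp_bounded bounded_iff by metis
  obtain C :: nat where C: "R / e + real c \<le> real C" using real_arch_simple by blast
  have "dist 0 (gp e q) \<le> real C * e" if "q \<in> grid c e" for q
  proof -
    have "dist 0 (gp e q) \<le> norm (near (gp e q)) + dist (gp e q) (near (gp e q))"
      using dist_triangle2[of 0 "gp e q" "near (gp e q)"] by simp
    also have "\<dots> \<le> R + real c * e"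
      using R[OF near(1)] near(2)[of "gp e q"] that by (simp add: grid_def add_mono)
    also have "\<dots> = (R / e + real c) * e" using assms by (simp add: field_simps)
    also have "\<dots> \<le> real C * e" using C assms by (intro mult_right_mono) auto
    finally show ?thesis .
  qed
  then have "grid c e \<subseteq> {q. dist 0 (gp e q) \<le> real C * e}" by blast
  then show ?thesis using grid_count(1)[OF assms] finite_subset by blast
qed

lemma theta_grid_sum:
  fixes e :: real
  assumes "e > 0" "infdist x K \<le> real c * e"
  shows "(\<Sum>q\<in>grid (c + rho) e. theta p e q x) = 1"
proof (rule theta_sum[OF assms(1) finite_grid[OF assms(1)]])
  fix q :: "'n \<Rightarrow> int" assume "theta p e q x \<noteq> 0"
  then have "dist x (gp e q) \<le> real rho * e" by (rule theta_dist[OF assms(1)])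
  moreover have "infdist (gp e q) K \<le> infdist x K + dist (gp e q) x" by (rule infdist_triangle)
  ultimately show "q \<in> grid (c + rho) e"
    using assms(2) by (simp add: grid_def dist_commute algebra_simps)
qed

lemma cutoff_eq_1: "e > 0 \<Longrightarrow> infdist x K \<le> e \<Longrightarrow> cutoff e x = 1"
  unfolding cutoff_def using theta_grid_sum[of e x 1] by (simp add: add.commute)

lemma cutoff_eq_0:
  fixes e :: real
  assumes "e > 0" "infdist x K > real (2 * rho + 1) * e"
  shows "cutoff e x = 0"
  unfolding cutoff_def
proof (rule sum.neutral, rule ballI, rule ccontr)
  fix q assume q: "q \<in> grid (rho + 1) e" "theta p e q x \<noteq> 0"
  then have "dist x (gp e q) \<le> real rho * e" using theta_dist assms(1) by blast
  moreover have "infdist x K \<le> infdist (gp e q) K + dist x (gp e q)" by (rule infdist_triangle)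
  ultimately show False using q(1) assms(2) by (simp add: grid_def algebra_simps)
qed

text \<open>\<open>w j\<close> vanishes where both cutoffs are 1, which holds within
  \<open>eps (Suc j) = eps j / 2\<close> of \<open>K\<close>, and where both are 0. So an active
  scale is comparable with the distance to \<open>K\<close>.\<close>

lemma w_nonzero:
  assumes "w j x \<noteq> 0"
  shows "eps j < 2 * infdist x K" "infdist x K \<le> real (2 * rho + 1) * eps j"
proof -
  have e: "eps (Suc j) = eps j / 2" by (simp add: eps_def)
  show "eps j < 2 * infdist x K"
  proof (rule ccontr)
    assume "\<not> ?thesis"
    then have "infdist x K \<le> eps (Suc j)" "infdist x K \<le> eps j"
      using e eps_pos[of j] infdist_nonneg[of x K] by linarith+
    then show False using assms unfolding w_def by (simp add: cutoff_eq_1)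
  qed
  show "infdist x K \<le> real (2 * rho + 1) * eps j"
  proof (rule ccontr)
    assume *: "\<not> ?thesis"
    have "real (2 * rho + 1) * eps (Suc j) \<le> real (2 * rho + 1) * eps j"
      using eps_pos[of j] by (intro mult_left_mono) (auto simp: e)
    then have "cutoff (eps (Suc j)) x = 0" "cutoff (eps j) x = 0"
      using * by (intro cutoff_eq_0 eps_pos; linarith)+
    then show False using assms unfolding w_def by simp
  qed
qed

lemma Ck_cutoff: "e > 0 \<Longrightarrow> Ck p UNIV (cutoff e)"
  unfolding cutoff_def[abs_def] by (intro Ck_sum Ck_theta open_UNIV)

lemma Ck_w: "Ck p UNIV (w j)"
  unfolding w_def[abs_def] by (intro Ck_diff Ck_cutoff open_UNIV eps_pos)

lemma Ck_T: "Ck p UNIV (T a (\<lambda>_. 0))"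
  by (rule jetfam_imp_Ck[OF open_UNIV jetfam_tay]) simp

lemma Ck_patch: "e > 0 \<Longrightarrow> Ck p UNIV (patch e)"
  unfolding patch_def[abs_def] by (intro Ck_sum Ck_mult Ck_T Ck_theta open_UNIV)

text \<open>Twice the constant \<open>2 * rho + 1\<close> of \<open>w_nonzero\<close>: on the ball
  of radius \<open>d / 2\<close> about a point at distance \<open>d\<close>, the distance to
  \<open>K\<close> exceeds \<open>d / 2\<close>. It is also below \<open>3 / 2 * d\<close>, whence
  the 3 in \<open>J\<close>.\<close>

definition c0 :: nat where "c0 = 4 * rho + 2"

definition J :: "real \<Rightarrow> nat set" where
  "J d = {j. d < real c0 * eps j \<and> eps j < 3 * d}"

text \<open>The scales in \<open>J d\<close> are powers of 1/2 within a factor \<open>3 * c0\<close>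
  of each other, and the crude inequality \<open>n < 2^n\<close> bounds their number by that
  factor.\<close>

lemma J_bound: "finite (J d)" "card (J d) \<le> 3 * c0"
proof -
  have "finite (J d) \<and> card (J d) \<le> 3 * c0"
  proof (cases "J d = {}")
    case False
    define j0 where "j0 = (LEAST j. j \<in> J d)"
    have j0: "j0 \<in> J d" unfolding j0_def using False by (metis LeastI ex_in_conv)
    have "J d \<subseteq> {j0..<j0 + 3 * c0}"
    proof
      fix j assume j: "j \<in> J d"
      then have le: "j0 \<le> j" unfolding j0_def by (rule Least_le)
      have "eps j * 2 ^ (j - j0) = eps j0"
      proof -
        have "eps j = eps j0 * (1/2) ^ (j - j0)"
          unfolding eps_def using le by (simp flip: power_add)
        then show ?thesis by (simp add: power_divide)
      qed
      moreover have "d < real c0 * eps j" "eps j0 < 3 * d" using j j0 by (auto simp: J_def)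
      ultimately have "eps j * 2 ^ (j - j0) < eps j * real (3 * c0)" by (simp add: algebra_simps)
      then have "(2::real) ^ (j - j0) < real (3 * c0)" using eps_pos[of j] by (simp del: of_nat_mult)
      then have "2 ^ (j - j0) < 3 * c0"
        by (metis of_nat_less_iff of_nat_numeral of_nat_power)
      then have "j - j0 < 3 * c0" using less_exp[of "j - j0"] by linarith
      then show "j \<in> {j0..<j0 + 3 * c0}" using le by auto
    qed
    then show ?thesis using finite_subset card_mono[of "{j0..<j0 + 3 * c0}" "J d"] by fastforce
  qed simp
  then show "finite (J d)" "card (J d) \<le> 3 * c0" by auto
qed

lemma infdist_ball:
  assumes "x \<in> ball x0 (infdist x0 K / 2)"
  shows "infdist x0 K / 2 < infdist x K" "infdist x K < 3 / 2 * infdist x0 K"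
proof -
  have "infdist x0 K \<le> infdist x K + dist x0 x" "infdist x K \<le> infdist x0 K + dist x x0"
    by (rule infdist_triangle)+
  then show "infdist x0 K / 2 < infdist x K" "infdist x K < 3 / 2 * infdist x0 K"
    using assms by (auto simp: dist_commute)
qed

lemma w_nonzero_J:
  assumes "x \<in> ball x0 (infdist x0 K / 2)" "w j x \<noteq> 0"
  shows "j \<in> J (infdist x0 K)"
  using infdist_ball[OF assms(1)] w_nonzero[OF assms(2)] unfolding J_def c0_def
  by (auto simp: algebra_simps)

lemma G_local:
  assumes "x \<in> ball x0 (infdist x0 K / 2)"
  shows "G x = (\<Sum>j\<in>J (infdist x0 K). w j x * patch (eps j) x)"
  unfolding G_def
  by (rule sum.mono_neutral_left[OF J_bound(1)]) (use w_nonzero_J[OF assms] in auto)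

text \<open>The sum telescopes to the coarsest cutoff minus a very fine one. The bound 1/2 on the
  distance of \<open>x0\<close> puts \<open>x\<close> within \<open>eps 0 = 1\<close> of
  \<open>K\<close>, where the coarsest cutoff is 1; the fine one is 0.\<close>

lemma w_sum:
  assumes "x \<in> ball x0 (infdist x0 K / 2)" "infdist x0 K \<le> 1/2"
  shows "(\<Sum>j\<in>J (infdist x0 K). w j x) = 1"
proof -
  have dx: "infdist x K > 0"
    using infdist_ball(1)[OF assms(1)] infdist_nonneg[of x0 K] by linarith
  have tele: "(\<Sum>j<M. w j x) = cutoff (eps 0) x - cutoff (eps M) x" for M
    by (induction M) (auto simp: w_def)
  obtain M where M: "(1/2::real) ^ M < infdist x K / real (2 * rho + 1)"
    using real_arch_pow_inv[of "infdist x K / real (2 * rho + 1)" "1/2"] dx by auto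
  have big: "infdist x K > real (2 * rho + 1) * eps j" if "j \<ge> M" for j
  proof -
    have "eps j \<le> (1/2) ^ M" unfolding eps_def using that by (intro power_decreasing) auto
    then have "eps j < infdist x K / real (2 * rho + 1)" using M by linarith
    then show ?thesis by (simp add: field_simps)
  qed
  have "{j. w j x \<noteq> 0} \<subseteq> {..<M}"
    using big w_nonzero(2) by (metis (mono_tags, lifting) lessThan_iff mem_Collect_eq not_le subsetI)
  then have "(\<Sum>j\<in>{j. w j x \<noteq> 0}. w j x) = (\<Sum>j<M. w j x)"
    by (intro sum.mono_neutral_left) auto
  also have "\<dots> = 1"
    unfolding tele using cutoff_eq_0[of "eps M" x] big[of M] cutoff_eq_1[of 1 x]
      infdist_ball(2)[OF assms(1)] assms(2) by (simp add: eps_def)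
  finally have "(\<Sum>j\<in>{j. w j x \<noteq> 0}. w j x) = 1" .
  moreover have "(\<Sum>j\<in>{j. w j x \<noteq> 0}. w j x) = (\<Sum>j\<in>J (infdist x0 K). w j x)"
    by (rule sum.mono_neutral_left[OF J_bound(1)]) (use w_nonzero_J[OF assms(1)] in auto)
  ultimately show ?thesis by simp
qed

lemma infdist_pos: "x \<notin> K \<Longrightarrow> infdist x K > 0"
  using compact_K K_ne compact_imp_closed infdist_pos_not_in_closed by blast

lemma Ck_G: "Ck p (- K) G"
proof (rule Ck_local)
  fix x assume "x \<in> - K"
  then have d: "infdist x K > 0" using infdist_pos by simp
  let ?S = "ball x (infdist x K / 2)"
  have "Ck p ?S (\<lambda>x'. \<Sum>j\<in>J (infdist x K). w j x' * patch (eps j) x')"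
    by (rule Ck_subset[OF _ subset_UNIV]) (intro Ck_sum Ck_mult Ck_w Ck_patch open_UNIV eps_pos)
  then have "Ck p ?S G" by (rule Ck_cong[OF open_ball, rotated]) (simp add: G_local)
  then show "\<exists>V. open V \<and> x \<in> V \<and> Ck p V G" using d by (intro exI[of _ ?S]) auto
qed

section \<open>Derivative estimates near \<open>K\<close>\<close>

definition Cth :: real where "Cth = (2 ^ p * 2 ^ Suc p) ^ CARD('n)"

text \<open>Bounds the number of grid functions of spacing \<open>e\<close> active somewhere on a
  ball of radius \<open>d / 2\<close>, provided \<open>d \<le> c * e\<close>; see
  \<open>theta_active\<close>.\<close>

definition cnt :: "nat \<Rightarrow> nat" where "cnt c = (2 * (rho + c) + 1) ^ CARD('n)"

lemma theta_active:
  fixes e d :: real and x0 :: "real^'n"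
  assumes "e > 0" "d \<le> real c * e" "x \<in> ball x0 (d / 2)" "theta p e q x \<noteq> 0"
  shows "q \<in> {q. dist x0 (gp e q) \<le> real (rho + c) * e}"
proof -
  have "dist x (gp e q) \<le> real rho * e" by (rule theta_dist[OF assms(1,4)])
  moreover have "dist x0 (gp e q) \<le> dist x0 x + dist x (gp e q)" by (rule dist_triangle)
  moreover have "dist x0 x < d / 2" "0 \<le> dist x0 x" using assms(3) by auto
  ultimately have "dist x0 (gp e q) \<le> real c * e + real rho * e" using assms(2) by linarith
  then show ?thesis by (simp add: algebra_simps)
qed

lemma bd_cutoff:
  fixes e d :: real
  assumes "e > 0" "d > 0" "d \<le> real c * e" "c \<ge> 1"
  shows "bd p (ball x0 (d / 2)) d (real c ^ p * (cnt c * Cth)) (cutoff e)"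
proof -
  let ?S = "ball x0 (d / 2)"
  have "bd p ?S e (cnt c * Cth) (cutoff e)"
    unfolding cutoff_def[abs_def] cnt_def
  proof (rule bd_sum_sparse[OF open_ball assms(1) finite_grid[OF assms(1)]])
    show "finite {q. dist x0 (gp e q) \<le> real (rho + c) * e}"
      "card {q. dist x0 (gp e q) \<le> real (rho + c) * e} \<le> (2 * (rho + c) + 1) ^ CARD('n)"
      by (rule grid_count[OF assms(1)])+
    show "Ck p ?S (theta p e q) \<and> bd p ?S e Cth (theta p e q)" for q :: "'n \<Rightarrow> int"
      using Ck_subset[OF Ck_theta[OF assms(1)] subset_UNIV] bd_subset[OF bd_theta[OF assms(1)] subset_UNIV]
      unfolding Cth_def by blast
    show "theta p e q x = 0" if "x \<in> ?S" "q \<notin> {q. dist x0 (gp e q) \<le> real (rho + c) * e}" for q x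
      using theta_active[OF assms(1,3) that(1)] that(2) by blast
  qed (simp add: Cth_def)
  then show ?thesis by (rule bd_rescale[rotated 5]) (use assms in auto)
qed

text \<open>From \<open>x0\<close> to an active grid point there are at most \<open>rho + c0\<close>
  spacings, from there to its nearest point of \<open>K\<close> at most \<open>7 * rho + 3\<close>,
  and a spacing is at most \<open>3 * d\<close>. The additional 1 pays for one more distance
  \<open>d\<close> to \<open>x0\<close>.\<close>

definition c1 :: nat where "c1 = 3 * (8 * rho + 3 + c0) + 1"

definition CT :: real where "CT = (1 + CARD('n)) ^ p * (2 * real c1) ^ p"

text \<open>\<open>tay_compare\<close> with \<open>h = 2 * c1 * d\<close>, a length covering all
  distances involved; the powers of \<open>2 * c1\<close> go into \<open>CT\<close>.\<close>

lemma bd_T_diff: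
  fixes e d \<delta> :: real
  assumes "close e \<delta>" "e > 0" "a \<in> K" "a' \<in> K" "d > 0" "2 * real c1 * d < \<delta>" "dist x0 a \<le> d" "dist x0 a' \<le> (real c1 - 1) * d"
  shows "bd p (ball x0 (d / 2)) d (CT * e * d ^ p) (\<lambda>x. T a' (\<lambda>_. 0) x - T a (\<lambda>_. 0) x)"
proof -
  let ?S = "ball x0 (d / 2)"
  define h where "h = 2 * real c1 * d"
  have c1: "real c1 \<ge> 1" by (simp add: c1_def)
  have c1d: "d \<le> real c1 * d" using mult_right_mono[OF c1, of d] assms(5) by simp
  have aa: "dist a a' \<le> real c1 * d"
    using dist_triangle3[of a a' x0] assms(7,8) by (simp add: algebra_simps)
  have hh: "real c1 * d \<le> h" unfolding h_def using c1d assms(5) by linarith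
  have ad: "dist a a' < \<delta>" and ah: "dist a a' \<le> h" using aa hh assms(6) unfolding h_def by linarith+
  have "bd p ?S d (CT * e * d ^ p / d ^ mdeg (\<lambda>_::'n. 0)) ((\<lambda>\<beta> x. T a' \<beta> x - T a \<beta> x) (\<lambda>_. 0))"
  proof (rule bd_of_jetfam[where p = p])
    show "jetfam p ?S (\<lambda>\<beta> x. T a' \<beta> x - T a \<beta> x)" by (intro jetfam_diff jetfam_tay)
    fix \<beta> :: "'n \<Rightarrow> nat" and x assume \<beta>: "mdeg \<beta> \<le> p" and x: "x \<in> ?S"
    have "dist x a' \<le> dist x x0 + dist x0 a'" by (rule dist_triangle)
    also have "\<dots> \<le> d + (real c1 - 1) * d" using x assms(5,8) by (intro add_mono) (auto simp: dist_commute)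
    also have "\<dots> = real c1 * d" by (simp add: algebra_simps)
    finally have xa: "dist x a' \<le> h" using hh by linarith
    have "\<bar>T a' \<beta> x - T a \<beta> x\<bar> \<le> (1 + CARD('n)) ^ p * e * h ^ (p - mdeg \<beta>)"
      by (rule tay_compare[OF assms(1,2,3,4) ad ah xa \<beta>])
    also have "h ^ (p - mdeg \<beta>) \<le> (2 * real c1) ^ p * (d ^ p / d ^ mdeg \<beta>)"
    proof -
      have "h ^ (p - mdeg \<beta>) = (2 * real c1) ^ (p - mdeg \<beta>) * d ^ (p - mdeg \<beta>)"
        unfolding h_def by (simp add: power_mult_distrib)
      also have "d ^ (p - mdeg \<beta>) = d ^ p / d ^ mdeg \<beta>" using \<beta> assms(5) by (simp add: power_diff)
      also have "(2 * real c1) ^ (p - mdeg \<beta>) * (d ^ p / d ^ mdeg \<beta>) \<le> (2 * real c1) ^ p * (d ^ p / d ^ mdeg \<beta>)"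
        using c1 assms(5) by (intro mult_right_mono power_increasing) auto
      finally show ?thesis .
    qed
    finally have "\<bar>T a' \<beta> x - T a \<beta> x\<bar> \<le> real ((1 + CARD('n)) ^ p) * e * ((2 * real c1) ^ p * (d ^ p / d ^ mdeg \<beta>))"
      using assms(2) by (simp add: mult_left_mono)
    then show "\<bar>T a' \<beta> x - T a \<beta> x\<bar> \<le> CT * e * d ^ p / d ^ mdeg \<beta>" by (simp add: CT_def mult_ac)
  qed (use assms(5) in auto)
  then show ?thesis by simp
qed

text \<open>From left to right: number of scales, product factor and bound for \<open>w j\<close>,
  number of active grid points, product factor and bound for \<open>theta\<close>, and the bound for
  differences of Taylor polynomials.\<close>

definition CG :: real where
  "CG = real (3 * c0) * (2 ^ p * (2 * (real (2 * c0) ^ p * (cnt (2 * c0) * Cth))) *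
     (cnt c0 * (2 ^ p * (real c0 ^ p * Cth) * CT)))"

text \<open>Since the weights \<open>w j\<close> and the \<open>theta\<close> at each scale sum to
  1, \<open>G\<close> minus the Taylor polynomial at the nearest point is a weighted sum of
  differences of Taylor polynomials. These are \<open>e * d^p\<close> in size, while each derivative
  costs \<open>1 / d\<close>; so order \<open>j\<close> is controlled by
  \<open>e * d^(p - j)\<close>.\<close>

lemma bd_G:
  fixes e \<delta> :: real
  assumes "close e \<delta>" "e > 0" "x0 \<notin> K" "infdist x0 K \<le> 1/2" "2 * real c1 * infdist x0 K < \<delta>"
  shows "bd p (ball x0 (infdist x0 K / 2)) (infdist x0 K) (CG * e * infdist x0 K ^ p)
     (\<lambda>x. G x - T (near x0) (\<lambda>_. 0) x)"
proof -
  define d where "d = infdist x0 K"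
  define a where "a = near x0"
  let ?S = "ball x0 (d / 2)"
  let ?Q = "\<lambda>j. grid (7 * rho + 3) (eps j)"
  let ?t = "\<lambda>j q x. theta p (eps j) q x * (T (near (gp (eps j) q)) (\<lambda>_. 0) x - T a (\<lambda>_. 0) x)"
  have d: "d > 0" using infdist_pos assms by (simp add: d_def)
  have Sne: "?S \<noteq> {}" using d by auto
  have a: "a \<in> K" "dist x0 a = d" using near by (auto simp: a_def d_def)
  have c0: "c0 \<ge> 1" "real c0 \<ge> 1" by (auto simp: c0_def)
  have CT0: "CT \<ge> 0" "Cth \<ge> 0" by (auto simp: CT_def Cth_def)
  have CkS: "Ck p UNIV F \<Longrightarrow> Ck p ?S F" for F by (rule Ck_subset) auto
  have eq: "G x - T a (\<lambda>_. 0) x = (\<Sum>j\<in>J d. w j x * (\<Sum>q\<in>?Q j. ?t j q x))" if x: "x \<in> ?S" for x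
  proof -
    have xx: "x \<in> ball x0 (infdist x0 K / 2)" using x by (simp add: d_def)
    have "(\<Sum>q\<in>?Q j. ?t j q x) = patch (eps j) x - T a (\<lambda>_. 0) x" if "j \<in> J d" for j
    proof -
      have "infdist x K \<le> real (6 * rho + 3) * eps j"
        using infdist_ball(2)[OF xx] that by (auto simp: J_def c0_def d_def algebra_simps)
      then have "(\<Sum>q\<in>?Q j. theta p (eps j) q x) = 1"
        using theta_grid_sum[of "eps j" x "6 * rho + 3"] by (simp add: algebra_simps)
      then show ?thesis unfolding patch_def
        by (simp add: right_diff_distrib sum_subtractf sum_distrib_right[symmetric])
    qed
    then have "(\<Sum>j\<in>J d. w j x * (\<Sum>q\<in>?Q j. ?t j q x)) =
        (\<Sum>j\<in>J d. w j x * patch (eps j) x) - (\<Sum>j\<in>J d. w j x) * T a (\<lambda>_. 0) x"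
      by (simp add: right_diff_distrib sum_subtractf sum_distrib_right)
    also have "\<dots> = G x - T a (\<lambda>_. 0) x"
      using G_local[OF xx] w_sum[OF xx assms(4)] by (simp add: d_def)
    finally show ?thesis by simp
  qed
  have Ckt: "Ck p UNIV (?t j q)" for j q by (intro Ck_mult Ck_theta Ck_diff Ck_T open_UNIV eps_pos)
  have "bd p ?S d (real (3 * c0) * (2 ^ p * (2 * (real (2 * c0) ^ p * (cnt (2 * c0) * Cth))) *
     (cnt c0 * (2 ^ p * (real c0 ^ p * Cth) * (CT * e * d ^ p)))))
     (\<lambda>x. \<Sum>j\<in>J d. w j x * (\<Sum>q\<in>?Q j. ?t j q x))"
  proof (rule bd_sum_sparse[OF open_ball d J_bound(1)])
    show "finite (J d)" "card (J d) \<le> 3 * c0" by (rule J_bound)+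
    fix j assume j: "j \<in> J d"
    have e: "d \<le> real c0 * eps j" "eps j \<le> 3 * d" using j by (auto simp: J_def)
    \<comment> \<open>The constant is \<open>2 * c0\<close> because the finer cutoff in
      \<open>w j\<close> has only half the spacing.\<close>
    have "bd p ?S d (real (2 * c0) ^ p * (cnt (2 * c0) * Cth) + real (2 * c0) ^ p * (cnt (2 * c0) * Cth)) (w j)"
      unfolding w_def[abs_def]
    proof (intro bd_diff bd_cutoff CkS Ck_cutoff open_ball eps_pos d)
      show "d \<le> real (2 * c0) * eps j"
        by (rule order_trans[OF e(1)], rule mult_right_mono) (auto intro: less_imp_le)
      show "d \<le> real (2 * c0) * eps (Suc j)" using e(1) by (simp add: eps_def)
    qed (use c0 in auto)
    then have bw: "bd p ?S d (2 * (real (2 * c0) ^ p * (cnt (2 * c0) * Cth))) (w j)" by (simp only: mult_2)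
    have bt: "bd p ?S d (cnt c0 * (2 ^ p * (real c0 ^ p * Cth) * (CT * e * d ^ p))) (\<lambda>x. \<Sum>q\<in>?Q j. ?t j q x)"
      unfolding cnt_def
    proof (rule bd_sum_sparse[OF open_ball d finite_grid[OF eps_pos]])
      show "finite {q. dist x0 (gp (eps j) q) \<le> real (rho + c0) * eps j}"
        "card {q. dist x0 (gp (eps j) q) \<le> real (rho + c0) * eps j} \<le> (2 * (rho + c0) + 1) ^ CARD('n)"
        by (rule grid_count[OF eps_pos])+
      show "?t j q x = 0" if "q \<notin> {q. dist x0 (gp (eps j) q) \<le> real (rho + c0) * eps j}" "x \<in> ?S" for q x
        using theta_active[OF eps_pos e(1) that(2)] that(1) by auto
      fix q assume q: "q \<in> ?Q j" "q \<in> {q. dist x0 (gp (eps j) q) \<le> real (rho + c0) * eps j}"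
      have "dist x0 (near (gp (eps j) q)) \<le> dist x0 (gp (eps j) q) + dist (gp (eps j) q) (near (gp (eps j) q))"
        by (rule dist_triangle)
      also have "\<dots> \<le> real (rho + c0) * eps j + real (7 * rho + 3) * eps j"
        using q near(2) by (intro add_mono) (auto simp: grid_def)
      also have "\<dots> = real (8 * rho + 3 + c0) * eps j" by (simp add: algebra_simps)
      also have "\<dots> \<le> real (8 * rho + 3 + c0) * (3 * d)" using e(2) by (intro mult_left_mono) auto
      also have "\<dots> = (real c1 - 1) * d" by (simp add: c1_def)
      finally have "bd p ?S d (CT * e * d ^ p) (\<lambda>x. T (near (gp (eps j) q)) (\<lambda>_. 0) x - T a (\<lambda>_. 0) x)"
        using a assms d near(1) by (intro bd_T_diff[where \<delta> = \<delta>]) (auto simp: d_def)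
      moreover have "bd p ?S d (real c0 ^ p * Cth) (theta p (eps j) q)"
        by (rule bd_rescale[where h = "eps j"])
          (use c0 e d Sne bd_subset[OF bd_theta[OF eps_pos] subset_UNIV] in \<open>auto simp: Cth_def\<close>)
      ultimately have "bd p ?S d (2 ^ p * (real c0 ^ p * Cth) * (CT * e * d ^ p)) (?t j q)"
        by (intro bd_mult open_ball CkS Ck_theta Ck_diff Ck_T open_UNIV eps_pos Sne)
      then show "Ck p ?S (?t j q) \<and> bd p ?S d (2 ^ p * (real c0 ^ p * Cth) * (CT * e * d ^ p)) (?t j q)"
        using CkS[OF Ckt] by blast
    qed (use CT0 assms(2) d in auto)
    have Cks: "Ck p UNIV (\<lambda>x. \<Sum>q\<in>?Q j. ?t j q x)" by (intro Ck_sum Ckt open_UNIV)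
    show "Ck p ?S (\<lambda>x. w j x * (\<Sum>q\<in>?Q j. ?t j q x)) \<and>
      bd p ?S d (2 ^ p * (2 * (real (2 * c0) ^ p * (cnt (2 * c0) * Cth))) *
        (cnt c0 * (2 ^ p * (real c0 ^ p * Cth) * (CT * e * d ^ p)))) (\<lambda>x. w j x * (\<Sum>q\<in>?Q j. ?t j q x))"
      by (intro conjI CkS Ck_mult Ck_w Cks open_UNIV bd_mult open_ball bw bt Sne)
  qed (use CT0 assms(2) d in auto)
  then have "bd p ?S d (CG * e * d ^ p) (\<lambda>x. \<Sum>j\<in>J d. w j x * (\<Sum>q\<in>?Q j. ?t j q x))"
    by (rule back_subst[of "\<lambda>c. bd p ?S d c _"]) (simp add: CG_def mult_ac)
  then have "bd p ?S d (CG * e * d ^ p) (\<lambda>x. G x - T a (\<lambda>_. 0) x)"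
    by (rule bd_cong[OF open_ball, rotated]) (rule eq[symmetric])
  then show ?thesis by (simp add: d_def a_def)
qed


section \<open>Gluing the jet on \<open>K\<close> with the extension\<close>

lemma CG_nonneg: "CG \<ge> 0"
  by (simp add: CG_def CT_def Cth_def)

text \<open>For \<open>y\<close> off \<open>K\<close> the nearest point \<open>b\<close> is
  inserted: \<open>D \<beta> y\<close> is close to the Taylor polynomial at \<open>b\<close> by
  \<open>bd_G\<close>, and that polynomial is close to the one at \<open>a\<close> by
  \<open>tay_compare\<close>. Both \<open>dist y b\<close> and \<open>dist a b\<close> are at most
  \<open>2 * dist a y\<close>.\<close>

lemma extension_close:
  fixes D :: "('n \<Rightarrow> nat) \<Rightarrow> real^'n \<Rightarrow> real" and e :: real
  assumes "jetfam p (- K) D" "\<And>x. x \<in> - K \<Longrightarrow> D (\<lambda>_. 0) x = G x" "e > 0"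
  shows "\<exists>\<delta>>0. \<forall>a\<in>K. \<forall>y. dist a y < \<delta> \<longrightarrow> (\<forall>\<beta>. mdeg \<beta> \<le> p \<longrightarrow>
     \<bar>(if y \<in> K then g \<beta> y else D \<beta> y) - T a \<beta> y\<bar> \<le> e * dist a y ^ (p - mdeg \<beta>))"
proof -
  define N where "N = real ((1 + CARD('n)) ^ p) * 2 ^ p"
  define e' where "e' = e / (1 + CG + N)"
  have N: "N \<ge> 0" by (simp add: N_def)
  have e': "e' > 0" using assms(3) CG_nonneg N by (simp add: e'_def)
  obtain \<delta> where \<delta>: "\<delta> > 0" "close e' \<delta>" using whitney[OF e'] unfolding close_def by blast
  \<comment> \<open>The 1/2 is the range of \<open>bd_G\<close>; the other term keeps both
    \<open>2 * c1 * t\<close> and \<open>2 * t\<close> below \<open>\<delta>\<close> for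
    \<open>t < r\<close>.\<close>
  define r where "r = min (1/2) (\<delta> / (2 * real c1 + 2))"
  have r: "r > 0" using \<delta>(1) by (simp add: r_def)
  have r2: "2 * real c1 * t < \<delta>" "2 * t < \<delta>" if "t < r" "0 \<le> t" for t
  proof -
    have "t < \<delta> / (2 * real c1 + 2)" using that by (simp add: r_def)
    then have "t * (2 * real c1 + 2) < \<delta>" by (simp add: pos_less_divide_eq)
    then have "2 * real c1 * t + 2 * t < \<delta>" by (simp add: algebra_simps)
    moreover have "0 \<le> 2 * real c1 * t" using that by simp
    ultimately show "2 * real c1 * t < \<delta>" "2 * t < \<delta>" using that by linarith+
  qed
  show ?thesis
  proof (intro exI[of _ r] conjI r ballI allI impI)
    fix a y :: "real^'n" and \<beta> :: "'n \<Rightarrow> nat" assume a: "a \<in> K" and ay: "dist a y < r" and \<beta>: "mdeg \<beta> \<le> p"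
    define s where "s = dist a y ^ (p - mdeg \<beta>)"
    have s: "s \<ge> 0" by (simp add: s_def)
    show "\<bar>(if y \<in> K then g \<beta> y else D \<beta> y) - T a \<beta> y\<bar> \<le> e * dist a y ^ (p - mdeg \<beta>)"
    proof (cases "y \<in> K")
      case True
      have "dist a y < \<delta>" using r2(2)[OF ay] zero_le_dist[of a y] by linarith
      then have "\<bar>g \<beta> y - T a \<beta> y\<bar> \<le> e' * s" using \<delta>(2) a True \<beta> unfolding close_def s_def by blast
      also have "\<dots> \<le> e * s"
        using assms(3) CG_nonneg N s by (intro mult_right_mono) (auto simp: e'_def divide_le_eq)
      finally show ?thesis using True by (simp add: s_def)
    next
      case False
      define d where "d = infdist y K"
      define b where "b = near y"
      have b: "b \<in> K" "dist y b = d" using near by (auto simp: b_def d_def)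
      have d: "d > 0" using infdist_pos[OF False] by (simp add: d_def)
      have da: "d \<le> dist a y" using infdist_le[OF a, of y] by (simp add: d_def dist_commute)
      let ?S = "ball y (d / 2)"
      have SK: "?S \<subseteq> - K"
      proof
        fix x assume "x \<in> ?S"
        then have "infdist x K > 0" using infdist_ball(1)[of x y] d by (simp add: d_def)
        then show "x \<in> - K" by auto
      qed
      have "bd p ?S d (CG * e' * d ^ p) (\<lambda>x. G x - T b (\<lambda>_. 0) x)"
        unfolding d_def b_def
        by (rule bd_G[OF \<delta>(2) e' False]) (use da ay r2(1)[of d] d in \<open>auto simp: r_def d_def\<close>)
      then have "bd p ?S d (CG * e' * d ^ p) ((\<lambda>\<beta> x. D \<beta> x - T b \<beta> x) (\<lambda>_. 0))"
        by (rule bd_cong[OF open_ball, rotated]) (use SK assms(2) in auto)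
      moreover have "jetfam p ?S (\<lambda>\<beta> x. D \<beta> x - T b \<beta> x)"
        by (intro jetfam_diff jetfam_tay jetfam_subset[OF assms(1) SK])
      ultimately have "bd (p - mdeg \<beta>) ?S d (CG * e' * d ^ p / d ^ mdeg \<beta>) (\<lambda>x. D \<beta> x - T b \<beta> x)"
        using jetfam_of_bd[OF open_ball, where D = "\<lambda>\<beta> x. D \<beta> x - T b \<beta> x"] \<beta> by blast
      then have "\<bar>D \<beta> y - T b \<beta> y\<bar> \<le> CG * e' * d ^ p / d ^ mdeg \<beta>"
        by (rule bd_imp_abs_le) (use d in simp)
      also have "\<dots> = CG * e' * d ^ (p - mdeg \<beta>)" using \<beta> d by (simp add: power_diff)
      also have "\<dots> \<le> CG * e' * s"
        unfolding s_def using da d CG_nonneg e' by (intro mult_left_mono power_mono) auto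
      finally have 1: "\<bar>D \<beta> y - T b \<beta> y\<bar> \<le> CG * e' * s" .
      have ab: "dist a b \<le> 2 * dist a y" using dist_triangle[of a b y] b(2) da by linarith
      have "\<bar>T b \<beta> y - T a \<beta> y\<bar> \<le> (1 + CARD('n)) ^ p * e' * (2 * dist a y) ^ (p - mdeg \<beta>)"
      proof (rule tay_compare[OF \<delta>(2) e' a b(1) _ ab _ \<beta>])
        show "dist a b < \<delta>" using ab r2(2)[OF ay] by simp
        show "dist y b \<le> 2 * dist a y" using b(2) da zero_le_dist[of a y] by linarith
      qed
      also have "\<dots> \<le> (1 + CARD('n)) ^ p * e' * (2 ^ p * s)"
      proof (intro mult_left_mono)
        have "(2::real) ^ (p - mdeg \<beta>) \<le> 2 ^ p" by (rule power_increasing) auto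
        then show "(2 * dist a y) ^ (p - mdeg \<beta>) \<le> 2 ^ p * s"
          unfolding power_mult_distrib s_def by (intro mult_right_mono) auto
      qed (use e' in auto)
      also have "\<dots> = N * e' * s" by (simp add: N_def)
      finally have 2: "\<bar>T b \<beta> y - T a \<beta> y\<bar> \<le> N * e' * s" .
      have "\<bar>D \<beta> y - T a \<beta> y\<bar> \<le> (CG + N) * e' * s" using 1 2 by (simp add: algebra_simps)
      also have "\<dots> \<le> e * s"
        using assms(3) CG_nonneg N s by (intro mult_right_mono) (auto simp: e'_def divide_le_eq)
      finally show ?thesis using False by (simp add: s_def)
    qed
  qed
qed

text \<open>At a point \<open>x\<close> of \<open>K\<close> the glued family is compared with the
  Taylor polynomial there. \<open>extension_close\<close> covers approach through \<open>K\<close>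
  and through its complement alike, so the remainder estimate yields continuity and the partial
  derivatives.\<close>

theorem whitney_extension: "\<exists>F. Cp_on p UNIV F \<and> (\<forall>x\<in>K. F x = g (\<lambda>_. 0) x)"
proof -
  have oK: "open (- K)" using compact_K compact_imp_closed by blast
  obtain D where D: "\<And>x. x \<in> - K \<Longrightarrow> D (\<lambda>_. 0) x = G x" "jetfam p (- K) D"
    using Ck_G Cp_on_iff_Ck[OF oK] unfolding Cp_on_iff_jetfam by blast
  define H where "H \<beta> y = (if y \<in> K then g \<beta> y else D \<beta> y)" for \<beta> y
  have HT: "\<exists>\<delta>>0. \<forall>y. dist a y < \<delta> \<longrightarrow> \<bar>H \<beta> y - T a \<beta> y\<bar> \<le> e * dist a y ^ (p - mdeg \<beta>)"
    if "e > 0" "a \<in> K" "mdeg \<beta> \<le> p" for e a \<beta>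
    using extension_close[OF D(2,1) that(1)] that unfolding H_def by meson
  have HD: "H \<beta> y = D \<beta> y" if "y \<in> - K" for \<beta> y using that by (simp add: H_def)
  have HK: "H \<beta> a = T a \<beta> a" if "a \<in> K" for \<beta> a using that by (simp add: H_def)
  have "jetfam p UNIV H"
    unfolding jetfam_def
  proof (intro conjI allI impI ballI)
    fix \<beta> :: "'n \<Rightarrow> nat" assume \<beta>: "mdeg \<beta> \<le> p"
    have "isCont (H \<beta>) x" for x
    proof (cases "x \<in> K")
      case False
      have "continuous_on (- K) (H \<beta>)"
        using jetfam_continuous_on[OF D(2) \<beta>] continuous_on_cong[of "- K" "- K" "H \<beta>" "D \<beta>"] HD by auto
      then show ?thesis using oK False by (simp add: continuous_on_eq_continuous_at)
    next
      case True
      have "((\<lambda>y. H \<beta> y - T x \<beta> y) \<longlongrightarrow> 0) (at x)"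
      proof (rule tendstoI)
        fix e :: real assume e: "e > 0"
        obtain \<delta> where \<delta>: "\<delta> > 0" "\<And>y. dist x y < \<delta> \<Longrightarrow> \<bar>H \<beta> y - T x \<beta> y\<bar> \<le> e / 2 * dist x y ^ (p - mdeg \<beta>)"
          using HT[of "e / 2" x \<beta>] True \<beta> e by auto
        have "dist (H \<beta> y - T x \<beta> y) 0 < e" if "dist y x < min \<delta> 1" for y
        proof -
          have "\<bar>H \<beta> y - T x \<beta> y\<bar> \<le> e / 2 * dist x y ^ (p - mdeg \<beta>)"
            using \<delta>(2)[of y] that by (simp add: dist_commute)
          also have "\<dots> \<le> e / 2 * 1"
            using that e by (intro mult_left_mono power_le_one) (auto simp: dist_commute)
          finally show ?thesis using e by (simp add: dist_norm)
        qed
        then show "\<forall>\<^sub>F y in at x. dist (H \<beta> y - T x \<beta> y) 0 < e"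
          unfolding eventually_at using \<delta>(1) by (intro exI[of _ "min \<delta> 1"]) auto
      qed
      moreover have "(T x \<beta> \<longlongrightarrow> T x \<beta> x) (at x)"
        using jetfam_continuous_on[OF jetfam_tay \<beta>, of UNIV]
        by (simp add: continuous_on_eq_continuous_at isCont_def del: tay_base)
      ultimately have "((\<lambda>y. (H \<beta> y - T x \<beta> y) + T x \<beta> y) \<longlongrightarrow> 0 + T x \<beta> x) (at x)"
        by (rule tendsto_add)
      then show ?thesis using HK[OF True] by (simp add: isCont_def)
    qed
    then show "continuous_on UNIV (H \<beta>)" by (simp add: continuous_at_imp_continuous_on)
  next
    fix \<beta> :: "'n \<Rightarrow> nat" and i x assume \<beta>: "mdeg \<beta> < p"
    show "has_partial i (H \<beta>) (H (inc i \<beta>) x) x"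
    proof (cases "x \<in> K")
      case False
      then have "has_partial i (D \<beta>) (H (inc i \<beta>) x) x"
        using jetfam_has_partial[OF D(2) \<beta>, of x i] HD by simp
      then show ?thesis by (rule has_partial_cong[OF oK, rotated 2]) (use False HD in auto)
    next
      case True
      \<comment> \<open>As \<open>mdeg \<beta> < p\<close>, the remainder is at most
        \<open>e / 2 * \<bar>h\<bar>\<close> for small \<open>h\<close>. The derivative itself is
        supplied by the Taylor polynomial.\<close>
      have "has_partial i (\<lambda>y. H \<beta> y - T x \<beta> y) 0 x"
        unfolding has_partial_def DERIV_def
      proof (rule tendstoI)
        fix e :: real assume e: "e > 0"
        obtain \<delta> where \<delta>: "\<delta> > 0" "\<And>y. dist x y < \<delta> \<Longrightarrow> \<bar>H \<beta> y - T x \<beta> y\<bar> \<le> e / 2 * dist x y ^ (p - mdeg \<beta>)"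
          using HT[of "e / 2" x \<beta>] True \<beta> e by auto
        have "dist ((H \<beta> (x + (0 + h) *\<^sub>R axis i 1) - T x \<beta> (x + (0 + h) *\<^sub>R axis i 1) -
              (H \<beta> (x + 0 *\<^sub>R axis i 1) - T x \<beta> (x + 0 *\<^sub>R axis i 1))) / h) 0 < e"
          if h: "h \<noteq> 0" "dist h 0 < min \<delta> 1" for h
        proof -
          define y where "y = x + h *\<^sub>R axis i 1"
          have xy: "dist x y = \<bar>h\<bar>" by (simp add: y_def dist_norm)
          have "\<bar>H \<beta> y - T x \<beta> y\<bar> \<le> e / 2 * \<bar>h\<bar> ^ (p - mdeg \<beta>)"
            using \<delta>(2)[of y] h xy by simp
          also have "\<dots> \<le> e / 2 * \<bar>h\<bar> ^ 1"
            using h e \<beta> by (intro mult_left_mono power_decreasing) auto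
          also have "\<dots> < e * \<bar>h\<bar>" using h e by simp
          finally have "\<bar>H \<beta> y - T x \<beta> y\<bar> / \<bar>h\<bar> < e" using h by (simp add: divide_simps)
          then show ?thesis using HK[OF True] by (simp add: y_def dist_norm)
        qed
        then show "\<forall>\<^sub>F h in at 0. dist ((H \<beta> (x + (0 + h) *\<^sub>R axis i 1) - T x \<beta> (x + (0 + h) *\<^sub>R axis i 1) -
              (H \<beta> (x + 0 *\<^sub>R axis i 1) - T x \<beta> (x + 0 *\<^sub>R axis i 1))) / h) 0 < e"
          unfolding eventually_at using \<delta>(1) by (intro exI[of _ "min \<delta> 1"]) auto
      qed
      from has_partial_add[OF this has_partial_tay[OF \<beta>, of i "\<lambda>\<gamma>. g \<gamma> x" x x]]
      have "has_partial i (H \<beta>) (0 + T x (inc i \<beta>) x) x" by simp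
      then show ?thesis using HK[OF True] by simp
    qed
  qed
  moreover have "\<forall>x\<in>K. H (\<lambda>_. 0) x = g (\<lambda>_. 0) x" by (simp add: H_def)
  ultimately show ?thesis unfolding Cp_on_iff_jetfam by blast
qed

end

subsection \<open>Patching local extensions\<close>

lemma finite_gp_cball:
  assumes "e > 0"
  shows "finite {q. dist (x::real^'n::finite) (gp e q) \<le> R}"
proof -
  obtain C :: nat where "R / e \<le> real C" using real_arch_simple by blast
  then have "R \<le> real C * e" using assms by (simp add: field_simps)
  then have "{q. dist x (gp e q) \<le> R} \<subseteq> {q. dist x (gp e q) \<le> real C * e}" by auto
  then show ?thesis using grid_count(1)[OF assms] finite_subset by blast
qed

text \<open>The open sets \<open>U\<close> and \<open>- B\<close> cover the space, and on the second
  the product is zero whatever \<open>F\<close> is outside \<open>U\<close>.\<close>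

lemma Ck_mult_supported:
  assumes "Ck p UNIV \<theta>" "open U" "Ck p U F" "closed B" "B \<subseteq> U" "\<And>x. \<theta> x \<noteq> 0 \<Longrightarrow> x \<in> B"
  shows "Ck p UNIV (\<lambda>x. \<theta> x * F x)"
proof (rule Ck_local)
  fix x
  show "\<exists>V. open V \<and> x \<in> V \<and> Ck p V (\<lambda>x. \<theta> x * F x)"
  proof (cases "x \<in> U")
    case True
    have "Ck p U (\<lambda>x. \<theta> x * F x)"
      by (intro Ck_mult assms(2,3) Ck_subset[OF assms(1)]) auto
    then show ?thesis using True assms(2) by blast
  next
    case False
    have "Ck p (- B) (\<lambda>x. \<theta> x * F x)"
      by (rule Ck_cong[OF _ _ Ck_const[of p "- B" 0]]) (use assms(4,6) in auto)
    then show ?thesis using False assms(4,5) by blast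
  qed
qed

text \<open>A Lebesgue number \<open>e0\<close> of the cover lets a single grid serve: the support
  of each \<open>theta\<close> that is active on \<open>C\<close> fits into one set of the
  cover.\<close>

lemma local_extension_compact:
  fixes f :: "real^'n::finite \<Rightarrow> real"
  assumes loc: "\<And>z. \<exists>U F. open U \<and> z \<in> U \<and> Ck p U F \<and> (\<forall>x\<in>X \<inter> U. F x = f x)" and "compact C"
  shows "\<exists>F. Ck p UNIV F \<and> (\<forall>x\<in>X \<inter> C. F x = f x)"
proof -
  obtain U F where U: "\<And>z. open (U z)" "\<And>z. z \<in> U z" "\<And>z. Ck p (U z) (F z)" "\<And>z x. x \<in> X \<Longrightarrow> x \<in> U z \<Longrightarrow> F z x = f x"
    using loc by (metis IntI)
  have "C \<subseteq> \<Union> (range U)" using U(2) by blast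
  then obtain e0 where e0: "e0 > 0" "\<And>x. x \<in> C \<Longrightarrow> \<exists>V\<in>range U. ball x e0 \<subseteq> V"
    using Heine_Borel_lemma[OF assms(2)] U(1) by (metis (no_types, lifting) rangeE)
  define r where "r = real (CARD('n) * (1 + p))"
  \<comment> \<open>Gives \<open>2 * (r * e) < e0\<close>, so a support ball of radius
    \<open>r * e\<close> containing a point \<open>x\<close> of \<open>C\<close> lies in
    \<open>ball x e0\<close>.\<close>
  define e where "e = e0 / (2 * r + 1)"
  have r: "r \<ge> 0" by (simp add: r_def)
  have e: "e > 0" using e0 r by (simp add: e_def)
  have re: "2 * (r * e) < e0"
  proof -
    have "e0 = (2 * r + 1) * e" using r by (simp add: e_def)
    then show ?thesis using e by (simp add: algebra_simps)
  qed
  define Q where "Q = {q. \<exists>x\<in>C. theta p e q x \<noteq> 0}"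
  obtain R where R: "\<And>x. x \<in> C \<Longrightarrow> norm x \<le> R"
    using assms(2) compact_imp_bounded bounded_iff by metis
  have td: "dist x (gp e q) \<le> r * e" if "theta p e q x \<noteq> 0" for q :: "'n \<Rightarrow> int" and x
    using theta_nonzero[OF e that] by (simp add: r_def)
  have "Q \<subseteq> {q. dist 0 (gp e q) \<le> R + r * e}"
  proof
    fix q assume "q \<in> Q"
    then obtain x where x: "x \<in> C" "theta p e q x \<noteq> 0" by (auto simp: Q_def)
    then show "q \<in> {q. dist 0 (gp e q) \<le> R + r * e}"
      using R[OF x(1)] td[OF x(2)] dist_triangle[of 0 "gp e q" x] by simp
  qed
  then have finQ: "finite Q" using finite_gp_cball[OF e] finite_subset by blast
  have "\<exists>z. cball (gp e q) (r * e) \<subseteq> U z" if qQ: "q \<in> Q" for q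
  proof -
    obtain x where x: "x \<in> C" "theta p e q x \<noteq> 0" using qQ by (auto simp: Q_def)
    obtain z where z: "ball x e0 \<subseteq> U z" using e0(2)[OF x(1)] by blast
    have "cball (gp e q) (r * e) \<subseteq> ball x e0"
    proof
      fix y assume "y \<in> cball (gp e q) (r * e)"
      then have "dist x y < e0"
        using td[OF x(2)] dist_triangle[of x y "gp e q"] re by simp
      then show "y \<in> ball x e0" by simp
    qed
    then show ?thesis using z by blast
  qed
  then obtain z where z: "\<And>q. q \<in> Q \<Longrightarrow> cball (gp e q) (r * e) \<subseteq> U (z q)" by metis
  let ?F = "\<lambda>x. \<Sum>q\<in>Q. theta p e q x * F (z q) x"
  have "Ck p UNIV ?F"
  proof (rule Ck_sum[OF open_UNIV])
    fix q assume "q \<in> Q"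
    then show "Ck p UNIV (\<lambda>x. theta p e q x * F (z q) x)"
      using td by (intro Ck_mult_supported[OF Ck_theta[OF e] U(1) U(3) closed_cball z])
        (auto simp: dist_commute)
  qed
  moreover have "?F x = f x" if x: "x \<in> X" "x \<in> C" for x
  proof -
    have "?F x = (\<Sum>q\<in>Q. theta p e q x * f x)"
    proof (rule sum.cong[OF refl])
      fix q assume "q \<in> Q"
      show "theta p e q x * F (z q) x = theta p e q x * f x"
      proof (cases "theta p e q x = 0")
        case False
        then have "x \<in> U (z q)" using td z[OF \<open>q \<in> Q\<close>] by (auto simp: dist_commute)
        then show ?thesis using U(4) x by simp
      qed simp
    qed
    also have "\<dots> = (\<Sum>q\<in>Q. theta p e q x) * f x" by (simp add: sum_distrib_right)
    also have "(\<Sum>q\<in>Q. theta p e q x) = 1"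
      by (rule theta_sum[OF e finQ]) (use x in \<open>auto simp: Q_def\<close>)
    finally show ?thesis by simp
  qed
  ultimately show ?thesis by blast
qed

text \<open>Lebesgue numbers are available only on compact sets. On the unit grid each support is a
  compact ball carrying its own extension, and these are glued by a locally finite sum.\<close>

lemma local_extension_global:
  fixes f :: "real^'n::finite \<Rightarrow> real"
  assumes "closed X"
    and loc: "\<And>z. z \<in> X \<Longrightarrow> \<exists>U F. open U \<and> z \<in> U \<and> Ck p U F \<and> (\<forall>x\<in>X \<inter> U. F x = f x)"
  shows "\<exists>F. Ck p UNIV F \<and> (\<forall>x\<in>X. F x = f x)"
proof -
  have loc': "\<exists>U F. open U \<and> z \<in> U \<and> Ck p U F \<and> (\<forall>x\<in>X \<inter> U. F x = f x)" for z
  proof (cases "z \<in> X")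
    case False
    then show ?thesis using assms(1) Ck_const[of p "- X" 0] by (intro exI[of _ "- X"]) auto
  qed (rule loc)
  define r where "r = real (CARD('n) * (1 + p))"
  have "\<exists>F. Ck p UNIV F \<and> (\<forall>x\<in>X \<inter> cball (gp 1 q) r. F x = f x)" for q :: "'n \<Rightarrow> int"
    by (rule local_extension_compact[OF loc' compact_cball])
  then obtain F where F: "\<And>q. Ck p UNIV (F q)" "\<And>q x. x \<in> X \<Longrightarrow> x \<in> cball (gp 1 q) r \<Longrightarrow> F q x = f x"
    by (metis IntI)
  have td: "dist x (gp 1 q) \<le> r" if "theta p 1 q x \<noteq> 0" for q :: "'n \<Rightarrow> int" and x
    using theta_nonzero[OF zero_less_one that] by (simp add: r_def)
  \<comment> \<open>Radius \<open>r + 1\<close> catches every \<open>q\<close> active anywhere on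
    the unit ball about \<open>x\<close>, so near \<open>x0\<close> the set \<open>A x0\<close> can
    replace \<open>A x\<close>.\<close>
  define A where "A x = {q. dist x (gp 1 q) \<le> r + 1}" for x :: "real^'n"
  have finA: "finite (A x)" for x unfolding A_def by (rule finite_gp_cball) simp
  have act: "q \<in> A x0" if "x \<in> ball x0 1" "theta p 1 q x \<noteq> 0" for q x x0
    using that(1) td[OF that(2)] dist_triangle[of x0 "gp 1 q" x] by (auto simp: A_def)
  define H where "H x = (\<Sum>q\<in>A x. theta p 1 q x * F q x)" for x
  have H: "H x = (\<Sum>q\<in>A x0. theta p 1 q x * F q x)" if "x \<in> ball x0 1" for x x0
  proof -
    have "H x = (\<Sum>q\<in>A x \<inter> A x0. theta p 1 q x * F q x)"
      unfolding H_def by (rule sum.mono_neutral_right) (use finA act[OF that] in auto)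
    also have "\<dots> = (\<Sum>q\<in>A x0. theta p 1 q x * F q x)"
      by (rule sum.mono_neutral_left) (use finA act[of x x] in auto)
    finally show ?thesis .
  qed
  have "Ck p UNIV H"
  proof (rule Ck_local)
    fix x0 :: "real^'n"
    have "Ck p UNIV (\<lambda>x. \<Sum>q\<in>A x0. theta p 1 q x * F q x)"
      by (intro Ck_sum Ck_mult Ck_theta F open_UNIV) simp
    then have "Ck p (ball x0 1) (\<lambda>x. \<Sum>q\<in>A x0. theta p 1 q x * F q x)" by (rule Ck_subset) simp
    then have "Ck p (ball x0 1) H" by (rule Ck_cong[OF open_ball, rotated]) (simp add: H)
    then show "\<exists>V. open V \<and> x0 \<in> V \<and> Ck p V H" by (intro exI[of _ "ball x0 1"]) auto
  qed
  moreover have "H x = f x" if x: "x \<in> X" for x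
  proof -
    have "H x = (\<Sum>q\<in>A x. theta p 1 q x * f x)"
      unfolding H_def
    proof (rule sum.cong[OF refl])
      fix q
      show "theta p 1 q x * F q x = theta p 1 q x * f x"
        using td[of q x] F(2)[OF x, of q] by (cases "theta p 1 q x = 0") (auto simp: dist_commute)
    qed
    also have "\<dots> = (\<Sum>q\<in>A x. theta p 1 q x) * f x" by (simp add: sum_distrib_right)
    also have "(\<Sum>q\<in>A x. theta p 1 q x) = 1"
      by (rule theta_sum[OF zero_less_one finA]) (use act[of x x] in auto)
    finally show ?thesis by simp
  qed
  ultimately show ?thesis by blast
qed

subsection \<open>Functionals on polynomials\<close>

lemma tendsto_fun_iff:
  fixes f :: "'k \<Rightarrow> 'i \<Rightarrow> 'a::topological_space"
  shows "(f \<longlongrightarrow> l) F \<longleftrightarrow> (\<forall>i. ((\<lambda>k. f k i) \<longlongrightarrow> l i) F)"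
  using limitin_componentwise[of "\<lambda>_. euclidean" UNIV f l F]
  by (simp add: euclidean_product_topology)

section \<open>Recentring the polynomials (x - b)^\<alpha> / \<alpha>!\<close>

lemma binomial_divided:
  fixes x y :: real
  shows "(\<Sum>s\<le>M. x ^ (M - s) / fact (M - s) * (y ^ s / fact s)) = (x + y) ^ M / fact M"
proof -
  have "(x + y) ^ M / fact M = (\<Sum>s\<le>M. of_nat (M choose s) * y ^ s * x ^ (M - s)) / fact M"
    unfolding add.commute[of x y] binomial_ring ..
  also have "\<dots> = (\<Sum>s\<le>M. x ^ (M - s) / fact (M - s) * (y ^ s / fact s))"
    unfolding sum_divide_distrib
    by (rule sum.cong) (auto simp: binomial_fact mult_ac)
  finally show ?thesis by simp
qed

text \<open>Coefficient of \<open>x^k\<close> in the univariate polynomial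
  \<open>(x - b)^m / m!\<close>; \<open>shifted_mono\<close> is its product over the
  coordinates.\<close>

definition shc :: "real \<Rightarrow> nat \<Rightarrow> nat \<Rightarrow> real" where
  "shc b m k = (if k \<le> m then (-b) ^ (m - k) / (fact (m - k) * fact k) else 0)"

lemma shifted_mono_eq_prod: "shifted_mono b \<alpha> \<beta> = (\<Prod>i\<in>UNIV. shc (b$i) (\<alpha> i) (\<beta> i))"
proof (cases "\<forall>i. \<beta> i \<le> \<alpha> i")
  case True
  have "shifted_mono b \<alpha> \<beta> = (\<Prod>i\<in>UNIV. real (\<alpha> i choose \<beta> i) * (- (b$i)) ^ (\<alpha> i - \<beta> i) / fact (\<alpha> i))"
    using True by (simp add: shifted_mono_def mfact_def prod_dividef)
  also have "\<dots> = (\<Prod>i\<in>UNIV. shc (b$i) (\<alpha> i) (\<beta> i))"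
    by (rule prod.cong) (use True in \<open>auto simp: shc_def binomial_fact\<close>)
  finally show ?thesis .
next
  case False
  then obtain i where "\<not> \<beta> i \<le> \<alpha> i" by blast
  then have "shc (b$i) (\<alpha> i) (\<beta> i) = 0" by (simp add: shc_def)
  then have "(\<Prod>i\<in>UNIV. shc (b$i) (\<alpha> i) (\<beta> i)) = 0" by (metis UNIV_I finite prod_zero)
  moreover have "shifted_mono b \<alpha> \<beta> = 0" unfolding shifted_mono_def by (rule if_not_P[OF False])
  ultimately show ?thesis by simp
qed

lemma mdeg_mono: "(\<And>i. \<beta> i \<le> \<alpha> i) \<Longrightarrow> mdeg \<beta> \<le> mdeg \<alpha>"
  unfolding mdeg_def by (rule sum_mono) auto

lemma mdeg_le_trans: "\<forall>i. \<beta> i \<le> \<alpha> i \<Longrightarrow> mdeg \<alpha> \<le> p \<Longrightarrow> mdeg \<beta> \<le> p"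
  using mdeg_mono order_trans by blast

lemma PiE_atMost_eq: "PiE UNIV (\<lambda>i. {..\<alpha> i}) = {\<beta>. \<forall>i. \<beta> i \<le> (\<alpha> i::nat)}"
  by auto

lemma shifted_mono_eval:
  assumes "mdeg \<alpha> \<le> p"
  shows "(\<Sum>\<kappa>\<in>mindex p. shifted_mono b \<alpha> \<kappa> * (\<Prod>i\<in>UNIV. (x$i) ^ \<kappa> i)) = dpm \<alpha> (x - b)"
proof -
  let ?B = "PiE UNIV (\<lambda>i. {..\<alpha> i})"
  have sub: "?B \<subseteq> mindex p"
    unfolding PiE_atMost_eq using mdeg_le_trans[OF _ assms] by (auto simp: mem_mindex)
  have "(\<Sum>\<kappa>\<in>mindex p. shifted_mono b \<alpha> \<kappa> * (\<Prod>i\<in>UNIV. (x$i) ^ \<kappa> i)) =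
      (\<Sum>\<kappa>\<in>?B. shifted_mono b \<alpha> \<kappa> * (\<Prod>i\<in>UNIV. (x$i) ^ \<kappa> i))"
    by (rule sum.mono_neutral_right[OF finite_mindex sub]) (unfold PiE_atMost_eq, auto simp: shifted_mono_def)
  also have "\<dots> = (\<Sum>\<kappa>\<in>?B. \<Prod>i\<in>UNIV. shc (b$i) (\<alpha> i) (\<kappa> i) * (x$i) ^ \<kappa> i)"
    by (simp add: shifted_mono_eq_prod prod.distrib)
  also have "\<dots> = (\<Prod>i\<in>UNIV. \<Sum>k\<le>\<alpha> i. shc (b$i) (\<alpha> i) k * (x$i) ^ k)"
    by (rule prod_sum_PiE[symmetric]) auto
  also have "\<dots> = (\<Prod>i\<in>UNIV. ((x - b)$i) ^ \<alpha> i / fact (\<alpha> i))"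
  proof (rule prod.cong[OF refl])
    fix i
    have "(\<Sum>k\<le>\<alpha> i. shc (b$i) (\<alpha> i) k * (x$i) ^ k) =
        (\<Sum>k\<le>\<alpha> i. (- (b$i)) ^ (\<alpha> i - k) / fact (\<alpha> i - k) * ((x$i) ^ k / fact k))"
      by (rule sum.cong) (auto simp: shc_def)
    then show "(\<Sum>k\<le>\<alpha> i. shc (b$i) (\<alpha> i) k * (x$i) ^ k) = ((x - b)$i) ^ \<alpha> i / fact (\<alpha> i)"
      unfolding binomial_divided by simp
  qed
  finally show ?thesis by (simp add: dpm_def)
qed

lemma dual_comp_pdelta: "mdeg \<alpha> \<le> p \<Longrightarrow> dual_comp p (pdelta p a) \<alpha> b = dpm \<alpha> (a - b)"
  unfolding dual_comp_def dual_app_def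
  by (subst shifted_mono_eval[symmetric], assumption, rule sum.cong) (auto simp: pdelta_def mem_mindex)

text \<open>Compares coefficients of \<open>x^k\<close> in the divided-power expansion of
  \<open>((b - a) + (x - b))^m\<close>.\<close>

lemma shc_recenter: "shc a m k = (\<Sum>j\<le>m. (b - a) ^ (m - j) / fact (m - j) * shc b j k)"
proof (cases "k \<le> m")
  case True
  define M where "M = m - k"
  have m: "m = M + k" using True by (simp add: M_def)
  have "(\<Sum>j\<le>m. (b - a) ^ (m - j) / fact (m - j) * shc b j k) =
      (\<Sum>j\<in>{k..m}. (b - a) ^ (m - j) / fact (m - j) * shc b j k)"
    by (rule sum.mono_neutral_right) (auto simp: shc_def)
  also have "\<dots> = (\<Sum>s\<le>M. (b - a) ^ (M - s) / fact (M - s) * ((-b) ^ s / fact s) / fact k)"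
    by (rule sum.reindex_bij_witness[where i = "\<lambda>s. s + k" and j = "\<lambda>j. j - k"]) (auto simp: m shc_def)
  also have "\<dots> = ((b - a) + (-b)) ^ M / fact M / fact k"
    unfolding sum_divide_distrib[symmetric] binomial_divided ..
  finally show ?thesis using True by (simp add: shc_def M_def)
next
  case False
  then show ?thesis by (auto simp: shc_def intro!: sum.neutral[symmetric])
qed

lemma shifted_mono_recenter:
  "shifted_mono a \<gamma> \<kappa> = (\<Sum>\<alpha>\<in>PiE UNIV (\<lambda>i. {..\<gamma> i}). dpm (\<lambda>i. \<gamma> i - \<alpha> i) (b - a) * shifted_mono b \<alpha> \<kappa>)"
proof -
  have "shifted_mono a \<gamma> \<kappa> = (\<Prod>i\<in>UNIV. \<Sum>j\<le>\<gamma> i. ((b - a)$i) ^ (\<gamma> i - j) / fact (\<gamma> i - j) * shc (b$i) j (\<kappa> i))"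
    unfolding shifted_mono_eq_prod
  proof (rule prod.cong[OF refl])
    fix i
    show "shc (a$i) (\<gamma> i) (\<kappa> i) = (\<Sum>j\<le>\<gamma> i. ((b - a)$i) ^ (\<gamma> i - j) / fact (\<gamma> i - j) * shc (b$i) j (\<kappa> i))"
      unfolding vector_minus_component by (rule shc_recenter)
  qed
  also have "\<dots> = (\<Sum>\<alpha>\<in>PiE UNIV (\<lambda>i. {..\<gamma> i}). \<Prod>i\<in>UNIV. ((b - a)$i) ^ (\<gamma> i - \<alpha> i) / fact (\<gamma> i - \<alpha> i) * shc (b$i) (\<alpha> i) (\<kappa> i))"
    by (rule prod_sum_PiE) auto
  also have "\<dots> = (\<Sum>\<alpha>\<in>PiE UNIV (\<lambda>i. {..\<gamma> i}). dpm (\<lambda>i. \<gamma> i - \<alpha> i) (b - a) * shifted_mono b \<alpha> \<kappa>)"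
    unfolding shifted_mono_eq_prod dpm_def prod.distrib ..
  finally show ?thesis .
qed

lemma dual_comp_recenter:
  assumes "mdeg \<gamma> \<le> p"
  shows "dual_comp p \<eta> \<gamma> a = (\<Sum>\<alpha>\<in>{\<alpha>\<in>mindex p. \<forall>i. \<alpha> i \<le> \<gamma> i}. dpm (\<lambda>i. \<gamma> i - \<alpha> i) (b - a) * dual_comp p \<eta> \<alpha> b)"
proof -
  have eq: "{\<alpha>\<in>mindex p. \<forall>i. \<alpha> i \<le> \<gamma> i} = PiE UNIV (\<lambda>i. {..\<gamma> i})"
    unfolding PiE_atMost_eq using mdeg_le_trans[OF _ assms] by (auto simp: mem_mindex)
  show ?thesis
    unfolding dual_comp_def dual_app_def eq sum_distrib_left
    by (subst sum.swap) (simp add: shifted_mono_recenter[of a \<gamma> _ b] sum_distrib_right mult.assoc)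
qed

lemma dual_comp_add: "dual_comp p (\<lambda>\<beta>. \<xi> \<beta> + \<eta> \<beta>) \<alpha> b = dual_comp p \<xi> \<alpha> b + dual_comp p \<eta> \<alpha> b"
  by (simp add: dual_comp_def dual_app_def algebra_simps sum.distrib)

lemma dual_comp_scale: "dual_comp p (\<lambda>\<beta>. c * \<xi> \<beta>) \<alpha> b = c * dual_comp p \<xi> \<alpha> b"
  by (simp add: dual_comp_def dual_app_def algebra_simps sum_distrib_left)

lemma dual_comp_zero [simp]: "dual_comp p (\<lambda>\<beta>. 0) \<alpha> b = 0"
  by (simp add: dual_comp_def dual_app_def)

lemma dual_comp_sum:
  "dual_comp p (\<lambda>\<beta>. \<Sum>v\<in>V. c v * \<xi> v \<beta>) \<alpha> b = (\<Sum>v\<in>V. c v * dual_comp p (\<xi> v) \<alpha> b)"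
  unfolding dual_comp_def dual_app_def sum_distrib_left
  by (subst sum.swap) (simp add: mult_ac)

lemma tendsto_shifted_mono:
  assumes "(b \<longlongrightarrow> c) F"
  shows "((\<lambda>k. shifted_mono (b k) \<alpha> \<kappa>) \<longlongrightarrow> shifted_mono c \<alpha> \<kappa>) F"
proof -
  have "((\<lambda>k. shc (b k $ i) m j) \<longlongrightarrow> shc (c $ i) m j) F" for i m j
    unfolding shc_def by (cases "j \<le> m") (auto intro!: tendsto_intros assms)
  then show ?thesis unfolding shifted_mono_eq_prod by (intro tendsto_prod)
qed

lemma tendsto_dual_comp:
  assumes "(b \<longlongrightarrow> c) F" "\<And>\<kappa>. ((\<lambda>k. \<xi> k \<kappa>) \<longlongrightarrow> \<zeta> \<kappa>) F"
  shows "((\<lambda>k. dual_comp p (\<xi> k) \<alpha> (b k)) \<longlongrightarrow> dual_comp p \<zeta> \<alpha> c) F"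
  unfolding dual_comp_def dual_app_def
  by (intro tendsto_sum tendsto_mult tendsto_shifted_mono assms)

subsection \<open>Restrictions of \<open>C\<^sup>p\<close> functions\<close>

text \<open>The value of \<open>\<xi>\<close> on the Taylor polynomial at \<open>a\<close> of the
  function with derivatives \<open>D\<close>, since \<open>dual_comp p \<xi> \<alpha> a\<close> is
  its value on \<open>(x - a)^\<alpha> / \<alpha>!\<close>.\<close>

definition jet_eval :: "nat \<Rightarrow> (('n::finite \<Rightarrow> nat) \<Rightarrow> real^'n \<Rightarrow> real) \<Rightarrow> real^'n \<Rightarrow> (('n \<Rightarrow> nat) \<Rightarrow> real) \<Rightarrow> real" where
  "jet_eval p D a \<xi> = (\<Sum>\<alpha>\<in>mindex p. D \<alpha> a * dual_comp p \<xi> \<alpha> a)"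

lemma jet_eval_add: "jet_eval p D a (\<lambda>\<beta>. \<xi> \<beta> + \<eta> \<beta>) = jet_eval p D a \<xi> + jet_eval p D a \<eta>"
  by (simp add: jet_eval_def dual_comp_add algebra_simps sum.distrib)

lemma jet_eval_scale: "jet_eval p D a (\<lambda>\<beta>. c * \<xi> \<beta>) = c * jet_eval p D a \<xi>"
  by (simp add: jet_eval_def dual_comp_scale algebra_simps sum_distrib_left)

lemma jet_eval_sum:
  "jet_eval p D a (\<lambda>\<beta>. \<Sum>v\<in>V. c v * \<xi> v \<beta>) = (\<Sum>v\<in>V. c v * jet_eval p D a (\<xi> v))"
  unfolding jet_eval_def dual_comp_sum sum_distrib_left
  by (subst sum.swap) (simp add: mult_ac)

lemma jet_eval_pdelta: "jet_eval p D a (pdelta p a) = D (\<lambda>_. 0) a"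
proof -
  have "jet_eval p D a (pdelta p a) = (\<Sum>\<alpha>\<in>mindex p. D \<alpha> a * (if \<alpha> = (\<lambda>_. 0) then 1 else 0))"
    unfolding jet_eval_def by (rule sum.cong) (auto simp: dual_comp_pdelta dpm_zero mem_mindex)
  also have "\<dots> = D (\<lambda>_. 0) a"
    by (subst sum.mono_neutral_right[of _ "{\<lambda>_. 0}"]) (auto simp: mem_mindex)
  finally show ?thesis .
qed

text \<open>Expands the Taylor polynomial at \<open>a\<close> around \<open>b\<close>. The
  components of \<open>\<eta>\<close> at \<open>b\<close>, which the smallness condition controls,
  then meet the derivatives of that polynomial at \<open>b\<close>.\<close>

lemma jet_eval_recenter:
  "jet_eval p D a \<eta> = (\<Sum>\<alpha>\<in>mindex p. dual_comp p \<eta> \<alpha> b * tay p (\<lambda>\<gamma>. D \<gamma> a) a \<alpha> b)"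
proof -
  have "jet_eval p D a \<eta> = (\<Sum>\<gamma>\<in>mindex p. \<Sum>\<alpha>\<in>{\<alpha>\<in>mindex p. \<forall>i. \<alpha> i \<le> \<gamma> i}.
      dual_comp p \<eta> \<alpha> b * (D \<gamma> a * dpm (\<lambda>i. \<gamma> i - \<alpha> i) (b - a)))"
    unfolding jet_eval_def
  proof (rule sum.cong[OF refl])
    fix \<gamma> :: "'a \<Rightarrow> nat" assume "\<gamma> \<in> mindex p"
    then show "D \<gamma> a * dual_comp p \<eta> \<gamma> a = (\<Sum>\<alpha>\<in>{\<alpha>\<in>mindex p. \<forall>i. \<alpha> i \<le> \<gamma> i}.
      dual_comp p \<eta> \<alpha> b * (D \<gamma> a * dpm (\<lambda>i. \<gamma> i - \<alpha> i) (b - a)))"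
      by (subst dual_comp_recenter[of \<gamma> p \<eta> a b]) (auto simp: mem_mindex sum_distrib_left mult_ac)
  qed
  also have "\<dots> = (\<Sum>\<alpha>\<in>mindex p. \<Sum>\<gamma>\<in>{\<gamma>\<in>mindex p. \<forall>i. \<alpha> i \<le> \<gamma> i}.
      dual_comp p \<eta> \<alpha> b * (D \<gamma> a * dpm (\<lambda>i. \<gamma> i - \<alpha> i) (b - a)))"
    by (rule sum.swap_restrict) auto
  also have "\<dots> = (\<Sum>\<alpha>\<in>mindex p. dual_comp p \<eta> \<alpha> b * tay p (\<lambda>\<gamma>. D \<gamma> a) a \<alpha> b)"
  proof (rule sum.cong[OF refl])
    fix \<alpha> :: "'a \<Rightarrow> nat" assume \<alpha>: "\<alpha> \<in> mindex p"
    have "(\<Sum>\<gamma>\<in>{\<gamma>\<in>mindex p. \<forall>i. \<alpha> i \<le> \<gamma> i}. D \<gamma> a * dpm (\<lambda>i. \<gamma> i - \<alpha> i) (b - a)) =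
       (\<Sum>\<delta>\<in>mindex (p - mdeg \<alpha>). D (\<lambda>i. \<alpha> i + \<delta> i) a * dpm \<delta> (b - a))"
    proof (rule sum.reindex_bij_witness[where i = "\<lambda>\<delta> i. \<alpha> i + \<delta> i" and j = "\<lambda>\<gamma> i. \<gamma> i - \<alpha> i"])
      fix \<gamma> :: "'a \<Rightarrow> nat" assume g: "\<gamma> \<in> {\<gamma>\<in>mindex p. \<forall>i. \<alpha> i \<le> \<gamma> i}"
      then show eq: "(\<lambda>i. \<alpha> i + (\<gamma> i - \<alpha> i)) = \<gamma>" by auto
      have "mdeg (\<lambda>i. \<alpha> i + (\<gamma> i - \<alpha> i)) = mdeg \<alpha> + mdeg (\<lambda>i. \<gamma> i - \<alpha> i)" by (rule mdeg_add)
      then show "(\<lambda>i. \<gamma> i - \<alpha> i) \<in> mindex (p - mdeg \<alpha>)" using g eq by (auto simp: mem_mindex)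
      show "D (\<lambda>i. \<alpha> i + (\<gamma> i - \<alpha> i)) a * dpm (\<lambda>i. \<gamma> i - \<alpha> i) (b - a) = D \<gamma> a * dpm (\<lambda>i. \<gamma> i - \<alpha> i) (b - a)"
        using eq by simp
    next
      fix \<delta> :: "'a \<Rightarrow> nat" assume "\<delta> \<in> mindex (p - mdeg \<alpha>)"
      then show "(\<lambda>i. \<alpha> i + \<delta> i) \<in> {\<gamma>\<in>mindex p. \<forall>i. \<alpha> i \<le> \<gamma> i}"
        using \<alpha> by (auto simp: mem_mindex mdeg_add)
    qed auto
    then show "(\<Sum>\<gamma>\<in>{\<gamma>\<in>mindex p. \<forall>i. \<alpha> i \<le> \<gamma> i}. dual_comp p \<eta> \<alpha> b * (D \<gamma> a * dpm (\<lambda>i. \<gamma> i - \<alpha> i) (b - a))) =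
        dual_comp p \<eta> \<alpha> b * tay p (\<lambda>\<gamma>. D \<gamma> a) a \<alpha> b"
      unfolding tay_def sum_distrib_left[symmetric] by simp
  qed
  finally show ?thesis .
qed

text \<open>The condition on \<open>\<eta>\<close> in \<open>DeltaE\<close> and
  \<open>DeltaF\<close> with \<open>C\<close> in place of 1; linearity of the fibres absorbs the
  constant in \<open>PhiN_limit_scaled\<close>.\<close>

definition small_at :: "nat \<Rightarrow> real^'n::finite \<Rightarrow> real^'n \<Rightarrow> (('n \<Rightarrow> nat) \<Rightarrow> real) \<Rightarrow> real \<Rightarrow> bool" where
  "small_at p a b \<eta> C \<longleftrightarrow> (\<forall>\<alpha>. mdeg \<alpha> \<le> p \<longrightarrow> dist a b ^ (p - mdeg \<alpha>) * \<bar>dual_comp p \<eta> \<alpha> b\<bar> \<le> C)"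

text \<open>Evaluating \<open>\<eta>\<close> at \<open>a\<close> instead of \<open>b\<close> changes
  the value by the sum of its components at \<open>b\<close> times Taylor remainders. Those
  remainders are o(|a - b|^(p - |\<alpha>|)), exactly what the smallness condition compensates;
  afterwards \<open>\<xi> + \<eta>\<close> is evaluated at one point.\<close>

lemma jet_eval_limit:
  fixes D :: "('n::finite \<Rightarrow> nat) \<Rightarrow> real^'n \<Rightarrow> real"
  assumes D: "jetfam p UNIV D" and "a \<longlonglongrightarrow> c" "b \<longlonglongrightarrow> c"
    and "\<And>\<kappa>. (\<lambda>k. \<xi> k \<kappa> + \<eta> k \<kappa>) \<longlonglongrightarrow> \<zeta> \<kappa>" and small: "\<And>k::nat. small_at p (a k) (b k) (\<eta> k) 1"
  shows "(\<lambda>k. jet_eval p D (a k) (\<xi> k) + jet_eval p D (b k) (\<eta> k)) \<longlonglongrightarrow> jet_eval p D c \<zeta>"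
proof -
  have cD: "(\<lambda>k. D \<alpha> (a k)) \<longlonglongrightarrow> D \<alpha> c" if "mdeg \<alpha> \<le> p" for \<alpha>
    using jetfam_continuous_on[OF D that] assms(2)
    by (simp add: continuous_on_eq_continuous_at isCont_tendsto_compose)
  have 1: "(\<lambda>k. jet_eval p D (a k) (\<lambda>\<kappa>. \<xi> k \<kappa> + \<eta> k \<kappa>)) \<longlonglongrightarrow> jet_eval p D c \<zeta>"
    unfolding jet_eval_def
    by (intro tendsto_sum tendsto_mult cD tendsto_dual_comp assms) (simp add: mem_mindex)
  have 2: "(\<lambda>k. jet_eval p D (b k) (\<eta> k) - jet_eval p D (a k) (\<eta> k)) \<longlonglongrightarrow> 0"
  proof (rule LIMSEQ_I)
    fix e :: real assume e: "e > 0"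
    define m where "m = real (card (mindex p :: ('n \<Rightarrow> nat) set))"
    define e' where "e' = e / (m + 1)"
    have m: "m \<ge> 0" by (simp add: m_def)
    have e': "e' > 0" using e m by (simp add: e'_def)
    obtain d where d: "d > 0" "\<And>x y \<beta>. x \<in> cball c 1 \<Longrightarrow> y \<in> cball c 1 \<Longrightarrow> dist x y < d \<Longrightarrow> mdeg \<beta> \<le> p \<Longrightarrow>
       \<bar>D \<beta> y - tay p (\<lambda>\<gamma>. D \<gamma> x) x \<beta> y\<bar> \<le> e' * dist x y ^ (p - mdeg \<beta>)"
      using jetfam_taylor[OF open_UNIV D compact_cball convex_cball subset_UNIV e', of c 1] by meson
    have "\<forall>\<^sub>F k in sequentially. dist (a k) c < min 1 (d / 2)" "\<forall>\<^sub>F k in sequentially. dist (b k) c < min 1 (d / 2)"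
      using assms(2,3) d(1) by (auto dest!: tendstoD[of _ c _ "min 1 (d / 2)"])
    then have "\<forall>\<^sub>F k in sequentially. norm (jet_eval p D (b k) (\<eta> k) - jet_eval p D (a k) (\<eta> k) - 0) < e"
    proof eventually_elim
      case (elim k)
      let ?x = "a k" and ?y = "b k"
      have xy: "?x \<in> cball c 1" "?y \<in> cball c 1" using elim by (auto simp: dist_commute)
      have dxy: "dist ?x ?y < d" using dist_triangle2[of ?x ?y c] elim by simp
      have "jet_eval p D ?y (\<eta> k) - jet_eval p D ?x (\<eta> k) =
         (\<Sum>\<alpha>\<in>mindex p. dual_comp p (\<eta> k) \<alpha> ?y * (D \<alpha> ?y - tay p (\<lambda>\<gamma>. D \<gamma> ?x) ?x \<alpha> ?y))"
        unfolding jet_eval_recenter[of p D ?x "\<eta> k" ?y]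
        by (simp add: jet_eval_def right_diff_distrib sum_subtractf mult.commute)
      also have "\<bar>\<dots>\<bar> \<le> (\<Sum>\<alpha>\<in>(mindex p :: ('n \<Rightarrow> nat) set). e')"
      proof (rule order_trans[OF sum_abs], rule sum_mono)
        fix \<alpha> :: "'n \<Rightarrow> nat" assume "\<alpha> \<in> mindex p"
        then have \<alpha>: "mdeg \<alpha> \<le> p" by (simp add: mem_mindex)
        have "\<bar>dual_comp p (\<eta> k) \<alpha> ?y * (D \<alpha> ?y - tay p (\<lambda>\<gamma>. D \<gamma> ?x) ?x \<alpha> ?y)\<bar>
          \<le> \<bar>dual_comp p (\<eta> k) \<alpha> ?y\<bar> * (e' * dist ?x ?y ^ (p - mdeg \<alpha>))"
          unfolding abs_mult using d(2)[OF xy dxy \<alpha>] by (intro mult_left_mono) auto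
        also have "\<dots> = e' * (dist ?x ?y ^ (p - mdeg \<alpha>) * \<bar>dual_comp p (\<eta> k) \<alpha> ?y\<bar>)" by simp
        also have "\<dots> \<le> e' * 1"
          using small[of k] \<alpha> e' unfolding small_at_def by (intro mult_left_mono) auto
        finally show "\<bar>dual_comp p (\<eta> k) \<alpha> ?y * (D \<alpha> ?y - tay p (\<lambda>\<gamma>. D \<gamma> ?x) ?x \<alpha> ?y)\<bar> \<le> e'" by simp
      qed
      also have "\<dots> = m * e'" by (simp add: m_def)
      also have "\<dots> < e" using e m by (simp add: e'_def field_simps)
      finally show ?case by simp
    qed
    then show "\<exists>no. \<forall>k\<ge>no. norm (jet_eval p D (b k) (\<eta> k) - jet_eval p D (a k) (\<eta> k) - 0) < e"
      by (simp add: eventually_sequentially)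
  qed
  from tendsto_add[OF 1 2] show ?thesis by (simp add: jet_eval_add algebra_simps)
qed

text \<open>Closures can be tested by sequences because the functionals live in a product over the
  countable set of multi-indices.\<close>

lemma mem_primeF_iff:
  "(c, \<zeta>, l) \<in> primeF p X \<Phi> \<longleftrightarrow> c \<in> X \<and> (\<exists>a b \<xi> \<eta> x y.
     (\<forall>k::nat. a k \<in> X \<and> b k \<in> X \<and> (a k, \<xi> k, x k) \<in> \<Phi> \<and> (b k, \<eta> k, y k) \<in> \<Phi> \<and> small_at p (a k) (b k) (\<eta> k) 1) \<and>
     a \<longlonglongrightarrow> c \<and> b \<longlonglongrightarrow> c \<and> (\<forall>\<kappa>. (\<lambda>k. \<xi> k \<kappa> + \<eta> k \<kappa>) \<longlonglongrightarrow> \<zeta> \<kappa>) \<and> (\<lambda>k. x k + y k) \<longlonglongrightarrow> (l::real))"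
    (is "?L \<longleftrightarrow> c \<in> X \<and> ?R")
proof
  assume L: ?L
  then have c: "c \<in> X" and "(c, c, \<zeta>, l) \<in> closure (DeltaF p X \<Phi>)" by (auto simp: primeF_def)
  then obtain s where s: "\<And>k. s k \<in> DeltaF p X \<Phi>" "s \<longlonglongrightarrow> (c, c, \<zeta>, l)"
    unfolding closure_sequential by blast
  have "\<forall>k. \<exists>a b \<xi> \<eta> x y. s k = (a, b, \<lambda>\<beta>. \<xi> \<beta> + \<eta> \<beta>, x + y) \<and> a \<in> X \<and> b \<in> X \<and> (a, \<xi>, x) \<in> \<Phi> \<and>
       (b, \<eta>, y) \<in> \<Phi> \<and> small_at p a b \<eta> 1"
  proof
    fix k
    show "\<exists>a b \<xi> \<eta> x y. s k = (a, b, \<lambda>\<beta>. \<xi> \<beta> + \<eta> \<beta>, x + y) \<and> a \<in> X \<and> b \<in> X \<and> (a, \<xi>, x) \<in> \<Phi> \<and>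
       (b, \<eta>, y) \<in> \<Phi> \<and> small_at p a b \<eta> 1"
      using s(1)[of k] unfolding DeltaF_def fibre_def small_at_def by blast
  qed
  from this[unfolded choice_iff] obtain a b \<xi> \<eta> x y where *: "\<And>k. s k = (a k, b k, \<lambda>\<beta>. \<xi> k \<beta> + \<eta> k \<beta>, x k + y k)"
     "\<And>k. a k \<in> X \<and> b k \<in> X \<and> (a k, \<xi> k, x k) \<in> \<Phi> \<and> (b k, \<eta> k, y k) \<in> \<Phi> \<and> small_at p (a k) (b k) (\<eta> k) 1"
    by blast
  have l1: "(\<lambda>k. fst (s k)) \<longlonglongrightarrow> c" using tendsto_fst[OF s(2)] by simp
  have l2: "(\<lambda>k. fst (snd (s k))) \<longlonglongrightarrow> c" using tendsto_fst[OF tendsto_snd[OF s(2)]] by simp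
  have l3: "(\<lambda>k. fst (snd (snd (s k)))) \<longlonglongrightarrow> \<zeta>" using tendsto_fst[OF tendsto_snd[OF tendsto_snd[OF s(2)]]] by simp
  have l4: "(\<lambda>k. snd (snd (snd (s k)))) \<longlonglongrightarrow> l" using tendsto_snd[OF tendsto_snd[OF tendsto_snd[OF s(2)]]] by simp
  have "a \<longlonglongrightarrow> c" "b \<longlonglongrightarrow> c" "\<forall>\<kappa>. (\<lambda>k. \<xi> k \<kappa> + \<eta> k \<kappa>) \<longlonglongrightarrow> \<zeta> \<kappa>" "(\<lambda>k. x k + y k) \<longlonglongrightarrow> l"
    using l1 l2 l3 l4 unfolding *(1) tendsto_fun_iff by simp_all
  then show "c \<in> X \<and> ?R" using *(2) c by blast
next
  assume "c \<in> X \<and> ?R"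
  then obtain a b \<xi> \<eta> x y where c: "c \<in> X"
    and *: "\<And>k::nat. a k \<in> X \<and> b k \<in> X \<and> (a k, \<xi> k, x k) \<in> \<Phi> \<and> (b k, \<eta> k, y k) \<in> \<Phi> \<and> small_at p (a k) (b k) (\<eta> k) 1"
    and **: "a \<longlonglongrightarrow> c" "b \<longlonglongrightarrow> c" "\<forall>\<kappa>. (\<lambda>k. \<xi> k \<kappa> + \<eta> k \<kappa>) \<longlonglongrightarrow> \<zeta> \<kappa>" "(\<lambda>k. x k + y k) \<longlonglongrightarrow> l"
    by blast
  let ?s = "\<lambda>k. (a k, b k, \<lambda>\<beta>. \<xi> k \<beta> + \<eta> k \<beta>, x k + y k)"
  have "?s k \<in> DeltaF p X \<Phi>" for k
    using *[of k] unfolding DeltaF_def fibre_def small_at_def by blast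
  moreover have "?s \<longlonglongrightarrow> (c, c, \<zeta>, l)"
    using ** by (intro tendsto_Pair) (auto simp: tendsto_fun_iff)
  ultimately have "(c, c, \<zeta>, l) \<in> closure (DeltaF p X \<Phi>)"
    unfolding closure_sequential by (intro exI[of _ ?s]) simp
  then show ?L using c by (simp add: primeF_def)
qed

lemma mem_primeE_imp:
  assumes "(c, \<zeta>) \<in> primeE p X E"
  shows "c \<in> X \<and> (\<exists>a b \<xi> \<eta>.
     (\<forall>k::nat. a k \<in> X \<and> b k \<in> X \<and> (a k, \<xi> k) \<in> E \<and> (b k, \<eta> k) \<in> E \<and> small_at p (a k) (b k) (\<eta> k) 1) \<and>
     a \<longlonglongrightarrow> c \<and> b \<longlonglongrightarrow> c \<and> (\<forall>\<kappa>. (\<lambda>k. \<xi> k \<kappa> + \<eta> k \<kappa>) \<longlonglongrightarrow> \<zeta> \<kappa>))"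
proof -
  have c: "c \<in> X" and "(c, c, \<zeta>) \<in> closure (DeltaE p X E)" using assms by (auto simp: primeE_def)
  then obtain s where s: "\<And>k. s k \<in> DeltaE p X E" "s \<longlonglongrightarrow> (c, c, \<zeta>)"
    unfolding closure_sequential by blast
  have "\<forall>k. \<exists>a b \<xi> \<eta>. s k = (a, b, \<lambda>\<beta>. \<xi> \<beta> + \<eta> \<beta>) \<and> a \<in> X \<and> b \<in> X \<and> (a, \<xi>) \<in> E \<and>
       (b, \<eta>) \<in> E \<and> small_at p a b \<eta> 1"
  proof
    fix k
    show "\<exists>a b \<xi> \<eta>. s k = (a, b, \<lambda>\<beta>. \<xi> \<beta> + \<eta> \<beta>) \<and> a \<in> X \<and> b \<in> X \<and> (a, \<xi>) \<in> E \<and>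
       (b, \<eta>) \<in> E \<and> small_at p a b \<eta> 1"
      using s(1)[of k] unfolding DeltaE_def fibre_def small_at_def by blast
  qed
  from this[unfolded choice_iff] obtain a b \<xi> \<eta> where *: "\<And>k. s k = (a k, b k, \<lambda>\<beta>. \<xi> k \<beta> + \<eta> k \<beta>)"
     "\<And>k. a k \<in> X \<and> b k \<in> X \<and> (a k, \<xi> k) \<in> E \<and> (b k, \<eta> k) \<in> E \<and> small_at p (a k) (b k) (\<eta> k) 1"
    by blast
  have l1: "(\<lambda>k. fst (s k)) \<longlonglongrightarrow> c" using tendsto_fst[OF s(2)] by simp
  have l2: "(\<lambda>k. fst (snd (s k))) \<longlonglongrightarrow> c" using tendsto_fst[OF tendsto_snd[OF s(2)]] by simp
  have l3: "(\<lambda>k. snd (snd (s k))) \<longlonglongrightarrow> \<zeta>" using tendsto_snd[OF tendsto_snd[OF s(2)]] by simp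
  have "a \<longlonglongrightarrow> c" "b \<longlonglongrightarrow> c" "\<forall>\<kappa>. (\<lambda>k. \<xi> k \<kappa> + \<eta> k \<kappa>) \<longlonglongrightarrow> \<zeta> \<kappa>"
    using l1 l2 l3 unfolding *(1) tendsto_fun_iff by simp_all
  then show ?thesis using *(2) c by blast
qed


section \<open>Linear structure and monotonicity of the iterates\<close>

lemma lspan2_superset: "S \<subseteq> lspan2 S"
proof
  fix v assume "v \<in> S"
  then show "v \<in> lspan2 S"
    unfolding lspan2_def by (cases v) (auto intro!: exI[of _ "{v}"] exI[of _ "\<lambda>_. 1"])
qed

lemma lspan2_zero: "(\<lambda>\<beta>. 0, 0) \<in> lspan2 S"
  unfolding lspan2_def by (auto intro!: exI[of _ "{}"])

lemma lspan2_scale: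
  assumes "(\<xi>, l) \<in> lspan2 S"
  shows "(\<lambda>\<beta>. c * \<xi> \<beta>, c * l) \<in> lspan2 S"
proof -
  obtain T d where T: "finite T" "T \<subseteq> S" "\<xi> = (\<lambda>\<beta>. \<Sum>v\<in>T. d v * fst v \<beta>)" "l = (\<Sum>v\<in>T. d v * snd v)"
    using assms unfolding lspan2_def by blast
  then have "(\<lambda>\<beta>. c * \<xi> \<beta>) = (\<lambda>\<beta>. \<Sum>v\<in>T. (c * d v) * fst v \<beta>)" "c * l = (\<Sum>v\<in>T. (c * d v) * snd v)"
    by (simp_all add: sum_distrib_left mult.assoc)
  then show ?thesis using T(1,2) unfolding lspan2_def mem_Collect_eq case_prod_conv
    by (intro exI[of _ T] exI[of _ "\<lambda>v. c * d v"]) simp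
qed

lemma lspan2_add:
  assumes "(\<xi>, l) \<in> lspan2 S" "(\<eta>, m) \<in> lspan2 S"
  shows "(\<lambda>\<beta>. \<xi> \<beta> + \<eta> \<beta>, l + m) \<in> lspan2 S"
proof -
  obtain T d where T: "finite T" "T \<subseteq> S" "\<xi> = (\<lambda>\<beta>. \<Sum>v\<in>T. d v * fst v \<beta>)" "l = (\<Sum>v\<in>T. d v * snd v)"
    using assms(1) unfolding lspan2_def by blast
  obtain R e where R: "finite R" "R \<subseteq> S" "\<eta> = (\<lambda>\<beta>. \<Sum>v\<in>R. e v * fst v \<beta>)" "m = (\<Sum>v\<in>R. e v * snd v)"
    using assms(2) unfolding lspan2_def by blast
  define c where "c v = (if v \<in> T then d v else 0) + (if v \<in> R then e v else 0)" for v
  have sum: "(\<Sum>v\<in>T. d v * g v) + (\<Sum>v\<in>R. e v * g v) = (\<Sum>v\<in>T \<union> R. c v * g v)" for g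
  proof -
    have "(\<Sum>v\<in>T. d v * g v) = (\<Sum>v\<in>T \<union> R. (if v \<in> T then d v else 0) * g v)"
      by (rule sum.mono_neutral_cong_left) (use T R in auto)
    moreover have "(\<Sum>v\<in>R. e v * g v) = (\<Sum>v\<in>T \<union> R. (if v \<in> R then e v else 0) * g v)"
      by (rule sum.mono_neutral_cong_left) (use T R in auto)
    ultimately show ?thesis by (simp add: c_def distrib_right sum.distrib)
  qed
  have "(\<lambda>\<beta>. \<xi> \<beta> + \<eta> \<beta>) = (\<lambda>\<beta>. \<Sum>v\<in>T \<union> R. c v * fst v \<beta>)" "l + m = (\<Sum>v\<in>T \<union> R. c v * snd v)"
    unfolding T R sum by (rule refl)+
  then show ?thesis using T(1,2) R(1,2)
    unfolding lspan2_def mem_Collect_eq case_prod_conv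
    by (intro exI[of _ "T \<union> R"] exI[of _ c]) simp
qed

lemma small_at_zero: "small_at p a b (\<lambda>\<beta>. 0) 1"
  by (simp add: small_at_def)

text \<open>Constant sequences with \<open>\<eta> = 0\<close> satisfy the smallness condition
  trivially; this makes the iterates increase.\<close>

lemma subset_rhoF:
  assumes "\<And>a v. (a, v) \<in> \<Phi> \<Longrightarrow> a \<in> X" "\<And>a. a \<in> X \<Longrightarrow> (a, \<lambda>\<beta>. 0, 0) \<in> \<Phi>"
  shows "\<Phi> \<subseteq> rhoF p X \<Phi>"
proof
  fix z assume z: "z \<in> \<Phi>"
  obtain a \<xi> l where zz: "z = (a, \<xi>, l)" by (cases z) auto
  have a: "a \<in> X" using assms(1) z zz by blast
  have "(a, \<xi>, l) \<in> primeF p X \<Phi>"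
    unfolding mem_primeF_iff
    by (intro conjI a exI[of _ "\<lambda>_. a"] exI[of _ "\<lambda>_. \<xi>"] exI[of _ "\<lambda>_ _. 0"] exI[of _ "\<lambda>_. l"] exI[of _ "\<lambda>_. 0"])
      (use a z zz assms(2) small_at_zero in auto)
  then have "(\<xi>, l) \<in> lspan2 (fibre (primeF p X \<Phi>) a)"
    using lspan2_superset by (fastforce simp: fibre_def)
  then show "z \<in> rhoF p X \<Phi>" using a zz by (simp add: rhoF_def)
qed

definition PhiN :: "nat \<Rightarrow> (real^'n::finite) set \<Rightarrow> (real^'n \<Rightarrow> real) \<Rightarrow> nat \<Rightarrow>
    ((real^'n) \<times> (('n \<Rightarrow> nat) \<Rightarrow> real) \<times> real) set" where
  "PhiN p X f i = (rhoF p X ^^ i) (Phi0 p X f)"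

lemma PhiN_simps [simp]: "PhiN p X f 0 = Phi0 p X f" "PhiN p X f (Suc i) = rhoF p X (PhiN p X f i)"
  by (simp_all add: PhiN_def)

lemma PhiN_base: "(a, v) \<in> PhiN p X f i \<Longrightarrow> a \<in> X"
  by (cases i) (auto simp: Phi0_def rhoF_def)

lemma PhiN_scale: "(a, \<xi>, l) \<in> PhiN p X f i \<Longrightarrow> (a, \<lambda>\<beta>. c * \<xi> \<beta>, c * l) \<in> PhiN p X f i"
proof (cases i)
  case 0
  assume "(a, \<xi>, l) \<in> PhiN p X f i"
  then obtain d where "a \<in> X" "\<xi> = (\<lambda>\<beta>. d * pdelta p a \<beta>)" "l = d * f a" using 0 by (auto simp: Phi0_def)
  then show ?thesis using 0 by (auto simp: Phi0_def mult.assoc intro!: exI[of _ "c * d"])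
next
  case (Suc j)
  assume "(a, \<xi>, l) \<in> PhiN p X f i"
  then show ?thesis using Suc lspan2_scale[of \<xi> l] by (simp add: rhoF_def)
qed

lemma PhiN_add:
  "(a, \<xi>, l) \<in> PhiN p X f i \<Longrightarrow> (a, \<eta>, m) \<in> PhiN p X f i \<Longrightarrow> (a, \<lambda>\<beta>. \<xi> \<beta> + \<eta> \<beta>, l + m) \<in> PhiN p X f i"
proof (cases i)
  case 0
  assume "(a, \<xi>, l) \<in> PhiN p X f i" "(a, \<eta>, m) \<in> PhiN p X f i"
  then obtain d e where "a \<in> X" "\<xi> = (\<lambda>\<beta>. d * pdelta p a \<beta>)" "l = d * f a"
     "\<eta> = (\<lambda>\<beta>. e * pdelta p a \<beta>)" "m = e * f a" using 0 by (auto simp: Phi0_def)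
  then show ?thesis using 0 by (auto simp: Phi0_def distrib_right intro!: exI[of _ "d + e"])
next
  case (Suc j)
  assume "(a, \<xi>, l) \<in> PhiN p X f i" "(a, \<eta>, m) \<in> PhiN p X f i"
  then show ?thesis using Suc lspan2_add[of \<xi> l _ \<eta> m] by (simp add: rhoF_def)
qed

lemma PhiN_zero: "a \<in> X \<Longrightarrow> (a, \<lambda>\<beta>. 0, 0) \<in> PhiN p X f i"
  by (cases i) (auto simp: Phi0_def rhoF_def lspan2_zero intro!: exI[of _ 0])

lemma PhiN_sum:
  assumes "a \<in> X" "\<And>v. v \<in> V \<Longrightarrow> (a, \<xi> v, l v) \<in> PhiN p X f i"
  shows "(a, \<lambda>\<beta>. \<Sum>v\<in>V. c v * \<xi> v \<beta>, \<Sum>v\<in>V. c v * l v) \<in> PhiN p X f i"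
  using assms(2)
proof (induction V rule: infinite_finite_induct)
  case (insert v V)
  have "(a, \<lambda>\<beta>. c v * \<xi> v \<beta> + (\<Sum>v\<in>V. c v * \<xi> v \<beta>), c v * l v + (\<Sum>v\<in>V. c v * l v)) \<in> PhiN p X f i"
    by (rule PhiN_add[OF PhiN_scale]) (use insert in auto)
  then show ?case using insert by simp
qed (use PhiN_zero[OF assms(1)] in auto)

lemma PhiN_mono: "i \<le> j \<Longrightarrow> PhiN p X f i \<subseteq> PhiN p X f j"
proof (induction j)
  case (Suc j)
  have "PhiN p X f j \<subseteq> PhiN p X f (Suc j)"
    unfolding PhiN_simps by (rule subset_rhoF) (auto intro: PhiN_base PhiN_zero)
  then show ?case using Suc by (cases "i = Suc j") auto
qed simp

lemma rhoF_subset_graph: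
  assumes "jetfam p UNIV D" "\<Phi> \<subseteq> {(a, \<xi>, l). l = jet_eval p D a \<xi>}"
  shows "rhoF p X \<Phi> \<subseteq> {(a, \<xi>, l). l = jet_eval p D a \<xi>}"
proof -
  have pr: "l = jet_eval p D c \<zeta>" if cl: "(c, \<zeta>, l) \<in> primeF p X \<Phi>" for c \<zeta> l
  proof -
    obtain a b \<xi> \<eta> x y where *: "\<And>k::nat. (a k, \<xi> k, x k) \<in> \<Phi> \<and> (b k, \<eta> k, y k) \<in> \<Phi> \<and> small_at p (a k) (b k) (\<eta> k) 1"
      and **: "a \<longlonglongrightarrow> c" "b \<longlonglongrightarrow> c" "\<And>\<kappa>. (\<lambda>k. \<xi> k \<kappa> + \<eta> k \<kappa>) \<longlonglongrightarrow> \<zeta> \<kappa>" "(\<lambda>k. x k + y k) \<longlonglongrightarrow> l"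
      using cl unfolding mem_primeF_iff by blast
    have xy: "x k = jet_eval p D (a k) (\<xi> k)" "y k = jet_eval p D (b k) (\<eta> k)" for k
      using *[of k] assms(2) by auto
    have "(\<lambda>k. x k + y k) \<longlonglongrightarrow> jet_eval p D c \<zeta>"
      unfolding xy by (rule jet_eval_limit[OF assms(1) **(1-3)]) (use * in blast)
    then show ?thesis using **(4) LIMSEQ_unique by blast
  qed
  show ?thesis
  proof clarify
    fix a \<xi> l assume "(a, \<xi>, l) \<in> rhoF p X \<Phi>"
    then obtain T c where T: "finite T" "T \<subseteq> fibre (primeF p X \<Phi>) a" "\<xi> = (\<lambda>\<beta>. \<Sum>v\<in>T. c v * fst v \<beta>)"
      "l = (\<Sum>v\<in>T. c v * snd v)"
      by (auto simp: rhoF_def lspan2_def)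
    have "snd v = jet_eval p D a (fst v)" if "v \<in> T" for v
      using T(2) that pr[of a "fst v" "snd v"] by (auto simp: fibre_def)
    then show "l = jet_eval p D a \<xi>" unfolding T jet_eval_sum by (intro sum.cong) auto
  qed
qed

text \<open>Smallness involves only the functionals, so an approximating sequence for
  \<open>primeE\<close> serves for \<open>primeF\<close> once each functional carries its value, and
  \<open>jet_eval_limit\<close> identifies the limit.\<close>

lemma rhoE_subset_rhoF:
  assumes "jetfam p UNIV D" "\<And>a \<xi>. (a, \<xi>) \<in> E \<Longrightarrow> (a, \<xi>, jet_eval p D a \<xi>) \<in> \<Phi>" "(a, \<xi>) \<in> rhoE p X E"
  shows "(a, \<xi>, jet_eval p D a \<xi>) \<in> rhoF p X \<Phi>"
proof -
  have pr: "(c, \<zeta>, jet_eval p D c \<zeta>) \<in> primeF p X \<Phi>" if cl: "(c, \<zeta>) \<in> primeE p X E" for c \<zeta>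
  proof -
    obtain a b \<xi> \<eta> where c: "c \<in> X" and *: "\<And>k::nat. a k \<in> X \<and> b k \<in> X \<and> (a k, \<xi> k) \<in> E \<and> (b k, \<eta> k) \<in> E \<and> small_at p (a k) (b k) (\<eta> k) 1"
      and **: "a \<longlonglongrightarrow> c" "b \<longlonglongrightarrow> c" "\<And>\<kappa>. (\<lambda>k. \<xi> k \<kappa> + \<eta> k \<kappa>) \<longlonglongrightarrow> \<zeta> \<kappa>"
      using mem_primeE_imp[OF cl] by blast
    have lim: "(\<lambda>k. jet_eval p D (a k) (\<xi> k) + jet_eval p D (b k) (\<eta> k)) \<longlonglongrightarrow> jet_eval p D c \<zeta>"
      by (rule jet_eval_limit[OF assms(1) **(1-3)]) (use * in blast)
    show ?thesis
      unfolding mem_primeF_iff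
      by (intro conjI c exI[of _ a] exI[of _ b] exI[of _ \<xi>] exI[of _ \<eta>]
        exI[of _ "\<lambda>k. jet_eval p D (a k) (\<xi> k)"] exI[of _ "\<lambda>k. jet_eval p D (b k) (\<eta> k)"])
        (use * ** lim assms(2) in auto)
  qed
  have a: "a \<in> X" and "\<xi> \<in> lspan (fibre (primeE p X E) a)" using assms(3) by (auto simp: rhoE_def)
  then obtain T c where T: "finite T" "T \<subseteq> fibre (primeE p X E) a" "\<xi> = (\<lambda>\<beta>. \<Sum>v\<in>T. c v * v \<beta>)"
    by (auto simp: lspan_def)
  let ?g = "\<lambda>v. (v, jet_eval p D a v)"
  have inj: "inj_on ?g T" by (auto simp: inj_on_def)
  have "\<xi> = (\<lambda>\<beta>. \<Sum>v\<in>?g ` T. c (fst v) * fst v \<beta>)" "jet_eval p D a \<xi> = (\<Sum>v\<in>?g ` T. c (fst v) * snd v)"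
    unfolding sum.reindex[OF inj] using T(3) jet_eval_sum[of p D a c "\<lambda>v. v" T] by simp_all
  moreover have "?g ` T \<subseteq> fibre (primeF p X \<Phi>) a" using T(2) pr by (auto simp: fibre_def)
  ultimately have "(\<xi>, jet_eval p D a \<xi>) \<in> lspan2 (fibre (primeF p X \<Phi>) a)"
    unfolding lspan2_def mem_Collect_eq case_prod_conv
    using T(1) by (intro exI[of _ "?g ` T"] exI[of _ "\<lambda>v. c (fst v)"]) simp
  then show ?thesis using a by (simp add: rhoF_def)
qed

text \<open>The iterates lie in the graph, which gives uniqueness; lifting a functional of
  \<open>tau\<close> with its value gives existence. The lift is made at stage 2r and monotonicity
  moves it to stage 2(r + 1).\<close>

lemma nabla_function_of_extension:
  assumes "Cp_on p UNIV F" "\<And>x. x \<in> X \<Longrightarrow> F x = f x" "a \<in> X" "\<xi> \<in> fibre (tau p X) a"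
  shows "\<exists>!l. (a, \<xi>, l) \<in> nabla p X f"
proof -
  obtain D where D: "\<And>x. D (\<lambda>_. 0) x = F x" "jetfam p UNIV D"
    using assms(1) unfolding Cp_on_iff_jetfam by blast
  have graph: "PhiN p X f i \<subseteq> {(a, \<xi>, l). l = jet_eval p D a \<xi>}" for i
  proof (induction i)
    case 0
    then show ?case using D(1) assms(2) by (auto simp: Phi0_def jet_eval_scale jet_eval_pdelta)
  next
    case (Suc i)
    then show ?case unfolding PhiN_simps by (rule rhoF_subset_graph[OF D(2)])
  qed
  have lift: "(a, \<xi>) \<in> (rhoE p X ^^ i) (E0 p X) \<Longrightarrow> (a, \<xi>, jet_eval p D a \<xi>) \<in> PhiN p X f i" for i a \<xi>
  proof (induction i arbitrary: a \<xi>)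
    case 0
    then show ?case using D(1) assms(2) by (auto simp: E0_def Phi0_def jet_eval_scale jet_eval_pdelta)
  next
    case (Suc i)
    then show ?case using rhoE_subset_rhoF[OF D(2) Suc.IH] by simp
  qed
  define N where "N = card (mindex p :: ('a \<Rightarrow> nat) set)"
  have "(a, \<xi>, jet_eval p D a \<xi>) \<in> PhiN p X f (2 * N)"
    using assms(4) by (intro lift) (simp add: fibre_def tau_def N_def)
  then have "(a, \<xi>, jet_eval p D a \<xi>) \<in> PhiN p X f (2 * (N + 1))"
    using PhiN_mono[of "2 * N" "2 * (N + 1)" p X f] by auto
  moreover have "nabla p X f = PhiN p X f (2 * (N + 1))" by (simp add: nabla_def PhiN_def N_def)
  ultimately show ?thesis using graph[of "2 * (N + 1)"] by auto
qed

subsection \<open>Vanishing order\<close>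

fun vanishes :: "nat \<Rightarrow> real^'n::finite \<Rightarrow> (real^'n \<Rightarrow> real) \<Rightarrow> bool" where
  "vanishes 0 y F \<longleftrightarrow> True"
| "vanishes (Suc m) y F \<longleftrightarrow> F y = 0 \<and> (\<forall>i. vanishes m y (pd i F))"

lemma vanishes_cong:
  assumes "open U" "y \<in> U" "\<And>x. x \<in> U \<Longrightarrow> F x = G x" "vanishes m y F"
  shows "vanishes m y G"
  using assms(3,4)
proof (induction m arbitrary: F G)
  case (Suc m)
  have "vanishes m y (pd i G)" for i
    by (rule Suc.IH[of "pd i F"]) (use pd_cong[OF assms(1) _ Suc.prems(1)] Suc.prems(2) in auto)
  then show ?case using Suc.prems assms(2) by auto
qed simp

lemma vanishes_add:
  assumes "open U" "y \<in> U"
  shows "Ck k U F \<Longrightarrow> Ck k U G \<Longrightarrow> n \<le> Suc k \<Longrightarrow> vanishes n y F \<Longrightarrow> vanishes n y G \<Longrightarrow>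
    vanishes n y (\<lambda>x. F x + G x)"
proof (induction n arbitrary: k F G)
  case (Suc n)
  show ?case
  proof (cases k)
    case 0
    then show ?thesis using Suc.prems by simp
  next
    case k: (Suc l)
    have "vanishes n y (pd i (\<lambda>x. F x + G x))" for i
    proof (rule vanishes_cong[OF assms])
      show "vanishes n y (\<lambda>x. pd i F x + pd i G x)"
        using Suc.prems k by (intro Suc.IH[of l]) auto
      show "pd i F x + pd i G x = pd i (\<lambda>x. F x + G x) x" if "x \<in> U" for x
        using Suc.prems k that by (simp add: pd_add)
    qed
    then show ?thesis using Suc.prems by simp
  qed
qed simp

text \<open>Orders of vanishing add: the derivative of the product is a sum of two products, in each
  of which one order has dropped by one. \<open>n \<le> Suc k\<close> bounds the number of
  derivatives available.\<close>

lemma vanishes_mult: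
  assumes "open U" "y \<in> U"
  shows "Ck k U F \<Longrightarrow> Ck k U G \<Longrightarrow> n \<le> Suc k \<Longrightarrow> n \<le> m + l \<Longrightarrow> vanishes m y F \<Longrightarrow> vanishes l y G \<Longrightarrow>
    vanishes n y (\<lambda>x. F x * G x)"
proof (induction n arbitrary: k F G m l)
  case (Suc n)
  have 0: "F y * G y = 0" using Suc.prems(4-6) by (cases m; cases l) auto
  show ?case
  proof (cases k)
    case 0
    then show ?thesis using Suc.prems \<open>F y * G y = 0\<close> by simp
  next
    case k: (Suc k')
    have C: "Ck k' U F" "Ck k' U G" "\<And>i. Ck k' U (pd i F)" "\<And>i. Ck k' U (pd i G)"
      using Suc.prems k Ck_SucD by auto
    \<comment> \<open>Subtraction is truncated: for \<open>m = 0\<close> the order stays 0, and the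
      orders still add up to at least \<open>n\<close>.\<close>
    have v: "vanishes (m - 1) y (pd i F)" "vanishes (l - 1) y (pd i G)" for i
      using Suc.prems(5,6) by (cases m; cases l; auto)+
    have "vanishes n y (pd i (\<lambda>x. F x * G x))" for i
    proof (rule vanishes_cong[OF assms])
      have "vanishes n y (\<lambda>x. pd i F x * G x)"
        by (rule Suc.IH[OF C(3) C(2) _ _ v(1) Suc.prems(6)]) (use Suc.prems k in auto)
      moreover have "vanishes n y (\<lambda>x. F x * pd i G x)"
        by (rule Suc.IH[OF C(1) C(4) _ _ Suc.prems(5) v(2)]) (use Suc.prems k in auto)
      ultimately show "vanishes n y (\<lambda>x. pd i F x * G x + F x * pd i G x)"
        by (rule vanishes_add[OF assms Ck_mult[OF assms(1) C(3) C(2)] Ck_mult[OF assms(1) C(1) C(4)], rotated])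
          (use Suc.prems k in auto)
      show "pd i F x * G x + F x * pd i G x = pd i (\<lambda>x. F x * G x) x" if "x \<in> U" for x
        using Suc.prems(1,2) k that by (intro has_partial_imp_pd[symmetric] has_partial_mult) auto
    qed
    then show ?thesis using 0 by simp
  qed
qed simp

lemma vanishes_power:
  assumes "open U" "y \<in> U" "Ck k U F" "F y = 0"
  shows "m \<le> Suc k \<Longrightarrow> vanishes m y (\<lambda>x. F x ^ m)"
proof (induction m)
  case (Suc m)
  have "vanishes (Suc m) y (\<lambda>x. F x * F x ^ m)"
    by (rule vanishes_mult[OF assms(1-3) Ck_power[OF assms(1,3)], of _ 1 m]) (use Suc assms(4) in auto)
  then show ?case by simp
qed simp

lemma vanishes_prod:
  assumes "open U" "y \<in> U" "finite I"
    and "\<And>i. i \<in> I \<Longrightarrow> Ck k U (F i)" "\<And>i. i \<in> I \<Longrightarrow> vanishes (m i) y (F i)" "(\<Sum>i\<in>I. m i) \<le> Suc k"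
  shows "vanishes (\<Sum>i\<in>I. m i) y (\<lambda>x. \<Prod>i\<in>I. F i x)"
  using assms(3-)
proof (induction I rule: finite_induct)
  case (insert i I)
  have "vanishes (m i + (\<Sum>i\<in>I. m i)) y (\<lambda>x. F i x * (\<Prod>i\<in>I. F i x))"
    by (rule vanishes_mult[OF assms(1,2) _ Ck_prod[OF assms(1)]]) (use insert in auto)
  then show ?case using insert by simp
qed simp

lemma vanishes_dpm:
  fixes \<phi> :: "real^'n::finite \<Rightarrow> real^'n"
  assumes "open U" "y \<in> U" "\<And>j. Ck k U (\<lambda>x. \<phi> x $ j)" "mdeg \<alpha> \<le> k"
  shows "vanishes (mdeg \<alpha>) y (\<lambda>x. dpm \<alpha> (\<phi> x - \<phi> y))"
proof -
  have C: "Ck k U (\<lambda>x. \<phi> x $ i - \<phi> y $ i)" for i by (intro Ck_diff assms Ck_const)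
  have "vanishes (\<alpha> i) y (\<lambda>x. 1 / fact (\<alpha> i) * (\<phi> x $ i - \<phi> y $ i) ^ \<alpha> i)" for i
  proof (rule vanishes_mult[OF assms(1,2) Ck_const Ck_power[OF assms(1) C], of _ 0 "\<alpha> i"])
    show "vanishes (\<alpha> i) y (\<lambda>x. (\<phi> x $ i - \<phi> y $ i) ^ \<alpha> i)"
      by (rule vanishes_power[OF assms(1,2) C]) (use le_mdeg[of \<alpha> i] assms(4) in auto)
  qed (use le_mdeg[of \<alpha> i] assms(4) in auto)
  then have "vanishes (\<Sum>i\<in>UNIV. \<alpha> i) y (\<lambda>x. \<Prod>i\<in>UNIV. 1 / fact (\<alpha> i) * (\<phi> x $ i - \<phi> y $ i) ^ \<alpha> i)"
    by (intro vanishes_prod[OF assms(1,2), where k = k] Ck_cmult[OF assms(1)] Ck_power[OF assms(1)] C)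
      (use assms(4) in \<open>auto simp: mdeg_def\<close>)
  then show ?thesis by (simp add: mdeg_def dpm_def)
qed

lemma jetfam_vanishes:
  assumes "open U" "y \<in> U" "jetfam p U D" "vanishes n y (D (\<lambda>_. 0))"
  shows "mdeg \<beta> \<le> p \<Longrightarrow> vanishes (n - mdeg \<beta>) y (D \<beta>)"
proof (induction "mdeg \<beta>" arbitrary: \<beta>)
  case 0
  then have "\<beta> = (\<lambda>_. 0)" by simp
  then show ?case using assms(4) by simp
next
  case (Suc k)
  obtain \<gamma> i where \<gamma>: "\<beta> = inc i \<gamma>" "mdeg \<gamma> = k" using mdeg_pos_decomp Suc.hyps(2) by metis
  have IH: "vanishes (n - k) y (D \<gamma>)" using Suc.hyps(1)[of \<gamma>] Suc.prems \<gamma> by simp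
  show ?case
  proof (cases "n - mdeg \<beta>")
    case n: (Suc m)
    then have "n - k = Suc (n - mdeg \<beta>)" using \<gamma> by simp
    then have "vanishes (n - mdeg \<beta>) y (pd i (D \<gamma>))" using IH by simp
    then show ?thesis
      by (rule vanishes_cong[OF assms(1,2), rotated]) (use jetfam_pd[OF assms(3)] Suc.prems \<gamma> in auto)
  qed simp
qed

subsection \<open>Limits in the iterated bundles\<close>

text \<open>Dividing by \<open>C' = max C 1\<close> reduces the smallness constant to 1, and the
  limit is multiplied back because fibres are linear. The factors \<open>s k\<close> allow values
  that diverge before scaling.\<close>

lemma PhiN_limit_scaled:
  assumes "\<And>k::nat. (a k, \<xi> k, x k) \<in> PhiN p X f i" "\<And>k. (b k, \<eta> k, y k) \<in> PhiN p X f i"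
    "\<And>k. small_at p (a k) (b k) (\<eta> k) C" "a \<longlonglongrightarrow> c" "b \<longlonglongrightarrow> c" "c \<in> X"
    "\<And>\<kappa>. (\<lambda>k. \<xi> k \<kappa> + \<eta> k \<kappa>) \<longlonglongrightarrow> \<zeta> \<kappa>" "\<And>k. 0 \<le> s k" "\<And>k. s k \<le> 1" "s \<longlonglongrightarrow> t" "(\<lambda>k. s k * (x k + y k)) \<longlonglongrightarrow> l"
  shows "(c, \<lambda>\<kappa>. t * \<zeta> \<kappa>, l) \<in> PhiN p X f (Suc i)"
proof -
  define C' where "C' = max C 1"
  have C': "C' \<ge> 1" "C \<le> C'" by (auto simp: C'_def)
  define r where "r k = s k / C'" for k
  have "(c, \<lambda>\<kappa>. t / C' * \<zeta> \<kappa>, l / C') \<in> primeF p X (PhiN p X f i)"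
    unfolding mem_primeF_iff
  proof (rule conjI[OF assms(6)], rule exI[of _ a], rule exI[of _ b], rule exI[of _ "\<lambda>k \<kappa>. r k * \<xi> k \<kappa>"],
      rule exI[of _ "\<lambda>k \<kappa>. r k * \<eta> k \<kappa>"], rule exI[of _ "\<lambda>k. r k * x k"], rule exI[of _ "\<lambda>k. r k * y k"],
      intro conjI allI assms(4,5))
    fix k
    show "a k \<in> X" "b k \<in> X" using assms(1,2) PhiN_base by blast+
    show "(a k, \<lambda>\<kappa>. r k * \<xi> k \<kappa>, r k * x k) \<in> PhiN p X f i" "(b k, \<lambda>\<kappa>. r k * \<eta> k \<kappa>, r k * y k) \<in> PhiN p X f i"
      by (intro PhiN_scale assms)+
    show "small_at p (a k) (b k) (\<lambda>\<kappa>. r k * \<eta> k \<kappa>) 1"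
      unfolding small_at_def
    proof (intro allI impI)
      fix \<alpha> :: "'a \<Rightarrow> nat" assume \<alpha>: "mdeg \<alpha> \<le> p"
      define A where "A = dist (a k) (b k) ^ (p - mdeg \<alpha>) * \<bar>dual_comp p (\<eta> k) \<alpha> (b k)\<bar>"
      have A: "A \<le> C" "A \<ge> 0" using assms(3)[of k] \<alpha> by (auto simp: small_at_def A_def)
      have "\<bar>r k\<bar> \<le> 1 / C'" using assms(8,9)[of k] C' by (simp add: r_def divide_right_mono)
      then have "\<bar>r k\<bar> * A \<le> 1 / C' * C'" using A C' by (intro mult_mono) auto
      then show "dist (a k) (b k) ^ (p - mdeg \<alpha>) * \<bar>dual_comp p (\<lambda>\<kappa>. r k * \<eta> k \<kappa>) \<alpha> (b k)\<bar> \<le> 1"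
        using C' by (simp add: dual_comp_scale abs_mult A_def mult_ac)
    qed
  next
    fix \<kappa>
    have "(\<lambda>k. s k / C' * (\<xi> k \<kappa> + \<eta> k \<kappa>)) \<longlonglongrightarrow> t / C' * \<zeta> \<kappa>"
      using C' by (intro tendsto_intros assms) auto
    then show "(\<lambda>k. r k * \<xi> k \<kappa> + r k * \<eta> k \<kappa>) \<longlonglongrightarrow> t / C' * \<zeta> \<kappa>"
      by (simp add: r_def distrib_left)
  next
    have "(\<lambda>k. s k * (x k + y k) / C') \<longlonglongrightarrow> l / C'"
      using C' by (intro tendsto_intros assms) auto
    then show "(\<lambda>k. r k * x k + r k * y k) \<longlonglongrightarrow> l / C'"
      by (simp add: r_def distrib_left add_divide_distrib)
  qed
  then have "(\<lambda>\<kappa>. t / C' * \<zeta> \<kappa>, l / C') \<in> lspan2 (fibre (primeF p X (PhiN p X f i)) c)"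
    using lspan2_superset by (fastforce simp: fibre_def)
  then have "(c, \<lambda>\<kappa>. t / C' * \<zeta> \<kappa>, l / C') \<in> PhiN p X f (Suc i)"
    using assms(6) by (simp add: rhoF_def)
  then have "(c, \<lambda>\<kappa>. C' * (t / C' * \<zeta> \<kappa>), C' * (l / C')) \<in> PhiN p X f (Suc i)" by (rule PhiN_scale)
  then show ?thesis using C' by simp
qed

text \<open>If the values \<open>z = x + y\<close> did not converge, rescaling by \<open>1 / (1 + \<bar>z\<bar>)\<close> would produce a
  nonzero value over the zero functional.\<close>

lemma PhiN_limit:
  assumes uniq: "\<And>c l. (c, \<lambda>_. 0, l) \<in> PhiN p X f (Suc i) \<Longrightarrow> l = 0"
    and "\<And>k::nat. (a k, \<xi> k, x k) \<in> PhiN p X f i" "\<And>k. (b k, \<eta> k, y k) \<in> PhiN p X f i"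
    "\<And>k. small_at p (a k) (b k) (\<eta> k) C" "a \<longlonglongrightarrow> c" "b \<longlonglongrightarrow> c" "c \<in> X"
    "\<And>\<kappa>. (\<lambda>k. \<xi> k \<kappa> + \<eta> k \<kappa>) \<longlonglongrightarrow> \<zeta> \<kappa>"
  shows "\<exists>l. (\<lambda>k. x k + y k) \<longlonglongrightarrow> l \<and> (c, \<zeta>, l) \<in> PhiN p X f (Suc i)"
proof -
  define z where "z k = x k + y k" for k
  have sub: "\<exists>q l. strict_mono (q::nat \<Rightarrow> nat) \<and> (\<lambda>k. z (r (q k))) \<longlonglongrightarrow> l \<and> (c, \<zeta>, l) \<in> PhiN p X f (Suc i)"
    if r: "strict_mono (r::nat \<Rightarrow> nat)" for r
  proof -
    \<comment> \<open>Maps unbounded values into a compact range: \<open>s\<close> and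
      \<open>s * z\<close> are bounded and \<open>\<bar>s * z\<bar> = 1 - s\<close>, so along a
      subsequence both converge, with limits satisfying
      \<open>\<bar>u\<bar> = 1 - t\<close>.\<close>
    define s where "s k = 1 / (1 + \<bar>z k\<bar>)" for k
    have s: "0 < s k" "s k \<le> 1" "\<bar>s k * z k\<bar> = 1 - s k" for k
      by (auto simp: s_def abs_mult field_simps)
    have b1: "\<bar>s k * z k\<bar> \<le> 1" for k using s[of k] by simp
    have inS: "(s (r k), s (r k) * z (r k)) \<in> {0..1} \<times> {-1..1}" for k
      using s(1,2)[of "r k"] b1[of "r k"] unfolding abs_le_iff by auto
    have "compact ({0..1::real} \<times> {-1..1::real})" by (intro compact_Times compact_Icc)
    from this[unfolded compact_def, rule_format, of "\<lambda>k. (s (r k), s (r k) * z (r k))", OF inS]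
    obtain q w where q: "strict_mono q" "((\<lambda>k. (s (r k), s (r k) * z (r k))) \<circ> q) \<longlonglongrightarrow> w"
      by blast
    obtain t u where w: "w = (t, u)" by (cases w)
    have lim: "(\<lambda>k. s (r (q k))) \<longlonglongrightarrow> t" "(\<lambda>k. s (r (q k)) * z (r (q k))) \<longlonglongrightarrow> u"
      using tendsto_fst[OF q(2)] tendsto_snd[OF q(2)] by (auto simp: w o_def)
    have rq: "filterlim (\<lambda>k. r (q k)) sequentially sequentially"
      using filterlim_subseq[OF strict_mono_o[OF r q(1)]] by (simp add: o_def)
    have mem: "(c, \<lambda>\<kappa>. t * \<zeta> \<kappa>, u) \<in> PhiN p X f (Suc i)"
    proof (rule PhiN_limit_scaled[where a = "\<lambda>k. a (r (q k))" and b = "\<lambda>k. b (r (q k))" and \<xi> = "\<lambda>k. \<xi> (r (q k))"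
        and \<eta> = "\<lambda>k. \<eta> (r (q k))" and x = "\<lambda>k. x (r (q k))" and y = "\<lambda>k. y (r (q k))" and s = "\<lambda>k. s (r (q k))" and C = C])
      show "(\<lambda>k. a (r (q k))) \<longlonglongrightarrow> c" by (rule filterlim_compose[OF assms(5) rq])
      show "(\<lambda>k. b (r (q k))) \<longlonglongrightarrow> c" by (rule filterlim_compose[OF assms(6) rq])
      show "(\<lambda>k. \<xi> (r (q k)) \<kappa> + \<eta> (r (q k)) \<kappa>) \<longlonglongrightarrow> \<zeta> \<kappa>" for \<kappa> by (rule filterlim_compose[OF assms(8) rq])
      show "(\<lambda>k. s (r (q k)) * (x (r (q k)) + y (r (q k)))) \<longlonglongrightarrow> u" using lim(2) by (simp add: z_def)
      show "0 \<le> s (r (q k))" "s (r (q k)) \<le> 1" for k using s[of "r (q k)"] by auto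
    qed (use assms lim(1) in auto)
    have "(\<lambda>k. \<bar>s (r (q k)) * z (r (q k))\<bar>) \<longlonglongrightarrow> 1 - t"
      unfolding s(3) by (intro tendsto_intros lim)
    moreover have "(\<lambda>k. \<bar>s (r (q k)) * z (r (q k))\<bar>) \<longlonglongrightarrow> \<bar>u\<bar>" by (intro tendsto_rabs lim)
    ultimately have u: "\<bar>u\<bar> = 1 - t" using LIMSEQ_unique by blast
    \<comment> \<open>For \<open>t = 0\<close> the limit functional would be zero with value
      \<open>\<bar>u\<bar> = 1\<close>, against \<open>uniq\<close>. Dividing by the limit
      \<open>t\<close> then recovers the original values.\<close>
    have t: "t \<noteq> 0"
    proof
      assume "t = 0"
      then have "u = 0" using uniq[of c u] mem by simp
      then show False using u \<open>t = 0\<close> by simp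
    qed
    have "(c, \<lambda>\<kappa>. 1 / t * (t * \<zeta> \<kappa>), 1 / t * u) \<in> PhiN p X f (Suc i)" by (rule PhiN_scale[OF mem])
    then have m2: "(c, \<zeta>, u / t) \<in> PhiN p X f (Suc i)" using t by simp
    have "(\<lambda>k. s (r (q k)) * z (r (q k)) / s (r (q k))) \<longlonglongrightarrow> u / t" by (intro tendsto_divide lim t)
    moreover have "s k * z k / s k = z k" for k using s(1)[of k] by simp
    ultimately have "(\<lambda>k. z (r (q k))) \<longlonglongrightarrow> u / t" by simp
    then show ?thesis using q(1) m2 by blast
  qed
  obtain l where l: "(c, \<zeta>, l) \<in> PhiN p X f (Suc i)" using sub[of id] by (auto simp: strict_mono_def)
  \<comment> \<open>A subsequence staying away from \<open>l\<close> would have a further one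
    converging to some \<open>l'\<close> over the same \<open>\<zeta>\<close>, and
    \<open>l - l'\<close> would be a value over zero.\<close>
  have "z \<longlonglongrightarrow> l"
  proof (rule ccontr)
    assume "\<not> z \<longlonglongrightarrow> l"
    then obtain e where e: "e > 0" "\<not> (\<forall>\<^sub>F k in sequentially. dist (z k) l < e)" unfolding tendsto_iff by blast
    obtain r :: "nat \<Rightarrow> nat" where r: "strict_mono r" "\<And>k. \<not> dist (z (r k)) l < e"
      using not_eventually_sequentiallyD[OF e(2)] by blast
    obtain q l' where q: "(\<lambda>k. z (r (q k))) \<longlonglongrightarrow> l'" "(c, \<zeta>, l') \<in> PhiN p X f (Suc i)"
      using sub[OF r(1)] by blast
    have "(c, \<lambda>\<kappa>. \<zeta> \<kappa> + (-1) * \<zeta> \<kappa>, l + (-1) * l') \<in> PhiN p X f (Suc i)"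
      by (intro PhiN_add PhiN_scale l q)
    then have "l = l'" using uniq[of c "l - l'"] by simp
    then have "\<forall>\<^sub>F k in sequentially. dist (z (r (q k))) l < e" using tendstoD[OF q(1) e(1)] by simp
    then show False using r(2) by auto
  qed
  then show ?thesis using l unfolding z_def by blast
qed

subsection \<open>Pulling back by a parametrization\<close>

text \<open>\<open>DD \<kappa>\<close> is the family of derivatives of the monomial \<open>x\<^sup>\<kappa>\<close> composed with \<open>h\<close>, so \<open>zeta \<beta> y\<close> below
  is the functional sending \<open>P\<close> to the \<open>\<beta>\<close>-th derivative of \<open>P \<circ> h\<close> at \<open>y\<close>. The map \<open>h\<close> need not be
  injective.\<close>

locale parametrized =
  fixes X :: "(real^'n::finite) set" and f :: "real^'n \<Rightarrow> real" and p :: nat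
    and W :: "(real^'n) set" and h :: "real^'n \<Rightarrow> real^'n"
    and DD :: "('n \<Rightarrow> nat) \<Rightarrow> ('n \<Rightarrow> nat) \<Rightarrow> real^'n \<Rightarrow> real"
  assumes open_W: "open W"
    and Ck_h: "\<And>j. Ck p W (\<lambda>y. h y $ j)"
    and DD: "\<And>\<kappa>. mdeg \<kappa> \<le> p \<Longrightarrow> jetfam p W (DD \<kappa>)"
    and DD_zero: "\<And>\<kappa> y. mdeg \<kappa> \<le> p \<Longrightarrow> y \<in> W \<Longrightarrow> DD \<kappa> (\<lambda>_. 0) y = (\<Prod>i\<in>UNIV. (h y $ i) ^ \<kappa> i)"
    and uniq: "\<And>c l. (c, \<lambda>_. 0, l) \<in> PhiN p X f (p + 2) \<Longrightarrow> l = 0"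
    and dense: "{y \<in> W. h y \<in> X} \<subseteq> closure (interior {y \<in> W. h y \<in> X})"
begin

text \<open>The value 0 beyond degree \<open>p\<close> matches \<open>pdelta\<close>, so that
  \<open>zeta (\<lambda>_. 0) y\<close> and \<open>pdelta p (h y)\<close> are equal as functions for
  \<open>y\<close> in \<open>W\<close>.\<close>

definition zeta :: "('n \<Rightarrow> nat) \<Rightarrow> real^'n \<Rightarrow> ('n \<Rightarrow> nat) \<Rightarrow> real" where
  "zeta \<beta> y \<kappa> = (if mdeg \<kappa> \<le> p then DD \<kappa> \<beta> y else 0)"

definition Z :: "(real^'n) set" where "Z = {y \<in> W. h y \<in> X}"

lemma uniq_le: "i \<le> p + 2 \<Longrightarrow> (c, \<lambda>_. 0, l) \<in> PhiN p X f i \<Longrightarrow> l = 0"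
  using PhiN_mono[of i "p + 2" p X f] uniq by blast

lemma PhiN_unique:
  assumes "i \<le> p + 2" "(c, \<xi>, l) \<in> PhiN p X f i" "(c, \<xi>, m) \<in> PhiN p X f i"
  shows "l = m"
proof -
  have "(c, \<lambda>\<kappa>. \<xi> \<kappa> + (-1) * \<xi> \<kappa>, l + (-1) * m) \<in> PhiN p X f i"
    by (intro PhiN_add PhiN_scale assms)
  then show ?thesis using uniq_le[OF assms(1), of c "l - m"] by simp
qed

lemma continuous_on_h: "continuous_on W h"
  by (intro continuous_on_vec_components Ck_imp_continuous_on[OF Ck_h])

lemma tendsto_zeta:
  assumes "mdeg \<beta> \<le> p" "y \<in> W" "(g \<longlongrightarrow> y) F"
  shows "((\<lambda>k. zeta \<beta> (g k) \<kappa>) \<longlongrightarrow> zeta \<beta> y \<kappa>) F"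
proof (cases "mdeg \<kappa> \<le> p")
  case True
  have "isCont (DD \<kappa> \<beta>) y"
    using jetfam_continuous_on[OF DD[OF True] assms(1)] open_W assms(2) by (simp add: continuous_on_eq_continuous_at)
  then show ?thesis using True assms(3) by (simp add: zeta_def isCont_tendsto_compose)
qed (simp add: zeta_def)

lemma tendsto_h: "y \<in> W \<Longrightarrow> (g \<longlongrightarrow> y) F \<Longrightarrow> ((\<lambda>k. h (g k)) \<longlongrightarrow> h y) F"
  using continuous_on_h open_W by (simp add: continuous_on_eq_continuous_at isCont_tendsto_compose)

lemma dual_comp_zeta: "dual_comp p (zeta \<beta> y) \<alpha> b = (\<Sum>\<kappa>\<in>mindex p. shifted_mono b \<alpha> \<kappa> * DD \<kappa> \<beta> y)"
  unfolding dual_comp_def dual_app_def by (rule sum.cong) (auto simp: zeta_def mem_mindex)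

text \<open>The component is the \<beta>-th derivative at \<open>y\<close> of
  \<open>dpm \<alpha> (h x - h y)\<close> in \<open>x\<close>, with the centre \<open>h y\<close>
  held fixed. This function vanishes at \<open>y\<close> to order \<open>mdeg \<alpha>\<close>, more
  than \<open>mdeg \<beta>\<close> derivatives can remove.\<close>

lemma dual_comp_zeta_vanishes:
  assumes "y \<in> W" "mdeg \<beta> < mdeg \<alpha>" "mdeg \<alpha> \<le> p"
  shows "dual_comp p (zeta \<beta> y) \<alpha> (h y) = 0"
proof -
  define D where "D \<beta> x = (\<Sum>\<kappa>\<in>mindex p. shifted_mono (h y) \<alpha> \<kappa> * DD \<kappa> \<beta> x)" for \<beta> x
  have jf: "jetfam p W D"
    unfolding jetfam_def
  proof (intro conjI allI impI ballI)
    show "continuous_on W (D \<gamma>)" if "mdeg \<gamma> \<le> p" for \<gamma>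
      unfolding D_def
      by (intro continuous_intros jetfam_continuous_on[OF DD that]) (simp add: mem_mindex)
    show "has_partial i (D \<gamma>) (D (inc i \<gamma>) x) x" if "mdeg \<gamma> < p" "x \<in> W" for \<gamma> i x
      unfolding D_def
      by (intro has_partial_sum has_partial_cmult jetfam_has_partial[OF DD that]) (simp add: mem_mindex)
  qed
  have "vanishes (mdeg \<alpha>) y (\<lambda>x. dpm \<alpha> (h x - h y))"
    by (rule vanishes_dpm[OF open_W assms(1) Ck_h assms(3)])
  then have "vanishes (mdeg \<alpha>) y (D (\<lambda>_. 0))"
  proof (rule vanishes_cong[OF open_W assms(1), rotated])
    fix x assume "x \<in> W"
    then have "D (\<lambda>_. 0) x = (\<Sum>\<kappa>\<in>mindex p. shifted_mono (h y) \<alpha> \<kappa> * (\<Prod>i\<in>UNIV. (h x $ i) ^ \<kappa> i))"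
      unfolding D_def by (intro sum.cong) (auto simp: DD_zero mem_mindex)
    then show "dpm \<alpha> (h x - h y) = D (\<lambda>_. 0) x" using shifted_mono_eval[OF assms(3)] by simp
  qed
  then have "vanishes (mdeg \<alpha> - mdeg \<beta>) y (D \<beta>)"
    by (rule jetfam_vanishes[OF open_W assms(1) jf]) (use assms in simp)
  moreover obtain n where "mdeg \<alpha> - mdeg \<beta> = Suc n" using assms(2) by (metis Suc_diff_Suc)
  ultimately have "D \<beta> y = 0" by simp
  then show ?thesis by (simp add: dual_comp_zeta D_def)
qed

lemma dual_comp_zeta_bounded:
  assumes "compact B" "B \<subseteq> W" "mdeg \<beta> \<le> p"
  shows "\<exists>M\<ge>0. \<forall>y\<in>B. \<forall>\<alpha>. mdeg \<alpha> \<le> p \<longrightarrow> \<bar>dual_comp p (zeta \<beta> y) \<alpha> (h y)\<bar> \<le> M"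
proof -
  have "\<exists>M. \<forall>y\<in>B. \<bar>dual_comp p (zeta \<beta> y) \<alpha> (h y)\<bar> \<le> M" for \<alpha>
  proof -
    have "continuous_on B (\<lambda>y. dual_comp p (zeta \<beta> y) \<alpha> (h y))"
      unfolding continuous_on_def
      using assms by (intro ballI tendsto_dual_comp tendsto_h tendsto_zeta tendsto_ident_at) auto
    then have "bounded ((\<lambda>y. dual_comp p (zeta \<beta> y) \<alpha> (h y)) ` B)"
      using assms(1) compact_continuous_image compact_imp_bounded by blast
    then show ?thesis by (auto simp: bounded_iff)
  qed
  then obtain M where M: "\<And>\<alpha> y. y \<in> B \<Longrightarrow> \<bar>dual_comp p (zeta \<beta> y) \<alpha> (h y)\<bar> \<le> M \<alpha>" by metis
  show ?thesis
  proof (intro exI[of _ "\<Sum>\<alpha>\<in>mindex p. \<bar>M \<alpha>\<bar>"] conjI ballI allI impI)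
    fix y and \<alpha> :: "'n \<Rightarrow> nat" assume "y \<in> B" "mdeg \<alpha> \<le> p"
    have "\<bar>dual_comp p (zeta \<beta> y) \<alpha> (h y)\<bar> \<le> \<bar>M \<alpha>\<bar>" using M[OF \<open>y \<in> B\<close>, of \<alpha>] by linarith
    also have "\<dots> \<le> (\<Sum>\<alpha>\<in>mindex p. \<bar>M \<alpha>\<bar>)"
      by (rule member_le_sum) (use \<open>mdeg \<alpha> \<le> p\<close> in \<open>auto simp: mem_mindex\<close>)
    finally show "\<bar>dual_comp p (zeta \<beta> y) \<alpha> (h y)\<bar> \<le> (\<Sum>\<alpha>\<in>mindex p. \<bar>M \<alpha>\<bar>)" .
  qed (simp add: sum_nonneg)
qed

text \<open>The coordinates of \<open>h\<close> are the monomials of degree 1 composed with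
  \<open>h\<close>, so for \<open>p \<ge> 1\<close> their derivatives are members of
  \<open>DD\<close>, bounded on the compact set.\<close>

lemma h_lipschitz:
  assumes "compact B" "convex B" "B \<subseteq> W" "p \<ge> 1"
  shows "\<exists>L. \<forall>y\<in>B. \<forall>y'\<in>B. dist (h y) (h y') \<le> L * dist y y'"
proof -
  define e :: "'n \<Rightarrow> 'n \<Rightarrow> nat" where "e j = inc j (\<lambda>_. 0)" for j
  have e: "mdeg (e j) \<le> p" for j using assms(4) by (simp add: e_def)
  have ev: "DD (e j) (\<lambda>_. 0) y = h y $ j" if "y \<in> W" for y j
  proof -
    have "DD (e j) (\<lambda>_. 0) y = (\<Prod>i\<in>UNIV. if i = j then h y $ i else 1)"
      unfolding DD_zero[OF e that] by (rule prod.cong) (auto simp: e_def inc_def)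
    then show ?thesis by simp
  qed
  have "\<exists>M. \<forall>y\<in>B. \<bar>DD (e j) (inc i (\<lambda>_. 0)) y\<bar> \<le> M" for i j
  proof -
    have "continuous_on W (DD (e j) (inc i (\<lambda>_. 0)))"
      by (rule jetfam_continuous_on[OF DD[OF e]]) (use assms(4) in simp)
    then have "bounded (DD (e j) (inc i (\<lambda>_. 0)) ` B)"
      using assms(1,3) compact_continuous_image compact_imp_bounded continuous_on_subset by metis
    then show ?thesis by (auto simp: bounded_iff)
  qed
  then have "\<forall>i j. \<exists>M. \<forall>y\<in>B. \<bar>DD (e j) (inc i (\<lambda>_. 0)) y\<bar> \<le> M" by blast
  from this[unfolded choice_iff] obtain M where M: "\<And>i j y. y \<in> B \<Longrightarrow> \<bar>DD (e j) (inc i (\<lambda>_. 0)) y\<bar> \<le> M i j"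
    by blast
  define B0 where "B0 = (\<Sum>i\<in>UNIV. \<Sum>j\<in>UNIV. \<bar>M i j\<bar>)"
  have B0: "\<bar>DD (e j) (inc i (\<lambda>_. 0)) y\<bar> \<le> B0" if "y \<in> B" for i j y
  proof -
    have "\<bar>DD (e j) (inc i (\<lambda>_. 0)) y\<bar> \<le> \<bar>M i j\<bar>" using M[OF that, of j i] by simp
    also have "\<dots> \<le> (\<Sum>j\<in>UNIV. \<bar>M i j\<bar>)" by (rule member_le_sum) auto
    also have "\<dots> \<le> B0" unfolding B0_def by (rule member_le_sum) (auto intro: sum_nonneg)
    finally show ?thesis .
  qed
  have "dist (h y) (h y') \<le> real CARD('n) * (real CARD('n) * B0) * dist y y'" if y: "y \<in> B" "y' \<in> B" for y y'
  proof -
    have yW: "y \<in> W" "y' \<in> W" using y assms(3) by auto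
    have "\<bar>(h y - h y') $ j\<bar> \<le> real CARD('n) * B0 * norm (y - y')" for j
      using jetfam_increment_bound[OF open_W DD[OF e], of "\<lambda>_. 0" B y' y j B0] assms y B0
      by (simp add: ev[OF yW(1)] ev[OF yW(2)])
    then have "(\<Sum>j\<in>UNIV. \<bar>(h y - h y') $ j\<bar>) \<le> (\<Sum>j\<in>(UNIV::'n set). real CARD('n) * B0 * norm (y - y'))"
      by (intro sum_mono)
    moreover have "norm (h y - h y') \<le> (\<Sum>j\<in>UNIV. \<bar>(h y - h y') $ j\<bar>)" by (rule norm_le_l1_cart)
    ultimately show ?thesis by (simp add: dist_norm mult_ac)
  qed
  then show ?thesis by blast
qed

text \<open>For \<open>p = 0\<close> the map \<open>h\<close> is merely continuous, but then only
  \<open>k = 0\<close> occurs and both powers are 1.\<close>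

lemma h_dist_power:
  assumes "compact B" "convex B" "B \<subseteq> W"
  shows "\<exists>L\<ge>1. \<forall>y\<in>B. \<forall>y'\<in>B. \<forall>k\<le>p. dist (h y) (h y') ^ k \<le> L * dist y y' ^ k"
proof (cases "p = 0")
  case False
  then obtain L0 where L0: "\<And>y y'. y \<in> B \<Longrightarrow> y' \<in> B \<Longrightarrow> dist (h y) (h y') \<le> L0 * dist y y'"
    using h_lipschitz[OF assms] by auto
  define L where "L = max 1 L0"
  have L: "L \<ge> 1" "L0 \<le> L" by (auto simp: L_def)
  show ?thesis
  proof (intro exI[of _ "L ^ p"] conjI ballI allI impI)
    show "1 \<le> L ^ p" using L by simp
    fix y y' k assume y: "y \<in> B" "y' \<in> B" and k: "k \<le> p"
    have "dist (h y) (h y') \<le> L * dist y y'"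
      using L0[OF y] mult_right_mono[OF L(2), of "dist y y'"] by simp
    then have "dist (h y) (h y') ^ k \<le> (L * dist y y') ^ k" by (rule power_mono) simp
    also have "\<dots> \<le> L ^ p * dist y y' ^ k"
      unfolding power_mult_distrib using L k by (intro mult_right_mono power_increasing) auto
    finally show "dist (h y) (h y') ^ k \<le> L ^ p * dist y y' ^ k" .
  qed
qed (auto intro: exI[of _ 1])

text \<open>Transfers smallness from the parameter domain to the image. Components with
  \<open>mdeg \<alpha> > mdeg \<beta>\<close> vanish; for the others the power of
  \<open>dist y y'\<close> splits into \<open>p - mdeg \<beta>\<close> factors absorbed by
  \<open>s\<close> and \<open>mdeg \<beta> - mdeg \<alpha>\<close> factors absorbed by the
  diameter.\<close>

lemma small_at_zeta:
  assumes "compact B" "convex B" "B \<subseteq> W" "mdeg \<beta> \<le> p"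
  shows "\<exists>C. \<forall>y\<in>B. \<forall>y'\<in>B. \<forall>s. \<bar>s\<bar> * dist y y' ^ (p - mdeg \<beta>) \<le> 1 \<longrightarrow>
    small_at p (h y) (h y') (\<lambda>\<kappa>. s * zeta \<beta> y' \<kappa>) C"
proof -
  obtain L where L: "L \<ge> 1" "\<And>y y' k. y \<in> B \<Longrightarrow> y' \<in> B \<Longrightarrow> k \<le> p \<Longrightarrow> dist (h y) (h y') ^ k \<le> L * dist y y' ^ k"
    using h_dist_power[OF assms(1-3)] by meson
  obtain M where M: "M \<ge> 0" "\<And>y \<alpha>. y \<in> B \<Longrightarrow> mdeg \<alpha> \<le> p \<Longrightarrow> \<bar>dual_comp p (zeta \<beta> y) \<alpha> (h y)\<bar> \<le> M"
    using dual_comp_zeta_bounded[OF assms(1,3,4)] by meson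
  \<comment> \<open>The summand 1 gives \<open>R \<ge> 1\<close>, so that \<open>R ^ p\<close>
    dominates all lower powers.\<close>
  define R where "R = diameter B + 1"
  have R: "R \<ge> 1" using diameter_ge_0[OF compact_imp_bounded[OF assms(1)]] by (simp add: R_def)
  have Rd: "dist y y' \<le> R" if "y \<in> B" "y' \<in> B" for y y'
    using diameter_bounded_bound[OF compact_imp_bounded[OF assms(1)] that] by (simp add: R_def)
  show ?thesis
  proof (intro exI[of _ "L * M * R ^ p"] ballI allI impI)
    fix y y' s assume y: "y \<in> B" "y' \<in> B" and s: "\<bar>s\<bar> * dist y y' ^ (p - mdeg \<beta>) \<le> 1"
    show "small_at p (h y) (h y') (\<lambda>\<kappa>. s * zeta \<beta> y' \<kappa>) (L * M * R ^ p)"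
      unfolding small_at_def dual_comp_scale abs_mult
    proof (intro allI impI)
      fix \<alpha> :: "'n \<Rightarrow> nat" assume \<alpha>: "mdeg \<alpha> \<le> p"
      show "dist (h y) (h y') ^ (p - mdeg \<alpha>) * (\<bar>s\<bar> * \<bar>dual_comp p (zeta \<beta> y') \<alpha> (h y')\<bar>) \<le> L * M * R ^ p"
      proof (cases "mdeg \<beta> < mdeg \<alpha>")
        case True
        then show ?thesis using dual_comp_zeta_vanishes[of y' \<beta> \<alpha>] y \<alpha> assms(3) L M R by auto
      next
        case False
        define t where "t = dist y y'"
        have t: "0 \<le> t" "t \<le> R" using Rd y by (auto simp: t_def)
        have "dist (h y) (h y') ^ (p - mdeg \<alpha>) * (\<bar>s\<bar> * \<bar>dual_comp p (zeta \<beta> y') \<alpha> (h y')\<bar>)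
            \<le> (L * t ^ (p - mdeg \<alpha>)) * (\<bar>s\<bar> * M)"
          unfolding t_def using L y M(2)[OF y(2) \<alpha>] by (intro mult_mono) auto
        also have "t ^ (p - mdeg \<alpha>) = t ^ (p - mdeg \<beta>) * t ^ (mdeg \<beta> - mdeg \<alpha>)"
          using False assms(4) by (simp flip: power_add)
        also have "(L * (t ^ (p - mdeg \<beta>) * t ^ (mdeg \<beta> - mdeg \<alpha>))) * (\<bar>s\<bar> * M) =
            L * M * ((\<bar>s\<bar> * t ^ (p - mdeg \<beta>)) * t ^ (mdeg \<beta> - mdeg \<alpha>))" by (simp add: mult_ac)
        also have "\<dots> \<le> L * M * (1 * R ^ p)"
        proof (intro mult_left_mono mult_mono)
          show "\<bar>s\<bar> * t ^ (p - mdeg \<beta>) \<le> 1" using s by (simp add: t_def)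
          have "t ^ (mdeg \<beta> - mdeg \<alpha>) \<le> R ^ (mdeg \<beta> - mdeg \<alpha>)" using t by (intro power_mono) auto
          also have "\<dots> \<le> R ^ p" using R assms(4) by (intro power_increasing) auto
          finally show "t ^ (mdeg \<beta> - mdeg \<alpha>) \<le> R ^ p" .
        qed (use L M t in auto)
        finally show ?thesis by simp
      qed
    qed
  qed
qed

text \<open>Raising the order by one is a limit of difference quotients along a coordinate, split
  into \<open>\<xi>\<close> at \<open>y\<close> and \<open>\<eta>\<close> at the neighbouring point,
  which still lies in the interior. Each order costs one stage.\<close>

lemma zeta_interior:
  assumes "i \<le> p"
  shows "y \<in> interior Z \<Longrightarrow> mdeg \<beta> \<le> i \<Longrightarrow> \<exists>l. (h y, zeta \<beta> y, l) \<in> PhiN p X f i"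
  using assms
proof (induction i arbitrary: y \<beta>)
  case 0
  then have y: "y \<in> W" "h y \<in> X" using interior_subset by (auto simp: Z_def)
  have "\<beta> = (\<lambda>_. 0)" using 0 by simp
  then have "zeta \<beta> y = pdelta p (h y)"
    using y(1) by (auto simp: zeta_def[abs_def] pdelta_def DD_zero)
  then have "(h y, zeta \<beta> y, f (h y)) \<in> PhiN p X f 0"
    using y(2) by (auto simp: Phi0_def intro!: exI[of _ 1])
  then show ?case by blast
next
  case (Suc i)
  show ?case
  proof (cases "mdeg \<beta> \<le> i")
    case True
    then show ?thesis using Suc.IH[OF Suc.prems(1) True] Suc.prems(3) PhiN_mono[of i "Suc i" p X f] by auto
  next
    case False
    then obtain \<gamma> j where \<gamma>: "\<beta> = inc j \<gamma>" "mdeg \<gamma> = i"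
      using mdeg_pos_decomp[of \<beta> i] Suc.prems(2) by (metis le_antisym not_less_eq_eq)
    have y: "y \<in> W" "h y \<in> X" using Suc.prems(1) interior_subset by (auto simp: Z_def)
    obtain r0 where r0: "r0 > 0" "cball y r0 \<subseteq> interior Z"
      using Suc.prems(1) open_contains_cball[of "interior Z"] by auto
    \<comment> \<open>Step lengths at most 1 give
      \<open>t k ^ (p - mdeg \<gamma>) \<le> t k\<close>, as \<open>mdeg \<gamma> < p\<close>; this
      makes the factor \<open>1 / t k\<close> admissible in \<open>small_at_zeta\<close>.\<close>
    define r where "r = min r0 1"
    have r: "r > 0" "r \<le> 1" "cball y r \<subseteq> interior Z" using r0 by (auto simp: r_def)
    have rW: "cball y r \<subseteq> W" using r(3) interior_subset by (force simp: Z_def)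
    define t where "t k = r / real (Suc k)" for k
    have t: "t k > 0" "t k \<le> r" for k using r by (auto simp: t_def field_simps)
    have tlim: "t \<longlonglongrightarrow> 0"
      unfolding t_def using LIMSEQ_Suc[OF lim_const_over_n[of r]] by simp
    define v where "v k = y + t k *\<^sub>R axis j 1" for k
    have v: "v k \<in> cball y r" "dist y (v k) = t k" for k
      using t[of k] by (auto simp: v_def dist_norm)
    have vlim: "v \<longlonglongrightarrow> y"
    proof -
      have "v \<longlonglongrightarrow> y + 0 *\<^sub>R axis j 1" unfolding v_def by (intro tendsto_intros tlim)
      then show ?thesis by simp
    qed
    have ip: "i \<le> p" "mdeg \<gamma> < p" using Suc.prems \<gamma> by auto
    obtain l0 where l0: "(h y, zeta \<gamma> y, l0) \<in> PhiN p X f i"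
      using Suc.IH[OF Suc.prems(1)] \<gamma> ip by auto
    have "\<exists>l. (h (v k), zeta \<gamma> (v k), l) \<in> PhiN p X f i" for k
      using Suc.IH[of "v k" \<gamma>] v(1)[of k] r(3) \<gamma> ip by auto
    then obtain l where l: "\<And>k. (h (v k), zeta \<gamma> (v k), l k) \<in> PhiN p X f i" by metis
    obtain C where C: "\<And>y1 y2 s. y1 \<in> cball y r \<Longrightarrow> y2 \<in> cball y r \<Longrightarrow> \<bar>s\<bar> * dist y1 y2 ^ (p - mdeg \<gamma>) \<le> 1 \<Longrightarrow>
        small_at p (h y1) (h y2) (\<lambda>\<kappa>. s * zeta \<gamma> y2 \<kappa>) C"
      using small_at_zeta[OF compact_cball convex_cball rW less_imp_le[OF ip(2)]] by blast
    have "\<exists>l'. (\<lambda>k. (- 1 / t k) * l0 + (1 / t k) * l k) \<longlonglongrightarrow> l' \<and> (h y, zeta \<beta> y, l') \<in> PhiN p X f (Suc i)"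
    proof (rule PhiN_limit[where a = "\<lambda>_. h y" and b = "\<lambda>k. h (v k)" and C = C
        and \<xi> = "\<lambda>k \<kappa>. (- 1 / t k) * zeta \<gamma> y \<kappa>" and \<eta> = "\<lambda>k \<kappa>. (1 / t k) * zeta \<gamma> (v k) \<kappa>"])
      show "l = 0" if "(c, \<lambda>_. 0, l) \<in> PhiN p X f (Suc i)" for c l
        using uniq_le[OF _ that] Suc.prems(3) by simp
      show "small_at p (h y) (h (v k)) (\<lambda>\<kappa>. (1 / t k) * zeta \<gamma> (v k) \<kappa>) C" for k
      proof (rule C)
        have "t k ^ (p - mdeg \<gamma>) \<le> t k ^ 1"
          using t[of k] r ip by (intro power_decreasing) auto
        then show "\<bar>1 / t k\<bar> * dist y (v k) ^ (p - mdeg \<gamma>) \<le> 1" using t[of k] v(2)[of k] by (simp add: field_simps)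
      qed (use v r in auto)
      show "(\<lambda>k. h (v k)) \<longlonglongrightarrow> h y" by (rule tendsto_h[OF y(1) vlim])
      show "(\<lambda>k. (- 1 / t k) * zeta \<gamma> y \<kappa> + (1 / t k) * zeta \<gamma> (v k) \<kappa>) \<longlonglongrightarrow> zeta \<beta> y \<kappa>" for \<kappa>
      proof (cases "mdeg \<kappa> \<le> p")
        case True
        have "has_partial j (DD \<kappa> \<gamma>) (DD \<kappa> \<beta> y) y"
          unfolding \<gamma> by (rule jetfam_has_partial[OF DD[OF True] ip(2) y(1)])
        then have "((\<lambda>s. (DD \<kappa> \<gamma> (y + s *\<^sub>R axis j 1) - DD \<kappa> \<gamma> y) / s) \<longlongrightarrow> DD \<kappa> \<beta> y) (at 0)"
          unfolding has_partial_def DERIV_def by simp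
        moreover have "filterlim t (at 0) sequentially"
          using t by (intro filterlim_atI tlim always_eventually allI) (metis less_irrefl)
        ultimately have "(\<lambda>k. (DD \<kappa> \<gamma> (y + t k *\<^sub>R axis j 1) - DD \<kappa> \<gamma> y) / t k) \<longlonglongrightarrow> DD \<kappa> \<beta> y"
          by (rule filterlim_compose)
        then show ?thesis using True by (simp add: zeta_def v_def diff_divide_distrib)
      qed (simp add: zeta_def)
      show "(h y, \<lambda>\<kappa>. (- 1 / t k) * zeta \<gamma> y \<kappa>, (- 1 / t k) * l0) \<in> PhiN p X f i" for k
        by (rule PhiN_scale[OF l0])
      show "(h (v k), \<lambda>\<kappa>. (1 / t k) * zeta \<gamma> (v k) \<kappa>, (1 / t k) * l k) \<in> PhiN p X f i" for k
        by (rule PhiN_scale[OF l])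
    qed (use y in auto)
    then show ?thesis by blast
  qed
qed

text \<open>Points of \<open>Z\<close> are limits of interior points, where values exist at stage
  \<open>p\<close>. Taking the second summand to be zero makes the smallness condition
  trivial.\<close>

lemma zeta_exists:
  assumes "y \<in> Z" "mdeg \<beta> \<le> p"
  shows "\<exists>l. (h y, zeta \<beta> y, l) \<in> PhiN p X f (Suc p)"
proof -
  have y: "y \<in> W" "h y \<in> X" using assms(1) by (auto simp: Z_def)
  have "y \<in> closure (interior Z)" using assms(1) dense unfolding Z_def by blast
  then obtain v where v: "\<And>k. v k \<in> interior Z" "v \<longlonglongrightarrow> y" unfolding closure_sequential by blast
  obtain l where l: "\<And>k. (h (v k), zeta \<beta> (v k), l k) \<in> PhiN p X f p"
    using zeta_interior[OF order_refl v(1) assms(2)] by metis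
  have hv: "h (v k) \<in> X" for k using l PhiN_base by blast
  have "\<exists>l'. (\<lambda>k. l k + 0) \<longlonglongrightarrow> l' \<and> (h y, zeta \<beta> y, l') \<in> PhiN p X f (Suc p)"
  proof (rule PhiN_limit[where a = "\<lambda>k. h (v k)" and b = "\<lambda>k. h (v k)" and C = 1
      and \<xi> = "\<lambda>k. zeta \<beta> (v k)" and \<eta> = "\<lambda>k \<kappa>. 0"])
    show "(\<lambda>k. zeta \<beta> (v k) \<kappa> + 0) \<longlonglongrightarrow> zeta \<beta> y \<kappa>" for \<kappa>
      using tendsto_zeta[OF assms(2) y(1) v(2)] by simp
  qed (use l y hv tendsto_h[OF y(1) v(2)] PhiN_zero[OF hv] small_at_zero uniq_le[of "Suc p"] in auto)
  then show ?thesis by blast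
qed

section \<open>The pulled-back jet and Whitney's condition\<close>

definition jet :: "('n \<Rightarrow> nat) \<Rightarrow> real^'n \<Rightarrow> real" where
  "jet \<beta> y = (SOME l. (h y, zeta \<beta> y, l) \<in> PhiN p X f (Suc p))"

lemma jet: "y \<in> Z \<Longrightarrow> mdeg \<beta> \<le> p \<Longrightarrow> (h y, zeta \<beta> y, jet \<beta> y) \<in> PhiN p X f (Suc p)"
  unfolding jet_def by (rule someI_ex) (rule zeta_exists)

lemma jet_zero: "y \<in> Z \<Longrightarrow> jet (\<lambda>_. 0) y = f (h y)"
proof -
  assume y: "y \<in> Z"
  then have "y \<in> W" "h y \<in> X" by (auto simp: Z_def)
  then have "zeta (\<lambda>_. 0) y = pdelta p (h y)"
    by (auto simp: zeta_def[abs_def] pdelta_def DD_zero)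
  then have "(h y, zeta (\<lambda>_. 0) y, f (h y)) \<in> PhiN p X f 0"
    using \<open>h y \<in> X\<close> by (auto simp: Phi0_def intro!: exI[of _ 1])
  then have "(h y, zeta (\<lambda>_. 0) y, f (h y)) \<in> PhiN p X f (Suc p)"
    using PhiN_mono[of 0 "Suc p" p X f] by blast
  then show ?thesis using PhiN_unique[of "Suc p"] jet[OF y, of "\<lambda>_. 0"] by simp
qed

text \<open>The scaled difference of \<open>zeta \<beta> (y k)\<close> and its Taylor expansion from
  \<open>x k\<close> tends to the zero functional, since on each monomial it is a Taylor remainder
  of the family \<open>DD \<kappa>\<close>. The values it carries are the Whitney quotients of
  \<open>jet\<close>.\<close>

lemma jet_remainder_limit:
  assumes B: "compact B" "convex B" "B \<subseteq> W" and \<beta>: "mdeg \<beta> \<le> p"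
    and xy: "\<And>k. x k \<in> B \<inter> Z" "\<And>k. y k \<in> B \<inter> Z" "\<And>k. x k \<noteq> y k" "x \<longlonglongrightarrow> c" "y \<longlonglongrightarrow> c" "c \<in> Z"
  shows "(\<lambda>k. (jet \<beta> (y k) - tay p (\<lambda>\<gamma>. jet \<gamma> (x k)) (x k) \<beta> (y k)) / dist (x k) (y k) ^ (p - mdeg \<beta>)) \<longlonglongrightarrow> 0"
proof -
  have c: "c \<in> W" "h c \<in> X" using xy(6) by (auto simp: Z_def)
  have hX: "h (x k) \<in> X" "h (y k) \<in> X" for k using xy(1,2)[of k] by (auto simp: Z_def)
  define s where "s k = 1 / dist (x k) (y k) ^ (p - mdeg \<beta>)" for k
  have dpos: "dist (x k) (y k) > 0" for k using xy(3)[of k] by simp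
  obtain C where C: "\<And>y1 y2 s. y1 \<in> B \<Longrightarrow> y2 \<in> B \<Longrightarrow> \<bar>s\<bar> * dist y1 y2 ^ (p - mdeg \<beta>) \<le> 1 \<Longrightarrow>
      small_at p (h y1) (h y2) (\<lambda>\<kappa>. s * zeta \<beta> y2 \<kappa>) C"
    using small_at_zeta[OF B \<beta>] by auto
  let ?I = "mindex (p - mdeg \<beta>) :: ('n \<Rightarrow> nat) set"
  have dI: "mdeg (\<lambda>i. \<beta> i + \<gamma> i) \<le> p" if "\<gamma> \<in> ?I" for \<gamma>
    using that \<beta> by (simp add: mem_mindex mdeg_add)
  define ca where "ca k \<gamma> = - s k * dpm \<gamma> (y k - x k)" for k \<gamma>
  have "\<exists>l. (\<lambda>k. (\<Sum>\<gamma>\<in>?I. ca k \<gamma> * jet (\<lambda>i. \<beta> i + \<gamma> i) (x k)) + s k * jet \<beta> (y k)) \<longlonglongrightarrow> l \<and>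
      (h c, \<lambda>_. 0, l) \<in> PhiN p X f (Suc (Suc p))"
  proof (rule PhiN_limit[where a = "\<lambda>k. h (x k)" and b = "\<lambda>k. h (y k)" and C = C
      and \<xi> = "\<lambda>k \<kappa>. \<Sum>\<gamma>\<in>?I. ca k \<gamma> * zeta (\<lambda>i. \<beta> i + \<gamma> i) (x k) \<kappa>" and \<eta> = "\<lambda>k \<kappa>. s k * zeta \<beta> (y k) \<kappa>"])
    show "l = 0" if "(c, \<lambda>_. 0, l) \<in> PhiN p X f (Suc (Suc p))" for c l
      using uniq_le[OF _ that] by simp
    show "(h (x k), \<lambda>\<kappa>. \<Sum>\<gamma>\<in>?I. ca k \<gamma> * zeta (\<lambda>i. \<beta> i + \<gamma> i) (x k) \<kappa>,
        \<Sum>\<gamma>\<in>?I. ca k \<gamma> * jet (\<lambda>i. \<beta> i + \<gamma> i) (x k)) \<in> PhiN p X f (Suc p)" for k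
      using xy(1)[of k] dI by (intro PhiN_sum hX jet) auto
    show "(h (y k), \<lambda>\<kappa>. s k * zeta \<beta> (y k) \<kappa>, s k * jet \<beta> (y k)) \<in> PhiN p X f (Suc p)" for k
      using xy(2)[of k] \<beta> by (intro PhiN_scale jet) auto
    show "small_at p (h (x k)) (h (y k)) (\<lambda>\<kappa>. s k * zeta \<beta> (y k) \<kappa>) C" for k
      using xy(1,2)[of k] dpos[of k] by (intro C) (auto simp: s_def)
    show "(\<lambda>k. h (x k)) \<longlonglongrightarrow> h c" "(\<lambda>k. h (y k)) \<longlonglongrightarrow> h c" using tendsto_h c(1) xy(4,5) by blast+
    show "h c \<in> X" by (rule c)
    show "(\<lambda>k. (\<Sum>\<gamma>\<in>?I. ca k \<gamma> * zeta (\<lambda>i. \<beta> i + \<gamma> i) (x k) \<kappa>) + s k * zeta \<beta> (y k) \<kappa>) \<longlonglongrightarrow> 0" for \<kappa>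
    proof (cases "mdeg \<kappa> \<le> p")
      case True
      have eq: "(\<Sum>\<gamma>\<in>?I. ca k \<gamma> * zeta (\<lambda>i. \<beta> i + \<gamma> i) (x k) \<kappa>) + s k * zeta \<beta> (y k) \<kappa> =
          s k * (DD \<kappa> \<beta> (y k) - tay p (\<lambda>\<gamma>. DD \<kappa> \<gamma> (x k)) (x k) \<beta> (y k))" for k
        using True by (simp add: zeta_def ca_def tay_def right_diff_distrib sum_distrib_left sum_negf mult_ac)
      show ?thesis
        unfolding eq
      proof (rule LIMSEQ_I)
        fix e :: real assume e: "e > 0"
        obtain d where d: "d > 0" "\<And>u v. u \<in> B \<Longrightarrow> v \<in> B \<Longrightarrow> dist u v < d \<Longrightarrow>
           \<bar>DD \<kappa> \<beta> v - tay p (\<lambda>\<gamma>. DD \<kappa> \<gamma> u) u \<beta> v\<bar> \<le> e / 2 * dist u v ^ (p - mdeg \<beta>)"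
          using jetfam_taylor[OF open_W DD[OF True] B, of "e / 2"] e \<beta> by (meson half_gt_zero)
        have "(\<lambda>k. dist (x k) (y k)) \<longlonglongrightarrow> dist c c" by (intro tendsto_dist xy)
        then have "\<forall>\<^sub>F k in sequentially. dist (x k) (y k) < d"
          using order_tendstoD(2)[of _ "dist c c" _ d] d(1) by simp
        then obtain no where no: "\<And>k. k \<ge> no \<Longrightarrow> dist (x k) (y k) < d" by (auto simp: eventually_sequentially)
        show "\<exists>no. \<forall>k\<ge>no. norm (s k * (DD \<kappa> \<beta> (y k) - tay p (\<lambda>\<gamma>. DD \<kappa> \<gamma> (x k)) (x k) \<beta> (y k)) - 0) < e"
        proof (intro exI[of _ no] allI impI)
          fix k assume "no \<le> k"
          have sp: "s k > 0" using dpos[of k] by (simp add: s_def)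
          have "\<bar>DD \<kappa> \<beta> (y k) - tay p (\<lambda>\<gamma>. DD \<kappa> \<gamma> (x k)) (x k) \<beta> (y k)\<bar> \<le> e / 2 * dist (x k) (y k) ^ (p - mdeg \<beta>)"
            using d(2)[of "x k" "y k"] xy(1,2)[of k] no[OF \<open>no \<le> k\<close>] by auto
          then have "s k * \<bar>DD \<kappa> \<beta> (y k) - tay p (\<lambda>\<gamma>. DD \<kappa> \<gamma> (x k)) (x k) \<beta> (y k)\<bar> \<le> s k * (e / 2 * dist (x k) (y k) ^ (p - mdeg \<beta>))"
            using sp by (intro mult_left_mono) auto
          also have "\<dots> = e / 2" using dpos[of k] by (simp add: s_def)
          finally show "norm (s k * (DD \<kappa> \<beta> (y k) - tay p (\<lambda>\<gamma>. DD \<kappa> \<gamma> (x k)) (x k) \<beta> (y k)) - 0) < e"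
            using e sp by (simp add: abs_mult)
        qed
      qed
    qed (simp add: zeta_def)
  qed
  \<comment> \<open>Last of the \<open>p + 2\<close> stages: the limit of the quotients is a value
    over the zero functional, hence 0.\<close>
  then have "(\<lambda>k. (\<Sum>\<gamma>\<in>?I. ca k \<gamma> * jet (\<lambda>i. \<beta> i + \<gamma> i) (x k)) + s k * jet \<beta> (y k)) \<longlonglongrightarrow> 0"
    using uniq_le[of "Suc (Suc p)"] by auto
  moreover have "(\<Sum>\<gamma>\<in>?I. ca k \<gamma> * jet (\<lambda>i. \<beta> i + \<gamma> i) (x k)) + s k * jet \<beta> (y k) =
      (jet \<beta> (y k) - tay p (\<lambda>\<gamma>. jet \<gamma> (x k)) (x k) \<beta> (y k)) / dist (x k) (y k) ^ (p - mdeg \<beta>)" for k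
    by (simp add: ca_def tay_def s_def diff_divide_distrib sum_divide_distrib sum_negf mult_ac)
  ultimately show ?thesis by simp
qed


text \<open>If Whitney's condition failed to hold uniformly, there would be violating pairs with
  distances tending to 0; by compactness both members converge along a subsequence to one point of
  \<open>B \<inter> Z\<close>, against \<open>jet_remainder_limit\<close>.\<close>

lemma local_extension:
  assumes B: "compact B" "convex B" "B \<subseteq> W" and "closed X"
  shows "\<exists>F. Cp_on p UNIV F \<and> (\<forall>y\<in>B. h y \<in> X \<longrightarrow> F y = f (h y))"
proof (cases "B \<inter> Z = {}")
  case True
  then have "\<forall>y\<in>B. h y \<notin> X" using B(3) by (auto simp: Z_def)
  then show ?thesis using Ck_const[of p UNIV 0] Cp_on_iff_Ck[OF open_UNIV] by blast
next
  case False
  have "B \<inter> Z = B \<inter> h -` X" using B(3) by (auto simp: Z_def)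
  moreover have "closed (B \<inter> h -` X)"
    using continuous_on_subset[OF continuous_on_h B(3)] compact_imp_closed[OF B(1)] assms(4)
    by (rule continuous_closed_preimage)
  ultimately have "compact (B \<inter> Z)"
    using compact_Int_closed[OF B(1)] by (metis Int_assoc inf.idem)
  have each: "\<exists>d>0. \<forall>x\<in>B \<inter> Z. \<forall>y\<in>B \<inter> Z. dist x y < d \<longrightarrow>
      \<bar>jet \<beta> y - tay p (\<lambda>\<gamma>. jet \<gamma> x) x \<beta> y\<bar> \<le> e * dist x y ^ (p - mdeg \<beta>)"
    if e: "e > 0" and \<beta>: "mdeg \<beta> \<le> p" for e \<beta>
  proof (rule ccontr)
    assume neg: "\<not> ?thesis"
    have "\<forall>k. \<exists>x y. x \<in> B \<inter> Z \<and> y \<in> B \<inter> Z \<and> dist x y < 1 / real (Suc k) \<and>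
       \<not> \<bar>jet \<beta> y - tay p (\<lambda>\<gamma>. jet \<gamma> x) x \<beta> y\<bar> \<le> e * dist x y ^ (p - mdeg \<beta>)"
    proof
      fix k
      have "1 / real (Suc k) > 0" by simp
      then show "\<exists>x y. x \<in> B \<inter> Z \<and> y \<in> B \<inter> Z \<and> dist x y < 1 / real (Suc k) \<and>
         \<not> \<bar>jet \<beta> y - tay p (\<lambda>\<gamma>. jet \<gamma> x) x \<beta> y\<bar> \<le> e * dist x y ^ (p - mdeg \<beta>)"
        using neg by blast
    qed
    from this[unfolded choice_iff] obtain x y where xy: "\<And>k. x k \<in> B \<inter> Z" "\<And>k. y k \<in> B \<inter> Z" "\<And>k. dist (x k) (y k) < 1 / real (Suc k)"
       "\<And>k. \<not> \<bar>jet \<beta> (y k) - tay p (\<lambda>\<gamma>. jet \<gamma> (x k)) (x k) \<beta> (y k)\<bar> \<le> e * dist (x k) (y k) ^ (p - mdeg \<beta>)"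
      by blast
    from \<open>compact (B \<inter> Z)\<close>[unfolded compact_def, rule_format, of x, OF xy(1)]
    obtain c r where c: "c \<in> B \<inter> Z" and r: "strict_mono r" and xl: "(x \<circ> r) \<longlonglongrightarrow> c" by blast
    have d0: "(\<lambda>k. dist (x k) (y k)) \<longlonglongrightarrow> 0"
    proof (rule tendsto_sandwich[of "\<lambda>_. 0" _ _ "\<lambda>k. 1 / real (Suc k)"])
      show "(\<lambda>k. 1 / real (Suc k)) \<longlonglongrightarrow> 0" using LIMSEQ_Suc[OF lim_const_over_n[of 1]] by simp
    qed (use xy(3) in \<open>auto intro!: always_eventually less_imp_le\<close>)
    have "(\<lambda>k. dist (x (r k)) (y (r k))) \<longlonglongrightarrow> 0" using LIMSEQ_subseq_LIMSEQ[OF d0 r] by (simp add: o_def)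
    then have "(\<lambda>k. x (r k) - y (r k)) \<longlonglongrightarrow> 0"
      unfolding dist_norm by (rule tendsto_norm_zero_cancel)
    with xl have yl: "(\<lambda>k. y (r k)) \<longlonglongrightarrow> c" unfolding o_def by (rule Lim_transform2)
    have "(\<lambda>k. (jet \<beta> (y (r k)) - tay p (\<lambda>\<gamma>. jet \<gamma> (x (r k))) (x (r k)) \<beta> (y (r k))) / dist (x (r k)) (y (r k)) ^ (p - mdeg \<beta>)) \<longlonglongrightarrow> 0"
    proof (rule jet_remainder_limit[OF B \<beta>])
      show "x (r k) \<noteq> y (r k)" for k
      proof
        assume "x (r k) = y (r k)"
        then show False using xy(4)[of "r k"] e by simp
      qed
    qed (use xy c xl yl in \<open>auto simp: o_def\<close>)
    then have "\<forall>\<^sub>F k in sequentially. \<bar>(jet \<beta> (y (r k)) - tay p (\<lambda>\<gamma>. jet \<gamma> (x (r k))) (x (r k)) \<beta> (y (r k))) / dist (x (r k)) (y (r k)) ^ (p - mdeg \<beta>)\<bar> < e"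
      using e by (auto dest!: tendstoD[where e = e])
    then obtain k where k: "\<bar>(jet \<beta> (y (r k)) - tay p (\<lambda>\<gamma>. jet \<gamma> (x (r k))) (x (r k)) \<beta> (y (r k))) / dist (x (r k)) (y (r k)) ^ (p - mdeg \<beta>)\<bar> < e"
      by (auto simp: eventually_sequentially)
    have "x (r k) \<noteq> y (r k)" using xy(4)[of "r k"] e by auto
    then have pos: "dist (x (r k)) (y (r k)) ^ (p - mdeg \<beta>) > 0" by simp
    show False using k xy(4)[of "r k"] pos by (simp add: abs_divide divide_less_eq)
  qed
  interpret whitney_field "B \<inter> Z" jet p
  proof
    show "compact (B \<inter> Z)" "B \<inter> Z \<noteq> {}" by fact+
    fix e :: real assume e: "e > 0"
    have "\<exists>d>0. \<forall>\<beta>\<in>I. \<forall>x\<in>B \<inter> Z. \<forall>y\<in>B \<inter> Z. dist x y < d \<longrightarrow>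
        \<bar>jet \<beta> y - tay p (\<lambda>\<gamma>. jet \<gamma> x) x \<beta> y\<bar> \<le> e * dist x y ^ (p - mdeg \<beta>)"
      if "finite I" "I \<subseteq> mindex p" for I
      using that
    proof (induction I rule: finite_induct)
      case (insert \<beta> I)
      then obtain d1 where d1: "d1 > 0" "\<forall>\<beta>\<in>I. \<forall>x\<in>B \<inter> Z. \<forall>y\<in>B \<inter> Z. dist x y < d1 \<longrightarrow>
        \<bar>jet \<beta> y - tay p (\<lambda>\<gamma>. jet \<gamma> x) x \<beta> y\<bar> \<le> e * dist x y ^ (p - mdeg \<beta>)" by auto
      obtain d2 where d2: "d2 > 0" "\<forall>x\<in>B \<inter> Z. \<forall>y\<in>B \<inter> Z. dist x y < d2 \<longrightarrow>
        \<bar>jet \<beta> y - tay p (\<lambda>\<gamma>. jet \<gamma> x) x \<beta> y\<bar> \<le> e * dist x y ^ (p - mdeg \<beta>)"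
        using each[OF e, of \<beta>] insert.prems by (auto simp: mem_mindex)
      show ?case using d1 d2 by (intro exI[of _ "min d1 d2"]) auto
    qed (auto intro: exI[of _ 1])
    from this[OF finite_mindex order_refl]
    show "\<exists>d>0. \<forall>x\<in>B \<inter> Z. \<forall>y\<in>B \<inter> Z. dist x y < d \<longrightarrow> (\<forall>\<beta>. mdeg \<beta> \<le> p \<longrightarrow>
      \<bar>jet \<beta> y - tay p (\<lambda>\<gamma>. jet \<gamma> x) x \<beta> y\<bar> \<le> e * dist x y ^ (p - mdeg \<beta>))"
      unfolding mem_mindex[symmetric] by blast
  qed
  obtain F where F: "Cp_on p UNIV F" "\<And>x. x \<in> B \<inter> Z \<Longrightarrow> F x = jet (\<lambda>_. 0) x"
    using whitney_extension by blast
  have "F y = f (h y)" if "y \<in> B" "h y \<in> X" for y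
  proof -
    have "y \<in> Z" using that B(3) by (auto simp: Z_def)
    then show ?thesis using F(2)[of y] jet_zero[of y] that(1) by simp
  qed
  then show ?thesis using F(1) by blast
qed

end

subsection \<open>Charts\<close>

lemma subspace_projection:
  fixes L :: "(real^'n::finite) set"
  assumes "subspace L"
  obtains \<pi> :: "real^'n \<Rightarrow> real^'n" where "linear \<pi>" "range \<pi> \<subseteq> L" "\<And>v. v \<in> L \<Longrightarrow> \<pi> v = v"
  using linear_exists_left_inverse_on[OF linear_id assms, of] that by auto

text \<open>A relative interior point \<open>x\<close> of \<open>X\<close> near
  \<open>\<psi> (\<pi> y)\<close> is lifted to a point near \<open>y\<close>. The parametrization
  takes values in \<open>M\<close> and, near the lift, in an open set meeting \<open>M\<close> only
  inside \<open>X\<close>; so the lift is an interior point.\<close>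

lemma parametrized_dense:
  fixes X M :: "(real^'n::finite) set" and \<pi> :: "real^'n \<Rightarrow> real^'n"
  assumes X: "X \<subseteq> M" "X = (top_of_set M) closure_of ((top_of_set M) interior_of X)"
    and U: "open U" "continuous_on U \<phi>" "\<phi> ` (M \<inter> U) = V \<inter> L" "\<And>x. x \<in> U \<Longrightarrow> \<psi> (\<phi> x) = x"
    and \<pi>: "linear \<pi>" "range \<pi> \<subseteq> L" "\<And>v. v \<in> L \<Longrightarrow> \<pi> v = v"
    and W: "W = \<pi> -` V" "open W" "continuous_on W (\<lambda>y. \<psi> (\<pi> y))"
  shows "{y \<in> W. \<psi> (\<pi> y) \<in> X} \<subseteq> closure (interior {y \<in> W. \<psi> (\<pi> y) \<in> X})"
proof
  let ?Z = "{y \<in> W. \<psi> (\<pi> y) \<in> X}"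
  let ?h = "\<lambda>y. \<psi> (\<pi> y)"
  have hM: "?h y \<in> M \<inter> U \<and> \<phi> (?h y) = \<pi> y" if "y \<in> W" for y
  proof -
    have "\<pi> y \<in> V \<inter> L" using that W(1) \<pi>(2) by auto
    then obtain x where "x \<in> M \<inter> U" "\<pi> y = \<phi> x" using U(3) by (metis imageE)
    then show ?thesis using U(4) by auto
  qed
  fix y assume y: "y \<in> ?Z"
  have yh: "?h y \<in> M \<inter> U" "\<phi> (?h y) = \<pi> y" using hM y by auto
  show "y \<in> closure (interior ?Z)"
    unfolding closure_approachable
  proof (intro allI impI)
    fix e :: real assume e: "e > 0"
    have "\<phi> \<midarrow>?h y\<rightarrow> \<phi> (?h y)" using U(1,2) yh(1) by (auto simp: continuous_on_eq_continuous_at isCont_def)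
    then have "\<forall>\<^sub>F x in nhds (?h y). dist (\<phi> x) (\<phi> (?h y)) < e"
      using e by (auto simp: tendsto_at_iff_tendsto_nhds dest: tendstoD)
    moreover have "\<forall>\<^sub>F x in nhds (?h y). x \<in> U" using U(1) yh(1) eventually_nhds by blast
    ultimately have "\<forall>\<^sub>F x in nhds (?h y). x \<in> U \<and> dist (\<phi> x) (\<phi> (?h y)) < e" by eventually_elim simp
    then obtain A where A: "open A" "?h y \<in> A" "\<And>x. x \<in> A \<Longrightarrow> x \<in> U \<and> dist (\<phi> x) (\<phi> (?h y)) < e"
      unfolding eventually_nhds by blast
    have "?h y \<in> (top_of_set M) closure_of ((top_of_set M) interior_of X)" using y X(2) by blast
    moreover have "openin (top_of_set M) (M \<inter> A)" using A(1) by auto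
    ultimately obtain x where x: "x \<in> (top_of_set M) interior_of X" "x \<in> M \<inter> A"
      unfolding in_closure_of using A(2) yh(1) by blast
    obtain T where T: "open T" "(top_of_set M) interior_of X = M \<inter> T"
      using openin_interior_of[of "top_of_set M" X] unfolding openin_open by blast
    have TX: "M \<inter> T \<subseteq> X" using T(2) interior_of_subset by metis
    have xU: "x \<in> U" "dist (\<phi> x) (\<phi> (?h y)) < e" using A(3) x(2) by auto
    have \<phi>x: "\<phi> x \<in> V \<inter> L" using U(3) x(2) xU(1) by blast
    \<comment> \<open>The component of \<open>y\<close> in \<open>L\<close> is replaced by
      \<open>\<phi> x\<close>, that in the kernel of \<open>\<pi>\<close> is kept; so
      \<open>z\<close> is as far from \<open>y\<close> as \<open>\<phi> x\<close> is from
      \<open>\<pi> y\<close>.\<close>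
    define z where "z = y - \<pi> y + \<phi> x"
    have "\<pi> (\<pi> y) = \<pi> y" using \<pi>(2,3) by auto
    then have \<pi>z: "\<pi> z = \<phi> x"
      unfolding z_def using \<pi>(3) \<phi>x by (simp add: linear_add[OF \<pi>(1)] linear_diff[OF \<pi>(1)])
    then have z: "z \<in> W" "?h z = x" using \<phi>x W(1) U(4)[OF xU(1)] by auto
    have "open (W \<inter> ?h -` T)" by (rule continuous_open_preimage[OF W(3,2) T(1)])
    moreover have "W \<inter> ?h -` T \<subseteq> ?Z" using hM TX by auto
    moreover have "z \<in> W \<inter> ?h -` T" using z x(1) T(2) by auto
    ultimately have "z \<in> interior ?Z" using interior_maximal by blast
    moreover have "dist z y < e" using xU(2) yh(2) by (simp add: z_def dist_norm)
    ultimately show "\<exists>z\<in>interior ?Z. dist z y < e" by blast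
  qed
qed

text \<open>Since \<open>\<pi>\<close> fixes \<open>L\<close>, the map \<open>h\<close> inverts
  \<open>\<phi>\<close> on \<open>X \<inter> U\<close>. Composing an extension of the pulled-back
  function with \<open>\<phi>\<close> therefore returns \<open>f\<close> on \<open>X\<close> near
  \<open>m\<close>.\<close>

lemma chart_extension:
  fixes X M :: "(real^'n::finite) set"
  assumes "closed X" "X \<subseteq> M" "Cp_submanifold p M"
    and "X = (top_of_set M) closure_of ((top_of_set M) interior_of X)"
    and uniq: "\<And>c l. (c, \<lambda>_. 0, l) \<in> PhiN p X f (p + 2) \<Longrightarrow> l = 0" and "m \<in> X"
  shows "\<exists>U F. open U \<and> m \<in> U \<and> Ck p U F \<and> (\<forall>x\<in>X \<inter> U. F x = f x)"
proof -
  obtain U V \<phi> L where U: "m \<in> U" "Cp_diffeo p U V \<phi>" "subspace L" "\<phi> ` (M \<inter> U) = V \<inter> L"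
    using assms(2,3,6) unfolding Cp_submanifold_def by blast
  then have oU: "open U" and oV: "open V" and C\<phi>: "Cp_map_on p U \<phi>"
    unfolding Cp_diffeo_def by blast+
  obtain \<psi> where \<psi>: "Cp_map_on p V \<psi>" "\<And>x. x \<in> U \<Longrightarrow> \<psi> (\<phi> x) = x"
    using U(2) unfolding Cp_diffeo_def by blast
  obtain \<pi> where \<pi>: "linear \<pi>" "range \<pi> \<subseteq> L" "\<And>v. v \<in> L \<Longrightarrow> \<pi> v = v"
    using subspace_projection[OF U(3)] by blast
  have Ck\<phi>: "Ck p U (\<lambda>x. \<phi> x $ j)" for j using C\<phi> Cp_on_iff_Ck[OF oU] unfolding Cp_map_on_def by blast
  have Ck\<psi>: "Ck p V (\<lambda>x. \<psi> x $ j)" for j using \<psi>(1) Cp_on_iff_Ck[OF oV] unfolding Cp_map_on_def by blast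
  have c\<phi>: "continuous_on U \<phi>" by (intro continuous_on_vec_components Ck_imp_continuous_on[OF Ck\<phi>])
  define W where "W = \<pi> -` V"
  have oW: "open W"
    unfolding W_def using oV by (rule open_vimage) (simp add: linear_continuous_on linear_linear \<pi>(1))
  define h where "h y = \<psi> (\<pi> y)" for y
  have Ck_h: "Ck p W (\<lambda>y. h y $ j)" for j
    unfolding h_def
  proof (rule Ck_compose[OF oW oV _ Ck\<psi>])
    show "\<pi> ` W \<subseteq> V" by (auto simp: W_def)
    show "Ck p W (\<lambda>x. \<pi> x $ j)" for j
      using \<pi>(1) by (intro Ck_subset[OF Ck_bounded_linear subset_UNIV] bounded_linear_compose[OF bounded_linear_vec_nth])
        (simp add: linear_linear)
  qed
  have ch: "continuous_on W h" by (intro continuous_on_vec_components Ck_imp_continuous_on[OF Ck_h])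
  have "\<forall>\<kappa>. \<exists>D. (\<forall>y\<in>W. D (\<lambda>_. 0) y = (\<Prod>i\<in>UNIV. (h y $ i) ^ \<kappa> i)) \<and> jetfam p W D"
  proof
    fix \<kappa> :: "'n \<Rightarrow> nat"
    have "Ck p W (\<lambda>y. \<Prod>i\<in>UNIV. (h y $ i) ^ \<kappa> i)" by (intro Ck_prod Ck_power Ck_h oW)
    then show "\<exists>D. (\<forall>y\<in>W. D (\<lambda>_. 0) y = (\<Prod>i\<in>UNIV. (h y $ i) ^ \<kappa> i)) \<and> jetfam p W D"
      unfolding Cp_on_iff_Ck[OF oW, symmetric] Cp_on_iff_jetfam .
  qed
  from this[unfolded choice_iff] obtain DD where DD: "\<And>\<kappa> y. y \<in> W \<Longrightarrow> DD \<kappa> (\<lambda>_. 0) y = (\<Prod>i\<in>UNIV. (h y $ i) ^ \<kappa> i)"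
     "\<And>\<kappa>. jetfam p W (DD \<kappa>)" by blast
  interpret parametrized X f p W h DD
  proof
    show "{y \<in> W. h y \<in> X} \<subseteq> closure (interior {y \<in> W. h y \<in> X})"
      unfolding h_def
      by (rule parametrized_dense[OF assms(2,4) oU c\<phi> U(4) \<psi>(2) \<pi> W_def oW]) (use ch in \<open>simp_all add: h_def[abs_def]\<close>)
  qed (use oW Ck_h DD uniq in auto)
  have \<phi>L: "\<phi> x \<in> V \<inter> L" if "x \<in> X \<inter> U" for x using that U(4) assms(2) by blast
  have "\<phi> m \<in> W" using \<phi>L[of m] \<pi>(3) U(1) assms(6) by (simp add: W_def)
  then obtain r where r: "r > 0" "cball (\<phi> m) r \<subseteq> W" using oW open_contains_cball by blast
  obtain F where F: "Cp_on p UNIV F" "\<And>y. y \<in> cball (\<phi> m) r \<Longrightarrow> h y \<in> X \<Longrightarrow> F y = f (h y)"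
    using local_extension[OF compact_cball convex_cball r(2) assms(1)] by blast
  let ?U = "U \<inter> \<phi> -` ball (\<phi> m) r"
  have oU': "open ?U" by (rule continuous_open_preimage[OF c\<phi> oU open_ball])
  have "Ck p ?U (\<lambda>x. F (\<phi> x))"
  proof (rule Ck_compose[OF oU' open_UNIV])
    show "Ck p UNIV F" using F(1) Cp_on_iff_Ck[OF open_UNIV] by blast
    show "Ck p ?U (\<lambda>x. \<phi> x $ j)" for j by (rule Ck_subset[OF Ck\<phi>]) auto
  qed simp
  moreover have "F (\<phi> x) = f x" if "x \<in> X \<inter> ?U" for x
  proof -
    have "h (\<phi> x) = x" using \<phi>L[of x] \<pi>(3) \<psi>(2)[of x] that by (simp add: h_def)
    then show ?thesis using F(2)[of "\<phi> x"] that by auto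
  qed
  ultimately show ?thesis using oU' U(1) r(1) by (intro exI[of _ ?U] exI[of _ "\<lambda>x. F (\<phi> x)"]) auto
qed

section \<open>Counting stages and conclusion\<close>

lemma zero_in_iterates:
  assumes "a \<in> X"
  shows "(a, \<lambda>_. 0) \<in> (rhoE p X ^^ i) (E0 p X)"
proof (cases i)
  case 0
  then show ?thesis using assms by (auto simp: E0_def intro!: exI[of _ 0])
next
  case (Suc j)
  have "(\<lambda>_. 0) \<in> lspan S" for S :: "(('a \<Rightarrow> nat) \<Rightarrow> real) set"
    unfolding lspan_def by (auto intro!: exI[of _ "{}"])
  then show ?thesis using Suc assms by (simp add: rhoE_def)
qed

text \<open>Multi-indices supported on one coordinate already number \<open>p + 1\<close>. This
  places stage \<open>p + 2\<close> below the number of iterations in \<open>nabla\<close>.\<close>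

lemma card_mindex_gt: "p < card (mindex p :: ('n::finite \<Rightarrow> nat) set)"
proof -
  obtain i :: 'n where True by simp
  let ?g = "\<lambda>k. (\<lambda>_. 0)(i := k) :: 'n \<Rightarrow> nat"
  have "mdeg (?g k) = k" for k by (simp add: mdeg_def)
  then have "?g ` {..p} \<subseteq> mindex p" by (auto simp: mem_mindex)
  moreover have "inj_on ?g {..p}" by (auto simp: inj_on_def fun_eq_iff split: if_splits)
  ultimately have "card {..p} \<le> card (mindex p :: ('n \<Rightarrow> nat) set)" by (intro card_inj_on_le) auto
  then show ?thesis by simp
qed

theorem theorem1p2:
  fixes X M :: "(real^'n::finite) set" and p :: nat and f :: "real^'n \<Rightarrow> real"
  assumes "closed X"
    and "X \<subseteq> M"
    and "Cp_submanifold p M"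
    and "X = (top_of_set M) closure_of ((top_of_set M) interior_of X)"
  shows "(\<exists>F. Cp_on p UNIV F \<and> (\<forall>x\<in>X. F x = f x)) \<longleftrightarrow>
         (\<forall>a\<in>X. \<forall>\<xi>\<in>fibre (tau p X) a. \<exists>!l. (a, \<xi>, l) \<in> nabla p X f)"
proof
  assume "\<exists>F. Cp_on p UNIV F \<and> (\<forall>x\<in>X. F x = f x)"
  then obtain F where "Cp_on p UNIV F" "\<And>x. x \<in> X \<Longrightarrow> F x = f x" by blast
  then show "\<forall>a\<in>X. \<forall>\<xi>\<in>fibre (tau p X) a. \<exists>!l. (a, \<xi>, l) \<in> nabla p X f"
    using nabla_function_of_extension by blast
next
  assume fn: "\<forall>a\<in>X. \<forall>\<xi>\<in>fibre (tau p X) a. \<exists>!l. (a, \<xi>, l) \<in> nabla p X f"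
  define N where "N = 2 * (card (mindex p :: ('n \<Rightarrow> nat) set) + 1)"
  have nabla: "nabla p X f = PhiN p X f N" by (simp add: nabla_def PhiN_def N_def)
  have "l = 0" if l: "(c, \<lambda>_. 0, l) \<in> PhiN p X f (p + 2)" for c l
  proof -
    have c: "c \<in> X" using l PhiN_base by blast
    have "p + 2 \<le> N" using card_mindex_gt[of p, where 'n = 'n] unfolding N_def by simp
    then have "(c, \<lambda>_. 0, l) \<in> nabla p X f" using PhiN_mono[of "p + 2" N p X f] l nabla by blast
    moreover have "(c, \<lambda>_. 0, 0) \<in> nabla p X f" unfolding nabla by (rule PhiN_zero[OF c])
    \<comment> \<open>The hypothesis speaks only of functionals in \<open>tau\<close>; zero lies in
      every fibre, so \<open>l\<close> and 0 are values over the same admissible functional.\<close>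
    moreover have "(\<lambda>_. 0) \<in> fibre (tau p X) c"
      unfolding fibre_def tau_def using zero_in_iterates[OF c] by blast
    ultimately show ?thesis using fn c by blast
  qed
  then have "\<exists>F. Ck p UNIV F \<and> (\<forall>x\<in>X. F x = f x)"
    by (intro local_extension_global assms(1) chart_extension[OF assms])
  then show "\<exists>F. Cp_on p UNIV F \<and> (\<forall>x\<in>X. F x = f x)" using Cp_on_iff_Ck[OF open_UNIV] by blast
qed

end
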